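(* Let $D$ be a Douglas algebra. Then the set of $hk$-continuity points for $D$ is equal to the Shilov boundary $\partial D$ of $D$.
   Context: Let $\mathbb T$ be the unit circle, $L^\infty(\mathbb T)$ the algebra of (equivalence classes of) essentially bounded measurable functions on $\mathbb T$ with the essential supremum norm, and $H^\infty(\mathbb T)$ the closed subalgebra of those functions in $L^\infty(\mathbb T)$ whose negative Fourier coefficients vanish. A Douglas algebra is a closed subalgebra of $L^\infty(\mathbb T)$ that strictly contains $H^\infty(\mathbb T)$. For a commutative unital semisimple Banach algebra $A$, $M(A)$ denotes its character space (all non-zero multiplicative linear functionals) with the Gelfand (weak-$*$) topology, and elements $f\in A$ are identified with their Gelfand transforms, i.e. with continuous functions on $M(A)$. The Shilov boundary $\partial A$ is the smallest closed subset of $M(A)$ on which every $f\in A$ attains its maximum modulus. For $E\subseteq M(A)$ put $I_A(E)=\{f\in A: f\equiv 0\text{ on }E\}$, and for an ideal $J$ of $A$ put $Z_A(J)=\{x\in M(A): f(x)=0\text{ for all }f\in J\}$. The hull-kernel topology on $M(A)$ is the topology whose closed sets are the sets $E\subseteq M(A)$ with $E=Z_A(I_A(E))$. A point $x\in M(A)$ is an $hk$-continuity point for $A$ if the identity map from $M(A)$ with the hull-kernel topology to $M(A)$ with the Gelfand topology is continuous at $x$. *)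

theory Defs
  imports "HOL-Analysis.Analysis" "HOL-Probability.Essential_Supremum"
begin

section \<open>Commutative unital complex normed algebras and their characters\<close>

class complex_normed_comm_algebra_1 = real_normed_algebra_1 + comm_ring_1 +
  fixes scaleC :: "complex \<Rightarrow> 'a \<Rightarrow> 'a" (infixr \<open>*\<^sub>C\<close> 75)
  assumes scaleC_add_right: "c *\<^sub>C (x + y) = c *\<^sub>C x + c *\<^sub>C y"
    and scaleC_add_left: "(c + d) *\<^sub>C x = c *\<^sub>C x + d *\<^sub>C x"
    and scaleC_scaleC: "c *\<^sub>C (d *\<^sub>C x) = (c * d) *\<^sub>C x"
    and scaleC_mult_left: "(c *\<^sub>C x) * y = c *\<^sub>C (x * y)"
    and scaleC_complex_of_real: "complex_of_real r *\<^sub>C x = r *\<^sub>R x"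
    and norm_scaleC: "norm (c *\<^sub>C x) = cmod c * norm x"

definition complex_subalgebra :: "'a::complex_normed_comm_algebra_1 set \<Rightarrow> bool" where
  "complex_subalgebra A \<longleftrightarrow>
     0 \<in> A \<and> (\<forall>f\<in>A. \<forall>g\<in>A. f + g \<in> A \<and> f * g \<in> A) \<and> (\<forall>c. \<forall>f\<in>A. c *\<^sub>C f \<in> A)"

text \<open>
  A Banach algebra is given as a subalgebra \<open>A\<close> of an ambient algebra. A functional on \<open>A\<close> is a
  function on the ambient type that takes the value \<open>undefined\<close> outside \<open>A\<close>, so that two
  functionals are equal iff they agree on \<open>A\<close>. The Gelfand transform of \<open>f\<close> is \<open>\<lambda>x. x f\<close>.
\<close>

definition characters :: "'a::complex_normed_comm_algebra_1 set \<Rightarrow> ('a \<Rightarrow> complex) set" where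
  "characters A = {x \<in> extensional A.
     (\<forall>f\<in>A. \<forall>g\<in>A. x (f + g) = x f + x g \<and> x (f * g) = x f * x g) \<and>
     (\<forall>c. \<forall>f\<in>A. x (c *\<^sub>C f) = c * x f) \<and>
     (\<exists>f\<in>A. x f \<noteq> 0)}"

definition gelfand_topology ::
    "'a::complex_normed_comm_algebra_1 set \<Rightarrow> ('a \<Rightarrow> complex) topology" where
  "gelfand_topology A = subtopology (product_topology (\<lambda>_. euclidean) A) (characters A)"

lemma topspace_gelfand_topology [simp]: "topspace (gelfand_topology A) = characters A"
  by (auto simp: gelfand_topology_def characters_def PiE_def)

definition closed_boundary ::
    "'a::complex_normed_comm_algebra_1 set \<Rightarrow> ('a \<Rightarrow> complex) set \<Rightarrow> bool" where
  "closed_boundary A E \<longleftrightarrow> closedin (gelfand_topology A) E \<and>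
     (\<forall>f\<in>A. \<exists>x\<in>E. \<forall>y\<in>characters A. cmod (y f) \<le> cmod (x f))"

text \<open>\<open>LEAST\<close> is with respect to inclusion.\<close>

definition shilov_boundary ::
    "'a::complex_normed_comm_algebra_1 set \<Rightarrow> ('a \<Rightarrow> complex) set" where
  "shilov_boundary A = (LEAST E. closed_boundary A E)"


section \<open>The hull-kernel topology\<close>

definition vanishing_ideal ::
    "'a::complex_normed_comm_algebra_1 set \<Rightarrow> ('a \<Rightarrow> complex) set \<Rightarrow> 'a set" where
  "vanishing_ideal A E = {f \<in> A. \<forall>x\<in>E. x f = 0}"

definition hull_set ::
    "'a::complex_normed_comm_algebra_1 set \<Rightarrow> 'a set \<Rightarrow> ('a \<Rightarrow> complex) set" where
  "hull_set A J = {x \<in> characters A. \<forall>f\<in>J. x f = 0}"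

definition hk_closed ::
    "'a::complex_normed_comm_algebra_1 set \<Rightarrow> ('a \<Rightarrow> complex) set \<Rightarrow> bool" where
  "hk_closed A E \<longleftrightarrow> E = hull_set A (vanishing_ideal A E)"

definition hk_topology ::
    "'a::complex_normed_comm_algebra_1 set \<Rightarrow> ('a \<Rightarrow> complex) topology" where
  "hk_topology A = topology (\<lambda>U. U \<subseteq> characters A \<and> hk_closed A (characters A - U))"

lemma hk_closedI:
  assumes "E \<subseteq> characters A"
    and "\<And>x. x \<in> characters A \<Longrightarrow> x \<notin> E \<Longrightarrow> \<exists>f\<in>A. (\<forall>y\<in>E. y f = 0) \<and> x f \<noteq> 0"
  shows "hk_closed A E"
  using assms unfolding hk_closed_def hull_set_def vanishing_ideal_def by blast

lemma hk_closedD: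
  assumes "hk_closed A E" "x \<in> characters A" "x \<notin> E"
  shows "\<exists>f\<in>A. (\<forall>y\<in>E. y f = 0) \<and> x f \<noteq> 0"
  using assms unfolding hk_closed_def hull_set_def vanishing_ideal_def by blast

lemma istopology_hk:
  assumes A: "complex_subalgebra A"
  shows "istopology (\<lambda>U. U \<subseteq> characters A \<and> hk_closed A (characters A - U))"
  unfolding istopology_def
proof (intro conjI allI impI)
  fix S T
  assume S: "S \<subseteq> characters A \<and> hk_closed A (characters A - S)"
    and T: "T \<subseteq> characters A \<and> hk_closed A (characters A - T)"
  show "S \<inter> T \<subseteq> characters A" using S by blast
  show "hk_closed A (characters A - S \<inter> T)"
  proof (rule hk_closedI)
    fix x assume x: "x \<in> characters A" "x \<notin> characters A - S \<inter> T"
    obtain f where f: "f \<in> A" "\<forall>y\<in>characters A - S. y f = 0" "x f \<noteq> 0"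
      using hk_closedD[of A "characters A - S" x] S x by auto
    obtain g where g: "g \<in> A" "\<forall>y\<in>characters A - T. y g = 0" "x g \<noteq> 0"
      using hk_closedD[of A "characters A - T" x] T x by auto
    have mult: "y (f * g) = y f * y g" if "y \<in> characters A" for y
      using that f(1) g(1) by (auto simp: characters_def)
    have vanish: "y (f * g) = 0" if y: "y \<in> characters A" "y \<notin> S \<inter> T" for y
    proof -
      have "y f = 0 \<or> y g = 0" using f(2) g(2) y by blast
      then show ?thesis using mult[OF y(1)] by auto
    qed
    have "f * g \<in> A" using A f(1) g(1) by (auto simp: complex_subalgebra_def)
    moreover have "\<forall>y\<in>characters A - S \<inter> T. y (f * g) = 0"
      using vanish by blast
    moreover have "x (f * g) \<noteq> 0" using f(3) g(3) mult[OF x(1)] by auto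
    ultimately show "\<exists>h\<in>A. (\<forall>y\<in>characters A - S \<inter> T. y h = 0) \<and> x h \<noteq> 0" by blast
  qed blast
next
  fix K assume K: "\<forall>U\<in>K. U \<subseteq> characters A \<and> hk_closed A (characters A - U)"
  show "\<Union>K \<subseteq> characters A" using K by blast
  show "hk_closed A (characters A - \<Union>K)"
  proof (rule hk_closedI)
    fix x assume x: "x \<in> characters A" "x \<notin> characters A - \<Union>K"
    then obtain U where U: "U \<in> K" "x \<in> U" by blast
    then obtain f where "f \<in> A" "\<forall>y\<in>characters A - U. y f = 0" "x f \<noteq> 0"
      using hk_closedD[of A "characters A - U" x] K x by auto
    then show "\<exists>f\<in>A. (\<forall>y\<in>characters A - \<Union>K. y f = 0) \<and> x f \<noteq> 0" using U by blast
  qed blast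
qed

lemma openin_hk_topology:
  assumes "complex_subalgebra A"
  shows "openin (hk_topology A) U \<longleftrightarrow> U \<subseteq> characters A \<and> hk_closed A (characters A - U)"
  by (simp add: hk_topology_def topology_inverse'[OF istopology_hk[OF assms]])

lemma topspace_hk_topology:
  assumes "complex_subalgebra A"
  shows "topspace (hk_topology A) = characters A"
proof -
  have "hk_closed A (characters A - characters A)"
    by (rule hk_closedI) (auto simp: characters_def)
  then have "openin (hk_topology A) (characters A)"
    by (simp add: openin_hk_topology[OF assms])
  then show ?thesis
    using openin_subset openin_topspace openin_hk_topology[OF assms] by blast
qed

lemma closedin_hk_topology:
  assumes "complex_subalgebra A"
  shows "closedin (hk_topology A) E \<longleftrightarrow> hk_closed A E"
proof -
  have "E \<subseteq> characters A" if "hk_closed A E"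
    using that by (auto simp: hk_closed_def hull_set_def)
  then show ?thesis
    by (auto simp: closedin_def topspace_hk_topology[OF assms] openin_hk_topology[OF assms]
        double_diff)
qed

definition hk_continuity_points ::
    "'a::complex_normed_comm_algebra_1 set \<Rightarrow> ('a \<Rightarrow> complex) set" where
  "hk_continuity_points A =
     {x \<in> characters A. topcontinuous_at (hk_topology A) (gelfand_topology A) id x}"


section \<open>The algebra \<open>L\<^sup>\<infinity>\<close> of the unit circle\<close>

text \<open>Normalized arc length measure on the unit circle:\<close>

definition circle_measure :: "complex measure" where
  "circle_measure =
     distr (uniform_measure lborel {0..2 * pi}) (restrict_space borel (sphere 0 1)) cis"

lemma sets_circle_measure [measurable_cong]:
  "sets circle_measure = sets (restrict_space borel (sphere 0 1))"
  by (simp add: circle_measure_def)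

lemma space_circle_measure: "space circle_measure = sphere 0 1"
  by (simp add: circle_measure_def space_restrict_space)

lemma emeasure_circle_measure: "emeasure circle_measure (space circle_measure) = 1"
proof -
  have cis: "cis \<in> borel \<rightarrow>\<^sub>M borel"
    by (intro borel_measurable_continuous_onI continuous_intros)
  have "cis \<in> uniform_measure lborel {0..2 * pi} \<rightarrow>\<^sub>M restrict_space borel (sphere 0 1)"
    by (rule measurable_restrict_space2) (use cis in \<open>auto simp: measurable_lborel2\<close>)
  moreover have "emeasure (uniform_measure lborel {0..2 * pi}) UNIV = 1"
    by (subst emeasure_uniform_measure)
       (auto simp: ennreal_divide_self)
  moreover have "cis -` sphere 0 1 = UNIV" by auto
  ultimately show ?thesis
    unfolding space_circle_measure unfolding circle_measure_def
    by (subst emeasure_distr) (auto simp: sets_restrict_space)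
qed

definition ess_bounded :: "(complex \<Rightarrow> complex) \<Rightarrow> bool" where
  "ess_bounded f \<longleftrightarrow> f \<in> borel_measurable circle_measure \<and>
     esssup circle_measure (\<lambda>z. ereal (cmod (f z))) < \<infinity>"

lemma esssup_le_iff:
  assumes "f \<in> borel_measurable circle_measure"
  shows "esssup circle_measure (\<lambda>z. ereal (cmod (f z))) \<le> ereal c \<longleftrightarrow>
    (AE z in circle_measure. cmod (f z) \<le> c)"
proof
  assume "esssup circle_measure (\<lambda>z. ereal (cmod (f z))) \<le> ereal c"
  then show "AE z in circle_measure. cmod (f z) \<le> c"
    using esssup_AE[where M = circle_measure and f = "\<lambda>z. ereal (cmod (f z))"]
    by (auto elim!: eventually_mono dest: order_trans)
next
  assume "AE z in circle_measure. cmod (f z) \<le> c"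
  then show "esssup circle_measure (\<lambda>z. ereal (cmod (f z))) \<le> ereal c"
    using assms by (intro esssup_I) auto
qed

lemma esssup_nonneg:
  assumes "f \<in> borel_measurable circle_measure"
  shows "0 \<le> esssup circle_measure (\<lambda>z. ereal (cmod (f z)))"
proof -
  have "0 = esssup circle_measure (\<lambda>z. 0 :: ereal)"
    by (simp add: esssup_const emeasure_circle_measure)
  also have "\<dots> \<le> esssup circle_measure (\<lambda>z. ereal (cmod (f z)))"
    using assms by (intro esssup_mono) auto
  finally show ?thesis .
qed

lemma ess_bounded_iff:
  "ess_bounded f \<longleftrightarrow> f \<in> borel_measurable circle_measure \<and>
     (\<exists>c. AE z in circle_measure. cmod (f z) \<le> c)"
proof -
  have "esssup circle_measure (\<lambda>z. ereal (cmod (f z))) < \<infinity> \<longleftrightarrow>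
      (\<exists>c. AE z in circle_measure. cmod (f z) \<le> c)"
    if f: "f \<in> borel_measurable circle_measure"
  proof -
    have "esssup circle_measure (\<lambda>z. ereal (cmod (f z))) < \<infinity> \<longleftrightarrow>
        (\<exists>c. esssup circle_measure (\<lambda>z. ereal (cmod (f z))) \<le> ereal c)"
      using esssup_nonneg[OF f]
      by (cases "esssup circle_measure (\<lambda>z. ereal (cmod (f z)))") auto
    then show ?thesis using esssup_le_iff[OF f] by simp
  qed
  then show ?thesis unfolding ess_bounded_def by blast
qed

lemma ess_bounded_const: "ess_bounded (\<lambda>_. c)"
  unfolding ess_bounded_iff by auto

lemma ess_bounded_add:
  assumes "ess_bounded f" "ess_bounded g" shows "ess_bounded (\<lambda>z. f z + g z)"
proof -
  obtain c d where c: "AE z in circle_measure. cmod (f z) \<le> c"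
    and d: "AE z in circle_measure. cmod (g z) \<le> d"
    using assms unfolding ess_bounded_iff by blast
  from c d have "AE z in circle_measure. cmod (f z + g z) \<le> c + d"
    by eventually_elim (intro norm_triangle_mono)
  then show ?thesis using assms unfolding ess_bounded_iff by auto
qed

lemma ess_bounded_mult:
  assumes "ess_bounded f" "ess_bounded g" shows "ess_bounded (\<lambda>z. f z * g z)"
proof -
  obtain c d where c: "AE z in circle_measure. cmod (f z) \<le> c"
    and d: "AE z in circle_measure. cmod (g z) \<le> d"
    using assms unfolding ess_bounded_iff by blast
  from c d have "AE z in circle_measure. cmod (f z * g z) \<le> c * d"
    by eventually_elim (auto simp: norm_mult intro!: mult_mono intro: order_trans[OF norm_ge_zero])
  then show ?thesis using assms unfolding ess_bounded_iff by auto
qed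

quotient_type linf = "complex \<Rightarrow> complex" / partial:
  "\<lambda>f g. ess_bounded f \<and> ess_bounded g \<and> (AE z in circle_measure. f z = g z)"
proof (rule part_equivpI)
  show "\<exists>f. ess_bounded f \<and> ess_bounded f \<and> (AE z in circle_measure. f z = f z)"
    using ess_bounded_const by auto
  show "symp (\<lambda>f g. ess_bounded f \<and> ess_bounded g \<and> (AE z in circle_measure. f z = g z))"
    by (auto intro!: sympI elim: eventually_mono)
  show "transp (\<lambda>f g. ess_bounded f \<and> ess_bounded g \<and> (AE z in circle_measure. f z = g z))"
    by (rule transpI) (auto elim: eventually_elim2)
qed

lift_definition linf_norm :: "linf \<Rightarrow> real" is
  "\<lambda>f. real_of_ereal (esssup circle_measure (\<lambda>z. ereal (cmod (f z))))"
  by (rule arg_cong[where f = real_of_ereal], rule esssup_AE_cong)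
     (auto simp: ess_bounded_def elim: eventually_mono)

lift_definition linf_scaleC :: "complex \<Rightarrow> linf \<Rightarrow> linf" is "\<lambda>c f z. c * f z"
  by (auto intro: ess_bounded_mult ess_bounded_const elim: eventually_mono)

instantiation linf :: comm_ring_1
begin

lift_definition zero_linf :: linf is "\<lambda>_. 0"
  by (simp add: ess_bounded_const)

lift_definition one_linf :: linf is "\<lambda>_. 1"
  by (simp add: ess_bounded_const)

lift_definition plus_linf :: "linf \<Rightarrow> linf \<Rightarrow> linf" is "\<lambda>f g z. f z + g z"
  by (auto intro: ess_bounded_add elim: eventually_elim2)

lift_definition times_linf :: "linf \<Rightarrow> linf \<Rightarrow> linf" is "\<lambda>f g z. f z * g z"
  by (auto intro: ess_bounded_mult elim: eventually_elim2)

definition uminus_linf :: "linf \<Rightarrow> linf" where "uminus_linf f = linf_scaleC (-1) f"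

definition minus_linf :: "linf \<Rightarrow> linf \<Rightarrow> linf" where "minus_linf f g = f + (- g)"

instance
proof
  fix a b c :: linf
  show "a + b + c = a + (b + c)"
    by transfer (auto intro!: ess_bounded_add simp: add.assoc)
  show "a + b = b + a"
    by transfer (auto intro!: ess_bounded_add simp: add.commute)
  show "0 + a = a"
    by transfer auto
  show "- a + a = 0"
    unfolding uminus_linf_def
    by transfer (auto intro!: ess_bounded_const)
  show "a - b = a + - b"
    by (simp add: minus_linf_def)
  show "a * b * c = a * (b * c)"
    by transfer (auto intro!: ess_bounded_mult simp: mult.assoc)
  show "a * b = b * a"
    by transfer (auto intro!: ess_bounded_mult simp: mult.commute)
  show "1 * a = a"
    by transfer auto
  show "(a + b) * c = a * c + b * c"
    by transfer (auto intro!: ess_bounded_mult ess_bounded_add simp: distrib_right)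
  show "(0::linf) \<noteq> 1"
  proof (transfer, clarsimp)
    assume "AE z in circle_measure. False"
    then show False
      using emeasure_circle_measure by (simp add: AE_iff_null null_sets_def)
  qed
qed

end

lemma linf_norm_nonneg: "0 \<le> linf_norm f"
  by transfer (auto simp: ess_bounded_def intro!: real_of_ereal_pos esssup_nonneg)

lemma linf_norm_le_iff:
  assumes "ess_bounded f"
  shows "real_of_ereal (esssup circle_measure (\<lambda>z. ereal (cmod (f z)))) \<le> c \<longleftrightarrow>
    (AE z in circle_measure. cmod (f z) \<le> c)"
proof -
  have f: "f \<in> borel_measurable circle_measure" using assms by (simp add: ess_bounded_def)
  show ?thesis
    using esssup_nonneg[OF f] assms esssup_le_iff[OF f, of c] unfolding ess_bounded_def
    by (cases "esssup circle_measure (\<lambda>z. ereal (cmod (f z)))") auto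
qed

lemma linf_norm_AE:
  assumes "ess_bounded f"
  shows "AE z in circle_measure.
    cmod (f z) \<le> real_of_ereal (esssup circle_measure (\<lambda>w. ereal (cmod (f w))))"
  using linf_norm_le_iff[OF assms] by blast

lemma linf_norm_scaleC_le: "linf_norm (linf_scaleC c f) \<le> cmod c * linf_norm f"
proof transfer
  fix c f assume "ess_bounded f \<and> ess_bounded f \<and> (AE z in circle_measure. f z = f z)"
  then have f: "ess_bounded f" by simp
  have "AE z in circle_measure. cmod (c * f z) \<le>
      cmod c * real_of_ereal (esssup circle_measure (\<lambda>z. ereal (cmod (f z))))"
    using linf_norm_AE[OF f] by eventually_elim (auto simp: norm_mult intro: mult_left_mono)
  then show "real_of_ereal (esssup circle_measure (\<lambda>z. ereal (cmod (c * f z))))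
      \<le> cmod c * real_of_ereal (esssup circle_measure (\<lambda>z. ereal (cmod (f z))))"
    using linf_norm_le_iff[OF ess_bounded_mult[OF ess_bounded_const f]] by blast
qed

lemma linf_scaleC_scaleC: "linf_scaleC c (linf_scaleC d f) = linf_scaleC (c * d) f"
  by transfer (auto intro!: ess_bounded_mult ess_bounded_const simp: mult.assoc)

lemma linf_scaleC_one: "linf_scaleC 1 f = f"
  by transfer auto

lemma linf_norm_zero_iff: "linf_norm f = 0 \<longleftrightarrow> f = 0"
proof -
  have "linf_norm f \<le> 0 \<longleftrightarrow> f = 0"
    by transfer (simp add: linf_norm_le_iff ess_bounded_const del: real_of_ereal_le_0)
  then show ?thesis using linf_norm_nonneg[of f] by linarith
qed

lemma linf_norm_scaleC: "linf_norm (linf_scaleC c f) = cmod c * linf_norm f"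
proof (cases "c = 0")
  case True
  then show ?thesis
    using linf_norm_scaleC_le[of c f] linf_norm_nonneg[of "linf_scaleC c f"] by simp
next
  case False
  have "linf_norm f = linf_norm (linf_scaleC (inverse c) (linf_scaleC c f))"
    using False by (simp add: linf_scaleC_scaleC linf_scaleC_one)
  also have "\<dots> \<le> cmod (inverse c) * linf_norm (linf_scaleC c f)"
    by (rule linf_norm_scaleC_le)
  finally have "cmod c * linf_norm f \<le> linf_norm (linf_scaleC c f)"
    using False by (simp add: norm_inverse norm_divide field_simps)
  then show ?thesis using linf_norm_scaleC_le[of c f] by linarith
qed

instantiation linf :: complex_normed_comm_algebra_1
begin

definition scaleC_linf :: "complex \<Rightarrow> linf \<Rightarrow> linf" where "scaleC_linf = linf_scaleC"

definition scaleR_linf :: "real \<Rightarrow> linf \<Rightarrow> linf" where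
  "scaleR_linf r = linf_scaleC (complex_of_real r)"

definition norm_linf :: "linf \<Rightarrow> real" where "norm_linf = linf_norm"

definition dist_linf :: "linf \<Rightarrow> linf \<Rightarrow> real" where "dist_linf f g = norm (f - g)"

definition sgn_linf :: "linf \<Rightarrow> linf" where "sgn_linf f = inverse (norm f) *\<^sub>R f"

definition uniformity_linf :: "(linf \<times> linf) filter" where
  "uniformity_linf = (INF e\<in>{0 <..}. principal {(f, g). dist f g < e})"

definition open_linf :: "linf set \<Rightarrow> bool" where
  "open_linf U \<longleftrightarrow> (\<forall>f\<in>U. eventually (\<lambda>(f', g). f' = f \<longrightarrow> g \<in> U) uniformity)"

instance
proof
  fix f g :: linf and a b :: real and c d :: complex and U :: "linf set"
  have add_right: "linf_scaleC c (f + g) = linf_scaleC c f + linf_scaleC c g" for c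
    by transfer (auto intro!: ess_bounded_mult ess_bounded_const ess_bounded_add simp: distrib_left)
  have add_left: "linf_scaleC (c + d) f = linf_scaleC c f + linf_scaleC d f" for c d
    by transfer (auto intro!: ess_bounded_mult ess_bounded_const ess_bounded_add simp: distrib_right)
  have mult_left: "linf_scaleC c f * g = linf_scaleC c (f * g)" for c f g
    by transfer (auto intro!: ess_bounded_mult ess_bounded_const simp: mult.assoc)
  show "a *\<^sub>R (f + g) = a *\<^sub>R f + a *\<^sub>R g" by (simp add: scaleR_linf_def add_right)
  show "(a + b) *\<^sub>R f = a *\<^sub>R f + b *\<^sub>R f" by (simp add: scaleR_linf_def add_left)
  show "a *\<^sub>R b *\<^sub>R f = (a * b) *\<^sub>R f" by (simp add: scaleR_linf_def linf_scaleC_scaleC)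
  show "1 *\<^sub>R f = f" by (simp add: scaleR_linf_def linf_scaleC_one)
  show "a *\<^sub>R f * g = a *\<^sub>R (f * g)" by (simp add: scaleR_linf_def mult_left)
  show "f * a *\<^sub>R g = a *\<^sub>R (f * g)"
    by (simp add: scaleR_linf_def mult.commute[of f] mult_left)
  show "dist f g = norm (f - g)" by (rule dist_linf_def)
  show "sgn f = inverse (norm f) *\<^sub>R f" by (rule sgn_linf_def)
  show "uniformity = (INF e\<in>{0 <..}. principal {(f, g :: linf). dist f g < e})"
    by (rule uniformity_linf_def)
  show "open U \<longleftrightarrow> (\<forall>f\<in>U. eventually (\<lambda>(f', g). f' = f \<longrightarrow> g \<in> U) uniformity)"
    by (rule open_linf_def)
  show "norm f = 0 \<longleftrightarrow> f = 0" by (simp add: norm_linf_def linf_norm_zero_iff)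
  show "norm (f + g) \<le> norm f + norm g"
    unfolding norm_linf_def
  proof transfer
    fix f g assume "ess_bounded f \<and> ess_bounded f \<and> (AE z in circle_measure. f z = f z)"
      "ess_bounded g \<and> ess_bounded g \<and> (AE z in circle_measure. g z = g z)"
    then have f: "ess_bounded f" and g: "ess_bounded g" by auto
    have "AE z in circle_measure. cmod (f z + g z) \<le>
        real_of_ereal (esssup circle_measure (\<lambda>z. ereal (cmod (f z)))) +
        real_of_ereal (esssup circle_measure (\<lambda>z. ereal (cmod (g z))))"
      using linf_norm_AE[OF f] linf_norm_AE[OF g]
      by eventually_elim (intro norm_triangle_mono)
    then show "real_of_ereal (esssup circle_measure (\<lambda>z. ereal (cmod (f z + g z)))) \<le>
        real_of_ereal (esssup circle_measure (\<lambda>z. ereal (cmod (f z)))) +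
        real_of_ereal (esssup circle_measure (\<lambda>z. ereal (cmod (g z))))"
      using linf_norm_le_iff[OF ess_bounded_add[OF f g]] by blast
  qed
  show "norm (a *\<^sub>R f) = \<bar>a\<bar> * norm f"
    by (simp add: norm_linf_def scaleR_linf_def linf_norm_scaleC)
  show "norm (f * g) \<le> norm f * norm g"
    unfolding norm_linf_def
  proof transfer
    fix f g assume "ess_bounded f \<and> ess_bounded f \<and> (AE z in circle_measure. f z = f z)"
      "ess_bounded g \<and> ess_bounded g \<and> (AE z in circle_measure. g z = g z)"
    then have f: "ess_bounded f" and g: "ess_bounded g" by auto
    have "AE z in circle_measure. cmod (f z * g z) \<le>
        real_of_ereal (esssup circle_measure (\<lambda>z. ereal (cmod (f z)))) *
        real_of_ereal (esssup circle_measure (\<lambda>z. ereal (cmod (g z))))"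
      using linf_norm_AE[OF f] linf_norm_AE[OF g]
      by eventually_elim
         (auto simp: norm_mult intro!: mult_mono intro: order_trans[OF norm_ge_zero])
    then show "real_of_ereal (esssup circle_measure (\<lambda>z. ereal (cmod (f z * g z)))) \<le>
        real_of_ereal (esssup circle_measure (\<lambda>z. ereal (cmod (f z)))) *
        real_of_ereal (esssup circle_measure (\<lambda>z. ereal (cmod (g z))))"
      using linf_norm_le_iff[OF ess_bounded_mult[OF f g]] by blast
  qed
  show "norm (1::linf) = 1"
    unfolding norm_linf_def
    by transfer (simp add: esssup_const emeasure_circle_measure flip: one_ereal_def)
  show "c *\<^sub>C (f + g) = c *\<^sub>C f + c *\<^sub>C g" by (simp add: scaleC_linf_def add_right)
  show "(c + d) *\<^sub>C f = c *\<^sub>C f + d *\<^sub>C f" by (simp add: scaleC_linf_def add_left)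
  show "c *\<^sub>C d *\<^sub>C f = (c * d) *\<^sub>C f" by (simp add: scaleC_linf_def linf_scaleC_scaleC)
  show "c *\<^sub>C f * g = c *\<^sub>C (f * g)" by (simp add: scaleC_linf_def mult_left)
  show "complex_of_real a *\<^sub>C f = a *\<^sub>R f" by (simp add: scaleC_linf_def scaleR_linf_def)
  show "norm (c *\<^sub>C f) = cmod c * norm f"
    by (simp add: norm_linf_def scaleC_linf_def linf_norm_scaleC)
qed

end


section \<open>Douglas algebras\<close>

lift_definition fourier_coeff :: "linf \<Rightarrow> int \<Rightarrow> complex" is
  "\<lambda>f n. LINT z|circle_measure. f z * z powi (- n)"
proof -
  fix f g :: "complex \<Rightarrow> complex"
  assume fg: "ess_bounded f \<and> ess_bounded g \<and> (AE z in circle_measure. f z = g z)"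
  have id: "(\<lambda>z. z) \<in> borel_measurable circle_measure"
    unfolding measurable_cong_sets[OF sets_circle_measure refl]
    by (rule measurable_restrict_space1) simp
  have [measurable]: "(\<lambda>z. z powi (- n)) \<in> borel_measurable circle_measure" for n :: int
    unfolding power_int_def using id by (cases "- n \<ge> 0") auto
  have [measurable]: "f \<in> borel_measurable circle_measure" "g \<in> borel_measurable circle_measure"
    using fg by (auto simp: ess_bounded_def)
  show "(\<lambda>n. LINT z|circle_measure. f z * z powi (- n)) =
      (\<lambda>n. LINT z|circle_measure. g z * z powi (- n))"
    using fg by (intro ext integral_cong_AE) (auto elim: eventually_mono)
qed

definition Hinf :: "linf set" where
  "Hinf = {f. \<forall>n<0. fourier_coeff f n = 0}"

definition douglas_algebra :: "linf set \<Rightarrow> bool" where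
  "douglas_algebra D \<longleftrightarrow> complex_subalgebra D \<and> closed D \<and> Hinf \<subset> D"

end

(*
  The key is Axler's theorem for indicators: for every measurable set E of the circle there is a
  unimodular R with R * 1_E in D. Let x be a character of D at which every finite family in D takes
  a value in its joint essential range. Let V be a neighbourhood |y(g_i) - x(g_i)| < e of x and let
  E = {|g_i - x(g_i)| < e/2}. Then f = R * 1_E satisfies x(f) <> 0, while y(f) <> 0 forces
  |y(g_i - x(g_i))| <= e/2, as one sees from y(g^n f) for large n. So f vanishes off V. Hence these
  characters are hk-continuity points and lie in every closed boundary; they form a closed boundary
  themselves, so they are the Shilov boundary. Off it no point is hk-continuous, because an element
  that vanishes on a boundary is 0.

  For Axler's theorem take G outer with |G| small on E and large off E. Then 1_E is uniformly close
  to 1 / (1 + G) = w / h with w in H^infinity and h inner. By Frostman's theorem h is uniformly close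
  to Blaschke products (h - l) / (1 - cnj l * h). Removing the finitely many zeros in a large disc,
  which is possible because 1 / z is in D, leaves an inner b with b(0) close to 1 and b * 1_E close
  to D. Doing this for errors tending to 0 gives b_n whose product R converges, and R * 1_E is in D
  since R / b_n is in H^infinity for all n.
*)

theory Submission
  imports Defs "HOL-Probability.Probability_Measure" "HOL-Complex_Analysis.Complex_Analysis"
begin

section \<open>Functions on the circle and their classes\<close>

text \<open>The obstacle is that an indicator need not lie in \<open>D\<close>, while the
  hull-kernel topology asks for elements that vanish exactly off V. A function within a small
  distance of \<open>D\<close> is therefore useless, and one \<open>b\<close> for one error does not
  suffice; the infinite product is there to serve all errors at once. The factor \<open>R\<close>
  does no harm, since only the support of \<open>R * 1_E\<close> and its modulus on E are used.

  The strict inclusion of H^infinity in \<open>D\<close> enters only in the construction of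
  \<open>1 / z\<close>, from one element of \<open>D\<close> with a nonzero coefficient of negative
  index.

  The theory of H^infinity is built from the vanishing Fourier coefficients. Point evaluations are
  Cauchy integrals; they are multiplicative because f - f(a) is divisible by z - a, and contractive
  because a multiplicative functional on a closed algebra is. Convergence is controlled in means:
  real parts dominate imaginary parts in L^2, and |b - 1|^2 has mean 2 - 2 Re b(0) for inner b.
  Rates such as 4^-n turn such estimates into convergence almost everywhere.\<close>

abbreviation \<mu> :: "complex measure" where "\<mu> \<equiv> circle_measure"

interpretation circle: prob_space \<mu>
  by (rule prob_spaceI) (rule emeasure_circle_measure)

lemma AE_circleI: "(\<And>z. norm z = 1 \<Longrightarrow> P z) \<Longrightarrow> AE z in \<mu>. P z"
  by (rule AE_I2) (simp add: space_circle_measure)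

lemma measurable_circle_continuous:
  fixes f :: "complex \<Rightarrow> 'a::topological_space"
  assumes "continuous_on (sphere 0 1) f"
  shows "f \<in> borel_measurable \<mu>"
  unfolding measurable_cong_sets[OF sets_circle_measure refl]
  by (rule borel_measurable_continuous_on_restrict[OF assms])

lemma measurable_circle_id [measurable]: "(\<lambda>z. z) \<in> borel_measurable \<mu>"
  by (rule measurable_circle_continuous) (intro continuous_intros)

lemma ess_boundedI:
  assumes "f \<in> borel_measurable \<mu>" "AE z in \<mu>. cmod (f z) \<le> c"
  shows "ess_bounded f"
  using assms unfolding ess_bounded_iff by blast

lemma ess_bounded_measurable [measurable_dest]: "ess_bounded f \<Longrightarrow> f \<in> borel_measurable \<mu>"
  by (simp add: ess_bounded_def)

lemma ess_bounded_pos_bound: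
  assumes "ess_bounded f"
  obtains c where "c > 0" "AE z in \<mu>. cmod (f z) \<le> c"
proof -
  obtain c where "AE z in \<mu>. cmod (f z) \<le> c"
    using assms unfolding ess_bounded_iff by blast
  then have "AE z in \<mu>. cmod (f z) \<le> max c 1"
    by eventually_elim auto
  then show thesis using that[of "max c 1"] by auto
qed

lemma ess_bounded_continuous:
  assumes "continuous_on (sphere 0 1) f"
  shows "ess_bounded f"
proof -
  have "compact (f ` sphere 0 1)"
    using assms by (intro compact_continuous_image) auto
  then obtain c where "\<forall>w\<in>f ` sphere 0 1. cmod w \<le> c"
    using compact_imp_bounded bounded_iff by blast
  then show ?thesis
    by (intro ess_boundedI[of _ c] measurable_circle_continuous assms AE_circleI) auto
qed

lemma ess_bounded_cong:
  assumes "ess_bounded f" "g \<in> borel_measurable \<mu>" "AE z in \<mu>. f z = g z"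
  shows "ess_bounded g"
proof -
  obtain c where "AE z in \<mu>. cmod (f z) \<le> c"
    using assms unfolding ess_bounded_iff by blast
  with assms(3) have "AE z in \<mu>. cmod (g z) \<le> c"
    by eventually_elim auto
  then show ?thesis using assms(2) by (rule ess_boundedI[rotated])
qed

lemma ess_bounded_minus: "ess_bounded f \<Longrightarrow> ess_bounded g \<Longrightarrow> ess_bounded (\<lambda>z. f z - g z)"
  using ess_bounded_add[of f "\<lambda>z. (-1) * g z"] ess_bounded_mult[OF ess_bounded_const, of g "-1"]
  by simp

lemma ess_bounded_cnj: "ess_bounded f \<Longrightarrow> ess_bounded (\<lambda>z. cnj (f z))"
proof -
  assume f: "ess_bounded f"
  have "cnj \<in> borel_measurable borel"
    by (intro borel_measurable_continuous_onI continuous_intros)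
  then show ?thesis
    using f measurable_compose[of f \<mu> borel cnj borel] by (auto simp: ess_bounded_iff)
qed

lemma ess_bounded_power: "ess_bounded f \<Longrightarrow> ess_bounded (\<lambda>z. f z ^ n)"
  by (induction n) (auto intro: ess_bounded_const ess_bounded_mult)

lemma ess_bounded_id: "ess_bounded (\<lambda>z. z)"
  by (rule ess_bounded_continuous) (intro continuous_intros)

lemma ess_bounded_divide:
  assumes "ess_bounded f" "ess_bounded g" "c > 0" "AE z in \<mu>. c \<le> cmod (g z)"
  shows "ess_bounded (\<lambda>z. f z / g z)"
proof -
  have [measurable]: "f \<in> borel_measurable \<mu>" "g \<in> borel_measurable \<mu>"
    using assms by (auto simp: ess_bounded_def)
  obtain d where d: "AE z in \<mu>. cmod (f z) \<le> d" "d > 0"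
    using ess_bounded_pos_bound[OF assms(1)] by metis
  show ?thesis
  proof (rule ess_boundedI[of _ "d / c"])
    show "AE z in \<mu>. cmod (f z / g z) \<le> d / c"
      using d(1) assms(4) by eventually_elim (use assms(3) d(2) in \<open>auto simp: norm_divide intro!: frac_le\<close>)
  qed measurable
qed

lemmas ess_bounded_intros =
  ess_bounded_const ess_bounded_id ess_bounded_add ess_bounded_minus ess_bounded_mult
  ess_bounded_cnj ess_bounded_power

lemma ess_integrable: "ess_bounded f \<Longrightarrow> integrable \<mu> f"
  unfolding ess_bounded_iff by (metis circle.integrable_const_bound)

lemma circle_integrable_bounded:
  fixes f :: "complex \<Rightarrow> real"
  assumes "f \<in> borel_measurable \<mu>" "AE z in \<mu>. \<bar>f z\<bar> \<le> c"
  shows "integrable \<mu> f"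
  using assms by (intro circle.integrable_const_bound[of _ c]) auto

lemma integrable_circle_continuous:
  fixes f :: "complex \<Rightarrow> real"
  assumes "continuous_on S f" "sphere 0 1 \<subseteq> S"
  shows "integrable \<mu> f"
proof -
  have "integrable \<mu> (\<lambda>z. complex_of_real (f z))"
    by (intro ess_integrable ess_bounded_continuous continuous_intros continuous_on_subset[OF assms])
  then show ?thesis by (simp only: complex_of_real_integrable_eq)
qed

lemma integrable_norm_square:
  assumes "ess_bounded f"
  shows "integrable \<mu> (\<lambda>z. (cmod (f z))\<^sup>2)"
  using integrable_norm[OF ess_integrable[OF ess_bounded_mult[OF assms assms]]]
  by (simp add: norm_mult power2_eq_square)

abbreviation unimodular :: "(complex \<Rightarrow> complex) \<Rightarrow> bool" where
  "unimodular f \<equiv> (AE z in \<mu>. cmod (f z) = 1)"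

section \<open>Classes, representatives and closed subalgebras\<close>

lemma abs_linf_eq_iff:
  assumes "ess_bounded f" "ess_bounded g"
  shows "abs_linf f = abs_linf g \<longleftrightarrow> (AE z in \<mu>. f z = g z)"
  using Quotient_rel[OF Quotient_linf, of f g] assms by simp

lemma abs_linf_surj:
  obtains f where "ess_bounded f" "F = abs_linf f"
  by (induction F rule: linf.abs_induct) blast

lemma abs_linf_add:
  "ess_bounded f \<Longrightarrow> ess_bounded g \<Longrightarrow> abs_linf f + abs_linf g = abs_linf (\<lambda>z. f z + g z)"
  by (simp add: plus_linf.abs_eq)

lemma abs_linf_mult:
  "ess_bounded f \<Longrightarrow> ess_bounded g \<Longrightarrow> abs_linf f * abs_linf g = abs_linf (\<lambda>z. f z * g z)"
  by (simp add: times_linf.abs_eq)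

lemma abs_linf_scaleC: "ess_bounded f \<Longrightarrow> c *\<^sub>C abs_linf f = abs_linf (\<lambda>z. c * f z)"
  by (simp add: scaleC_linf_def linf_scaleC.abs_eq)

lemma minus_scaleC: "f - g = f + (-1) *\<^sub>C g" for f g :: linf
  by (simp add: minus_linf_def uminus_linf_def scaleC_linf_def)

lemma abs_linf_minus:
  "ess_bounded f \<Longrightarrow> ess_bounded g \<Longrightarrow> abs_linf f - abs_linf g = abs_linf (\<lambda>z. f z - g z)"
  unfolding minus_scaleC
  by (subst abs_linf_scaleC, assumption, subst abs_linf_add)
     (auto intro: ess_bounded_mult[OF ess_bounded_const, of _ "-1", simplified])

lemma norm_abs_linf_le_iff:
  "ess_bounded f \<Longrightarrow> norm (abs_linf f) \<le> c \<longleftrightarrow> (AE z in \<mu>. cmod (f z) \<le> c)"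
  by (simp add: norm_linf_def linf_norm.abs_eq linf_norm_le_iff)

text \<open>Elements of an algebra of classes are handled through their representatives, so that
  norm estimates become pointwise estimates almost everywhere.\<close>

definition reps :: "linf set \<Rightarrow> (complex \<Rightarrow> complex) set" where
  "reps A = {f. ess_bounded f \<and> abs_linf f \<in> A}"

lemma reps_ess_bounded: "f \<in> reps A \<Longrightarrow> ess_bounded f"
  by (simp add: reps_def)

lemma reps_mono: "A \<subseteq> B \<Longrightarrow> reps A \<subseteq> reps B"
  by (auto simp: reps_def)

lemma in_reps_obtain:
  assumes "F \<in> A"
  obtains f where "f \<in> reps A" "F = abs_linf f"
  using abs_linf_surj[of F] assms unfolding reps_def by blast

lemma reps_cong_AE:
  assumes "f \<in> reps A" "g \<in> borel_measurable \<mu>" "AE z in \<mu>. f z = g z"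
  shows "g \<in> reps A"
proof -
  have "ess_bounded g" using assms ess_bounded_cong reps_ess_bounded by blast
  moreover have "abs_linf f = abs_linf g"
    using abs_linf_eq_iff assms calculation reps_ess_bounded by blast
  ultimately show ?thesis using assms(1) by (simp add: reps_def)
qed

definition closed_subalgebra :: "linf set \<Rightarrow> bool" where
  "closed_subalgebra A \<longleftrightarrow> complex_subalgebra A \<and> closed A \<and> 1 \<in> A"

context
  fixes A :: "linf set"
  assumes A: "closed_subalgebra A"
begin

lemma reps_const: "(\<lambda>_. c) \<in> reps A"
proof -
  have "c *\<^sub>C 1 \<in> A" using A by (auto simp: closed_subalgebra_def complex_subalgebra_def)
  then show ?thesis
    unfolding one_linf.abs_eq abs_linf_scaleC[OF ess_bounded_const]
    by (simp add: reps_def ess_bounded_const)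
qed

lemma reps_add: "f \<in> reps A \<Longrightarrow> g \<in> reps A \<Longrightarrow> (\<lambda>z. f z + g z) \<in> reps A"
  using A unfolding closed_subalgebra_def complex_subalgebra_def reps_def
  by (auto intro: ess_bounded_add simp flip: abs_linf_add)

lemma reps_mult: "f \<in> reps A \<Longrightarrow> g \<in> reps A \<Longrightarrow> (\<lambda>z. f z * g z) \<in> reps A"
  using A unfolding closed_subalgebra_def complex_subalgebra_def reps_def
  by (auto intro: ess_bounded_mult simp flip: abs_linf_mult)

lemma reps_minus: "f \<in> reps A \<Longrightarrow> g \<in> reps A \<Longrightarrow> (\<lambda>z. f z - g z) \<in> reps A"
  using reps_add[of f "\<lambda>z. (-1) * g z"] reps_mult[OF reps_const, of g "-1"] by simp

lemma reps_power: "f \<in> reps A \<Longrightarrow> (\<lambda>z. f z ^ n) \<in> reps A"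
  by (induction n) (auto intro: reps_const reps_mult)

lemma reps_sum:
  "(\<And>i. i \<in> I \<Longrightarrow> f i \<in> reps A) \<Longrightarrow> (\<lambda>z. \<Sum>i\<in>I. f i z) \<in> reps A"
  by (induction I rule: infinite_finite_induct) (auto intro: reps_const reps_add)

lemma reps_prod:
  "(\<And>i. i \<in> I \<Longrightarrow> f i \<in> reps A) \<Longrightarrow> (\<lambda>z. \<Prod>i\<in>I. f i z) \<in> reps A"
  by (induction I rule: infinite_finite_induct) (auto intro: reps_const reps_mult)

lemma reps_closed:
  assumes "ess_bounded f"
    and "\<And>e. e > 0 \<Longrightarrow> \<exists>g\<in>reps A. AE z in \<mu>. cmod (f z - g z) \<le> e"
  shows "f \<in> reps A"
proof -
  have "abs_linf f \<in> closure A"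
    unfolding closure_approachable
  proof (intro allI impI)
    fix e :: real assume "e > 0"
    then obtain g where g: "g \<in> reps A" "AE z in \<mu>. cmod (f z - g z) \<le> e / 2"
      using assms(2)[of "e / 2"] by auto
    have "dist (abs_linf g) (abs_linf f) = norm (abs_linf f - abs_linf g)"
      by (subst dist_commute) (rule dist_linf_def)
    also have "\<dots> \<le> e / 2"
      using g assms(1) abs_linf_minus[of f g] norm_abs_linf_le_iff[of "\<lambda>z. f z - g z" "e / 2"]
      by (simp add: reps_ess_bounded ess_bounded_minus)
    finally show "\<exists>G\<in>A. dist G (abs_linf f) < e"
      using g(1) \<open>e > 0\<close> by (intro bexI[of _ "abs_linf g"]) (auto simp: reps_def)
  qed
  then show ?thesis using A assms(1) by (auto simp: closed_subalgebra_def reps_def)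
qed

text \<open>Neumann series: the geometric partial sums lie in \<open>A\<close> and converge
  uniformly off a null set.\<close>

lemma reps_inverse_one_minus:
  assumes f: "f \<in> reps A" and c: "AE z in \<mu>. cmod (f z) \<le> c" "c < 1"
  shows "(\<lambda>z. 1 / (1 - f z)) \<in> reps A"
proof (rule reps_closed)
  have lower: "AE z in \<mu>. 1 - c \<le> cmod (1 - f z)"
    using c(1)
  proof eventually_elim
    case (elim z)
    have "1 - cmod (f z) \<le> cmod (1 - f z)" using norm_triangle_ineq2[of 1 "f z"] by simp
    then show ?case using elim by linarith
  qed
  show "ess_bounded (\<lambda>z. 1 / (1 - f z))"
    using lower c(2) f by (intro ess_bounded_divide[of _ _ "1 - c"] ess_bounded_intros reps_ess_bounded) auto
  fix e :: real assume e: "e > 0"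
  \<comment> \<open>The sign of \<open>c\<close> is not assumed, and the powers in the error bound
    need a nonnegative base.\<close>
  define d where "d = max c 0"
  have d: "0 \<le> d" "d < 1" "c \<le> d" using c(2) by (auto simp: d_def)
  have "(\<lambda>n. d ^ n / (1 - c)) \<longlonglongrightarrow> 0 / (1 - c)"
    using d c(2) by (intro tendsto_divide LIMSEQ_power_zero) auto
  then obtain n where n: "d ^ n / (1 - c) < e"
    using order_tendstoD(2)[of _ "0 / (1 - c)" _ e] e by (fastforce simp: eventually_sequentially)
  show "\<exists>g\<in>reps A. AE z in \<mu>. cmod (1 / (1 - f z) - g z) \<le> e"
  proof (intro bexI)
    show "(\<lambda>z. \<Sum>i<n. f z ^ i) \<in> reps A" by (intro reps_sum reps_power f)
    show "AE z in \<mu>. cmod (1 / (1 - f z) - (\<Sum>i<n. f z ^ i)) \<le> e"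
      using c(1) lower
    proof eventually_elim
      case (elim z)
      then have ne: "f z \<noteq> 1" using c(2) by auto
      have "(\<Sum>i<n. f z ^ i) = (1 - f z ^ n) / (1 - f z)" by (rule sum_gp_strict[THEN trans]) (use ne in auto)
      then have "1 / (1 - f z) - (\<Sum>i<n. f z ^ i) = f z ^ n / (1 - f z)"
        by (simp add: diff_divide_distrib)
      then have "cmod (1 / (1 - f z) - (\<Sum>i<n. f z ^ i)) = cmod (f z) ^ n / cmod (1 - f z)"
        by (simp add: norm_divide norm_power)
      also have "\<dots> \<le> d ^ n / (1 - c)"
        using elim c(2) d by (intro frac_le power_mono) auto
      finally show ?case using n by simp
    qed
  qed
qed

text \<open>If |\<phi> f| exceeded \<open>c\<close>, then g = f / \<phi>(f) would have norm below 1,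
  so 1 - g would be invertible in \<open>A\<close> although \<phi> kills it. Phrased for functionals
  of functions, to serve both point evaluations in the disc and characters.\<close>

lemma multiplicative_functional_bound:
  fixes \<phi> :: "(complex \<Rightarrow> complex) \<Rightarrow> complex"
  assumes mult: "\<And>f g. f \<in> reps A \<Longrightarrow> g \<in> reps A \<Longrightarrow> \<phi> (\<lambda>z. f z * g z) = \<phi> f * \<phi> g"
    and minus: "\<And>f g. f \<in> reps A \<Longrightarrow> g \<in> reps A \<Longrightarrow> \<phi> (\<lambda>z. f z - g z) = \<phi> f - \<phi> g"
    and const: "\<And>c. \<phi> (\<lambda>_. c) = c"
    and cong: "\<And>f g. f \<in> reps A \<Longrightarrow> g \<in> reps A \<Longrightarrow> (AE z in \<mu>. f z = g z) \<Longrightarrow> \<phi> f = \<phi> g"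
    and f: "f \<in> reps A" and c: "AE z in \<mu>. cmod (f z) \<le> c"
  shows "cmod (\<phi> f) \<le> c"
proof (rule ccontr)
  assume "\<not> cmod (\<phi> f) \<le> c"
  then have w: "c < cmod (\<phi> f)" by simp
  \<comment> \<open>A statement free of \<open>z\<close> that holds almost everywhere is true,
    because the measure has mass 1.\<close>
  have "AE z in \<mu>. 0 \<le> c" using c by eventually_elim (rule order_trans[OF norm_ge_zero])
  then have c0: "0 \<le> c" by simp
  then have w0: "\<phi> f \<noteq> 0" using w by auto
  define g where "g = (\<lambda>z. inverse (\<phi> f) * f z)"
  have g: "g \<in> reps A" unfolding g_def by (intro reps_mult reps_const f)
  have \<phi>g: "\<phi> g = 1" unfolding g_def mult[OF reps_const f] const using w0 by simp
  have gb: "AE z in \<mu>. cmod (g z) \<le> c / cmod (\<phi> f)"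
    using c
  proof eventually_elim
    case (elim z)
    have "cmod (g z) = cmod (f z) / cmod (\<phi> f)"
      by (simp add: g_def norm_mult norm_inverse divide_inverse)
    then show ?case using elim by (simp add: divide_right_mono)
  qed
  have lt: "c / cmod (\<phi> f) < 1" using w c0 by (simp add: divide_less_eq)
  have h: "(\<lambda>z. 1 / (1 - g z)) \<in> reps A" by (rule reps_inverse_one_minus[OF g gb lt])
  have g1: "(\<lambda>z. 1 - g z) \<in> reps A" by (intro reps_minus reps_const g)
  have "AE z in \<mu>. (1 - g z) * (1 / (1 - g z)) = 1"
    using gb by eventually_elim (use lt in auto)
  then have "\<phi> (\<lambda>z. (1 - g z) * (1 / (1 - g z))) = 1"
    using cong[OF reps_mult[OF g1 h] reps_const] const by simp
  moreover have "\<phi> (\<lambda>z. 1 - g z) = 0" unfolding minus[OF reps_const g] const \<phi>g by simp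
  ultimately show False unfolding mult[OF g1 h] by simp
qed

end

section \<open>Trigonometric polynomials\<close>

lemma circle_integral:
  fixes f :: "complex \<Rightarrow> complex"
  assumes "f \<in> borel_measurable \<mu>"
  shows "(LINT z|\<mu>. f z) = (1 / (2 * pi)) *\<^sub>R (LINT t:{0..2 * pi}|lborel. f (cis t))"
proof -
  have cis: "cis \<in> borel \<rightarrow>\<^sub>M restrict_space borel (sphere 0 1)"
    by (rule measurable_restrict_space2)
       (auto intro!: borel_measurable_continuous_onI continuous_intros)
  have f: "f \<in> borel_measurable (restrict_space borel (sphere 0 1))"
    using assms by (simp add: measurable_cong_sets[OF sets_circle_measure refl])
  have u: "uniform_measure lborel {0..2 * pi} =
      density lborel (\<lambda>t. ennreal (indicator {0..2 * pi} t / (2 * pi)))"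
    unfolding uniform_measure_def
    by (intro density_cong AE_I2)
       (auto simp: indicator_def divide_ennreal[symmetric] ennreal_mult[symmetric])
  have fc: "(\<lambda>t. f (cis t)) \<in> borel_measurable borel"
    using measurable_compose[OF cis f] .
  have "(LINT z|\<mu>. f z) = (LINT t|uniform_measure lborel {0..2 * pi}. f (cis t))"
    unfolding circle_measure_def
    by (rule integral_distr) (use cis f in \<open>auto simp: measurable_cong_sets[OF sets_uniform_measure refl]\<close>)
  also have "\<dots> = (LINT t|lborel. (indicator {0..2 * pi} t / (2 * pi)) *\<^sub>R f (cis t))"
    unfolding u by (rule integral_density) (use fc in auto)
  also have "\<dots> = (LINT t|lborel. (1 / (2 * pi)) *\<^sub>R (indicator {0..2 * pi} t *\<^sub>R f (cis t)))"
    by simp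
  also have "\<dots> = (1 / (2 * pi)) *\<^sub>R (LINT t:{0..2 * pi}|lborel. f (cis t))"
    unfolding set_lebesgue_integral_def by (rule integral_scaleR_right)
  finally show ?thesis .
qed

lemma integral_circle_power:
  assumes "n > 0"
  shows "(LINT z|\<mu>. z ^ n) = 0"
proof -
  have "(LINT t:{0..2 * pi}|lborel. cis t ^ n) =
      cis (real n * (2 * pi)) / (\<i> * of_nat n) - cis (real n * 0) / (\<i> * of_nat n)"
    unfolding set_lebesgue_integral_def Complex.DeMoivre
  proof (rule integral_FTC_Icc)
    fix t :: real
    have "((\<lambda>t. exp (of_real (real n * t) * \<i>) / (\<i> * of_nat n)) has_vector_derivative
        exp (of_real (real n * t) * \<i>)) (at t within {0..2 * pi})"
      using assms
      by (auto intro!: derivative_eq_intros has_vector_derivative_real_field simp: field_simps)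
    then show "((\<lambda>t. cis (real n * t) / (\<i> * of_nat n)) has_vector_derivative
        cis (real n * t)) (at t within {0..2 * pi})"
      by (simp add: cis_conv_exp mult.commute)
  qed (auto intro!: continuous_intros)
  also have "\<dots> = 0"
    using cis_multiple_2pi[of "real n"] by (simp add: mult.commute)
  finally show ?thesis
    by (subst circle_integral) (auto intro!: measurable_circle_continuous continuous_intros)
qed

text \<open>Mean value property: the Taylor series is integrated term by term and only the constant
  term survives.\<close>

lemma integral_circle_holomorphic:
  assumes f: "f holomorphic_on ball 0 R" and r: "0 \<le> r" "r < R"
  shows "(LINT z|\<mu>. f (of_real r * z)) = f 0"
proof -
  define a where "a n = (deriv ^^ n) f 0 / fact n" for n
  have sums: "(\<lambda>n. a n * w ^ n) sums f w" if "cmod w < R" for w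
    using holomorphic_power_series[OF f, of w] that by (simp add: a_def)
  \<comment> \<open>Convergence at a radius beyond \<open>r\<close> gives the absolute convergence
    at \<open>r\<close> that justifies the interchange.\<close>
  define s where "s = (r + R) / 2"
  have s: "r < s" "s < R" "s > 0" using r by (auto simp: s_def)
  have "summable (\<lambda>n. a n * of_real s ^ n)" using sums[of "of_real s"] s by (auto simp: sums_iff)
  then have summ: "summable (\<lambda>n. cmod (a n) * r ^ n)"
    using powser_insidea[of a "of_real s" "of_real r :: complex"] s r
    by (simp add: norm_mult norm_power)
  have int: "integrable \<mu> (\<lambda>z. a n * (of_real r * z) ^ n)" for n
    by (intro ess_integrable ess_bounded_intros)
  have nrm: "norm z = 1 \<Longrightarrow> norm (a n * (of_real r * z) ^ n) = cmod (a n) * r ^ n" for n z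
    using r by (simp add: norm_mult norm_power)
  have "(\<lambda>n. LINT z|\<mu>. a n * (of_real r * z) ^ n) sums
      (LINT z|\<mu>. (\<Sum>n. a n * (of_real r * z) ^ n))"
  proof (rule sums_integral[OF int])
    show "AE z in \<mu>. summable (\<lambda>n. norm (a n * (of_real r * z) ^ n))"
      by (rule AE_circleI) (simp only: nrm summ)
    have "(LINT z|\<mu>. norm (a n * (of_real r * z) ^ n)) = (LINT z|\<mu>. cmod (a n) * r ^ n)" for n
      by (rule Bochner_Integration.integral_cong) (use nrm in \<open>auto simp: space_circle_measure\<close>)
    then show "summable (\<lambda>n. LINT z|\<mu>. norm (a n * (of_real r * z) ^ n))"
      using summ circle.prob_space by simp
  qed
  moreover have "(LINT z|\<mu>. a n * (of_real r * z) ^ n) = (if n = 0 then f 0 else 0)" for n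
    using integral_circle_power[of n] circle.prob_space
    by (simp add: power_mult_distrib mult.assoc[symmetric]) (simp add: a_def)
  moreover have "(LINT z|\<mu>. (\<Sum>n. a n * (of_real r * z) ^ n)) = (LINT z|\<mu>. f (of_real r * z))"
    by (rule Bochner_Integration.integral_cong)
       (use sums r in \<open>auto simp: space_circle_measure sums_iff norm_mult\<close>)
  ultimately have "(\<lambda>n. if n = 0 then f 0 else 0) sums (LINT z|\<mu>. f (of_real r * z))"
    by simp
  then show ?thesis using sums_single[of 0 "\<lambda>_. f 0"] sums_unique2 by blast
qed

lemma integral_circle_entire:
  assumes "f holomorphic_on UNIV"
  shows "(LINT z|\<mu>. f z) = f 0"
  using integral_circle_holomorphic[of f 2 1] holomorphic_on_subset[OF assms] by simp

inductive trig_poly :: "(complex \<Rightarrow> complex) \<Rightarrow> bool" where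
  trig_poly_monomial: "trig_poly (\<lambda>z. c * z powi n)"
| trig_poly_add: "trig_poly f \<Longrightarrow> trig_poly g \<Longrightarrow> trig_poly (\<lambda>z. f z + g z)"

inductive analytic_poly :: "(complex \<Rightarrow> complex) \<Rightarrow> bool" where
  analytic_poly_monomial: "analytic_poly (\<lambda>z. c * z ^ n)"
| analytic_poly_add: "analytic_poly f \<Longrightarrow> analytic_poly g \<Longrightarrow> analytic_poly (\<lambda>z. f z + g z)"

lemma analytic_poly_entire: "analytic_poly p \<Longrightarrow> p holomorphic_on UNIV"
  by (induction rule: analytic_poly.induct) (auto intro!: holomorphic_intros)

lemma entire_ess_bounded: "p holomorphic_on UNIV \<Longrightarrow> ess_bounded p"
  by (intro ess_bounded_continuous holomorphic_on_imp_continuous_on) (auto intro: holomorphic_on_subset)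

lemma inverse_circle: "norm z = 1 \<Longrightarrow> inverse z = cnj z"
  by (metis complex_norm_square inverse_unique of_real_1 one_power2)

lemma powi_minus_circle: "norm z = 1 \<Longrightarrow> z powi (- int n) = cnj (z ^ n)"
  using inverse_circle[of z] by (simp add: power_int_minus flip: power_inverse)

text \<open>Integer exponents add only away from 0 in general, so the product is identified on the
  circle only.\<close>

lemma trig_poly_mult:
  assumes "trig_poly f" "trig_poly g"
  shows "\<exists>h. trig_poly h \<and> (\<forall>z. norm z = 1 \<longrightarrow> h z = f z * g z)"
  using assms
proof (induction arbitrary: g rule: trig_poly.induct)
  case (trig_poly_monomial c n)
  then show ?case
  proof (induction rule: trig_poly.induct)
    case (trig_poly_monomial d m)
    have "c * d * z powi (n + m) = c * z powi n * (d * z powi m)" if "norm z = 1" for z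
      using that by (subst power_int_add) auto
    then show ?case using trig_poly.trig_poly_monomial by blast
  next
    case (trig_poly_add f g)
    then obtain h1 h2 where "trig_poly h1" "\<forall>z. norm z = 1 \<longrightarrow> h1 z = c * z powi n * f z"
      "trig_poly h2" "\<forall>z. norm z = 1 \<longrightarrow> h2 z = c * z powi n * g z" by blast
    then show ?case
      by (intro exI[of _ "\<lambda>z. h1 z + h2 z"]) (auto intro: trig_poly.intros simp: algebra_simps)
  qed
next
  case (trig_poly_add f1 f2)
  then obtain h1 h2 where "trig_poly h1" "\<forall>z. norm z = 1 \<longrightarrow> h1 z = f1 z * g z"
    "trig_poly h2" "\<forall>z. norm z = 1 \<longrightarrow> h2 z = f2 z * g z" by blast
  then show ?case
    by (intro exI[of _ "\<lambda>z. h1 z + h2 z"]) (auto intro: trig_poly.intros simp: algebra_simps)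
qed

text \<open>The bridge from Stone-Weierstrass, whose approximants are real polynomials in the two
  coordinates.\<close>

lemma trig_poly_real_polynomial:
  assumes "real_polynomial_function (g :: complex \<Rightarrow> real)"
  shows "\<exists>t. trig_poly t \<and> (\<forall>z. norm z = 1 \<longrightarrow> t z = of_real (g z))"
  using assms
proof (induction rule: real_polynomial_function.induct)
  case (linear f)
  interpret bounded_linear f by fact
  \<comment> \<open>Chosen so that 2 Re (c z) = Re z * f 1 + Im z * f \<i>, which is the real-linear
    form \<open>f\<close>.\<close>
  define c where "c = Complex (f 1) (- f \<i>) / 2"
  have "c * z powi 1 + cnj c * z powi (-1) = of_real (f z)" if "norm z = 1" for z
  proof -
    have "f z = f (Re z *\<^sub>R 1 + Im z *\<^sub>R \<i>)"
      by (metis complex_eq scaleR_conv_of_real mult.right_neutral mult.commute)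
    also have "\<dots> = Re z * f 1 + Im z * f \<i>" by (simp only: add scale real_scaleR_def)
    finally have fz: "f z = Re z * f 1 + Im z * f \<i>" .
    have "c * z powi 1 + cnj c * z powi (-1) = c * z + cnj (c * z)"
      using powi_minus_circle[OF that, of 1] by simp
    also have "\<dots> = of_real (2 * Re (c * z))" by (rule complex_add_cnj)
    also have "2 * Re (c * z) = f z" by (simp add: fz c_def)
    finally show ?thesis .
  qed
  then show ?case
    by (intro exI[of _ "\<lambda>z. c * z powi 1 + cnj c * z powi (-1)"] conjI trig_poly.intros) auto
next
  case (const c)
  show ?case using trig_poly_monomial[of "of_real c" 0] by (auto simp del: trig_poly_monomial)
next
  case (add f g)
  then obtain h1 h2 where "trig_poly h1" "\<forall>z. norm z = 1 \<longrightarrow> h1 z = of_real (f z)"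
    "trig_poly h2" "\<forall>z. norm z = 1 \<longrightarrow> h2 z = of_real (g z)" by blast
  then show ?case
    by (intro exI[of _ "\<lambda>z. h1 z + h2 z"]) (auto intro: trig_poly.intros)
next
  case (mult f g)
  then obtain h1 h2 where h: "trig_poly h1" "\<forall>z. norm z = 1 \<longrightarrow> h1 z = of_real (f z)"
    "trig_poly h2" "\<forall>z. norm z = 1 \<longrightarrow> h2 z = of_real (g z)" by blast
  then show ?case using trig_poly_mult[OF h(1,3)] by auto
qed

text \<open>The normalization \<open>q 0 = 0\<close> assigns the constant term to \<open>p\<close>.
  It makes the antianalytic part orthogonal to H^infinity.\<close>

lemma trig_poly_decompose:
  assumes "trig_poly t"
  shows "\<exists>p q. analytic_poly p \<and> analytic_poly q \<and> q 0 = 0 \<and> (\<forall>z. norm z = 1 \<longrightarrow> t z = p z + cnj (q z))"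
  using assms
proof (induction rule: trig_poly.induct)
  case (trig_poly_monomial c n)
  show ?case
  proof (cases "n \<ge> 0")
    case True
    then obtain k where "n = int k" using nonneg_int_cases by blast
    then show ?thesis
      by (intro exI[of _ "\<lambda>z. c * z ^ k"] exI[of _ "\<lambda>z. 0 * z ^ 0"] conjI analytic_poly.intros) auto
  next
    case False
    then obtain k where k: "n = - int k" "k > 0"
      by (metis linorder_not_le neg_int_cases)
    then show ?thesis
      by (intro exI[of _ "\<lambda>z. 0 * z ^ 0"] exI[of _ "\<lambda>z. cnj c * z ^ k"] conjI analytic_poly.intros)
         (auto simp: powi_minus_circle)
  qed
next
  case (trig_poly_add f g)
  then obtain p1 q1 p2 q2 where "analytic_poly p1" "analytic_poly q1" "q1 0 = 0"
    "\<forall>z. norm z = 1 \<longrightarrow> f z = p1 z + cnj (q1 z)"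
    "analytic_poly p2" "analytic_poly q2" "q2 0 = 0"
    "\<forall>z. norm z = 1 \<longrightarrow> g z = p2 z + cnj (q2 z)"
    by blast
  then show ?case
    by (intro exI[of _ "\<lambda>z. p1 z + p2 z"] exI[of _ "\<lambda>z. q1 z + q2 z"])
       (auto intro: analytic_poly.intros)
qed

section \<open>Density of bounded trigonometric polynomials in L^1\<close>

lemma indicator_L1_continuous:
  assumes A: "A \<in> sets \<mu>" and e: "e > 0"
  obtains v :: "complex \<Rightarrow> real" where "continuous_on UNIV v"
    "(LINT z|\<mu>. \<bar>indicator A z - v z\<bar>) < e"
proof -
  \<comment> \<open>Regularity is formulated for measures on the Borel sets of a Polish space; the
    push-forward to the plane is one.\<close>
  define M where "M = distr \<mu> borel (\<lambda>z. z)"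
  have [simp]: "sets M = sets borel" "space M = UNIV" by (simp_all add: M_def)
  have A_borel: "A \<in> sets borel"
    using A unfolding sets_circle_measure
    by (auto simp: sets_restrict_space)
  interpret M: prob_space M unfolding M_def by (rule circle.prob_space_distr) simp
  have A_eq: "emeasure M A = ennreal (measure M A)" by (rule M.emeasure_eq_measure)
  have "\<exists>K. compact K \<and> K \<subseteq> A \<and> measure M A - e / 2 < measure M K"
  proof (cases "measure M A = 0")
    case True
    then show ?thesis using e by (intro exI[of _ "{}"]) auto
  next
    case False
    have "ennreal (measure M A - e / 2) < emeasure M A"
      unfolding A_eq using e False measure_nonneg[of M A] by (intro ennreal_lessI) linarith+
    also have "\<dots> = (SUP K \<in> {K. K \<subseteq> A \<and> compact K}. emeasure M K)"
      using A_borel by (intro inner_regular) auto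
    finally show ?thesis
      by (auto simp: less_SUP_iff M.emeasure_eq_measure ennreal_less_iff intro: leI)
         (metis ennreal_less_iff ennreal_leI not_le)
  qed
  then obtain K where K: "compact K" "K \<subseteq> A" "measure M A - e / 2 < measure M K" by blast
  have "(INF U \<in> {U. A \<subseteq> U \<and> open U}. emeasure M U) = emeasure M A"
    using A_borel by (intro outer_regular[symmetric]) auto
  also have "\<dots> < ennreal (measure M A + e / 2)"
    using e by (simp add: A_eq ennreal_less_iff)
  finally obtain U where U: "A \<subseteq> U" "open U" "measure M U < measure M A + e / 2"
    by (auto simp: INF_less_iff M.emeasure_eq_measure ennreal_less_iff)
  obtain v :: "complex \<Rightarrow> real" where v: "continuous_on UNIV v" "\<And>x. v x \<in> closed_segment 0 1"
      "\<And>x. x \<in> - U \<Longrightarrow> v x = 0" "\<And>x. x \<in> K \<Longrightarrow> v x = 1"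
  proof (rule Urysohn[of "- U" K 0 1])
    show "- U \<inter> K = {}" using U(1) K(2) by blast
  qed (use U(2) K(1) compact_imp_closed in auto)
  have v01: "0 \<le> v x" "v x \<le> 1" for x using v(2)[of x] by (auto simp: closed_segment_eq_real_ivl)
  have [measurable]: "U \<in> sets borel" "K \<in> sets borel" "A \<in> sets borel"
    using U K A_borel by (auto intro: borel_compact)
  have [measurable]: "v \<in> borel_measurable borel" using v(1) by (rule borel_measurable_continuous_onI)
  have "(\<lambda>z. \<bar>indicator A z - v z\<bar>) \<in> borel_measurable borel" by measurable
  then have meas: "(\<lambda>z. \<bar>indicator A z - v z\<bar>) \<in> borel_measurable M"
    by (simp only: measurable_cong_sets[OF \<open>sets M = sets borel\<close> refl])
  have "(LINT z|\<mu>. \<bar>indicator A z - v z\<bar>) = (LINT z|M. \<bar>indicator A z - v z\<bar>)"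
    unfolding M_def by (subst integral_distr) auto
  \<comment> \<open>The Urysohn function is 1 on \<open>K\<close> and 0 off \<open>U\<close>, so it
    differs from the indicator only on \<open>U - K\<close>.\<close>
  also have "\<dots> \<le> (LINT z|M. indicator (U - K) z)"
  proof (rule integral_mono)
    show "integrable M (\<lambda>z. \<bar>indicator A z - v z\<bar>)"
    proof (rule M.integrable_const_bound[of _ 1])
      show "AE z in M. norm \<bar>indicator A z - v z\<bar> \<le> 1"
      proof (rule AE_I2)
        fix z show "norm \<bar>indicator A z - v z\<bar> \<le> 1"
          using v01[of z] by (auto simp: indicator_def)
      qed
    qed (rule meas)
    show "\<bar>indicator A z - v z\<bar> \<le> indicator (U - K) z" for z
      using v(3,4)[of z] v01[of z] U(1) K(2) by (auto simp: indicator_def)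
  qed (auto intro!: integrable_real_indicator simp: M.emeasure_eq_measure)
  also have "\<dots> = measure M U - measure M K"
    using K U by (subst M.finite_measure_Diff[symmetric]) auto
  also have "\<dots> < e" using K U by simp
  finally show thesis using that v(1) by blast
qed

lemma L1_continuous_dense:
  fixes f :: "complex \<Rightarrow> real"
  assumes "integrable \<mu> f" "e > 0"
  shows "\<exists>v. continuous_on UNIV v \<and> (LINT z|\<mu>. \<bar>f z - v z\<bar>) < e"
  using assms
proof (induction arbitrary: e rule: integrable_induct)
  case (base A c)
  show ?case
  proof (cases "c = 0")
    case True
    then show ?thesis using base by (intro exI[of _ "\<lambda>_. 0"]) auto
  next
    case False
    obtain v where v: "continuous_on UNIV v" "(LINT z|\<mu>. \<bar>indicator A z - v z\<bar>) < e / \<bar>c\<bar>"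
      using indicator_L1_continuous[OF base(1), of "e / \<bar>c\<bar>"] base False by auto
    have "(LINT z|\<mu>. \<bar>indicator A z *\<^sub>R c - c * v z\<bar>) = \<bar>c\<bar> * (LINT z|\<mu>. \<bar>indicator A z - v z\<bar>)"
      by (subst integral_mult_right_zero[symmetric])
         (auto simp: abs_mult[symmetric] algebra_simps)
    also have "\<dots> < e" using v(2) False by (simp add: field_simps)
    finally show ?thesis using v(1) by (intro exI[of _ "\<lambda>z. c * v z"]) (auto intro!: continuous_intros)
  qed
next
  case (add f g)
  obtain v w where v: "continuous_on UNIV v" "(LINT z|\<mu>. \<bar>f z - v z\<bar>) < e / 2"
    and w: "continuous_on UNIV w" "(LINT z|\<mu>. \<bar>g z - w z\<bar>) < e / 2"
    using add.IH[of "e / 2"] add.prems by auto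
  have iv: "integrable \<mu> v" "integrable \<mu> w"
    by (rule integrable_circle_continuous[of UNIV]; use v w in simp)+
  have "(LINT z|\<mu>. \<bar>f z + g z - (v z + w z)\<bar>) \<le> (LINT z|\<mu>. \<bar>f z - v z\<bar> + \<bar>g z - w z\<bar>)"
    using add iv by (intro integral_mono) auto
  also have "\<dots> < e" using v w add iv by simp
  finally show ?case using v w by (intro exI[of _ "\<lambda>z. v z + w z"]) (auto intro!: continuous_intros)
next
  case (lim f s)
  have "(\<lambda>i. LINT z|\<mu>. \<bar>s i z - f z\<bar>) \<longlonglongrightarrow> (LINT z|\<mu>. 0)"
  proof (rule integral_dominated_convergence[where w = "\<lambda>z. 3 * \<bar>f z\<bar>"])
    show "AE z in \<mu>. (\<lambda>i. \<bar>s i z - f z\<bar>) \<longlonglongrightarrow> 0"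
      using lim(2) by (intro AE_I2 tendsto_rabs_zero) (auto intro: LIM_zero)
    \<comment> \<open>The approximants of the induction rule satisfy |s i z| <= 2 |f z|, which
      explains the factor 3.\<close>
    show "AE z in \<mu>. norm \<bar>s i z - f z\<bar> \<le> 3 * \<bar>f z\<bar>" for i
    proof (rule AE_I2)
      fix z assume "z \<in> space \<mu>"
      then show "norm \<bar>s i z - f z\<bar> \<le> 3 * \<bar>f z\<bar>" using lim(3)[of z i] by auto
    qed
  qed (use lim in \<open>auto intro: borel_measurable_integrable\<close>)
  then obtain i where i: "(LINT z|\<mu>. \<bar>s i z - f z\<bar>) < e / 2"
    using lim.prems order_tendstoD(2)[of _ 0 sequentially "e / 2"] by (auto simp: eventually_sequentially)
  obtain v where v: "continuous_on UNIV v" "(LINT z|\<mu>. \<bar>s i z - v z\<bar>) < e / 2"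
    using lim(5)[of "e / 2" i] lim.prems by auto
  have iv: "integrable \<mu> v"
    by (rule integrable_circle_continuous[OF v(1)]) simp
  have "(LINT z|\<mu>. \<bar>f z - v z\<bar>) \<le> (LINT z|\<mu>. \<bar>s i z - f z\<bar> + \<bar>s i z - v z\<bar>)"
    using lim iv by (intro integral_mono) auto
  also have "\<dots> < e" using v i lim iv by simp
  finally show ?case using v by blast
qed

text \<open>The sup bound does not depend on \<open>e\<close>. It is what later turns L^1 closeness
  into L^2 closeness.\<close>

lemma L1_trig_poly_real:
  assumes u: "u \<in> borel_measurable \<mu>" "AE z in \<mu>. \<bar>u z\<bar> \<le> M" and e: "e > 0"
  obtains t where "trig_poly t" "\<And>z. norm z = 1 \<Longrightarrow> t z = of_real (Re (t z))"
    "\<And>z. norm z = 1 \<Longrightarrow> \<bar>Re (t z)\<bar> \<le> \<bar>M\<bar> + 1" "(LINT z|\<mu>. \<bar>u z - Re (t z)\<bar>) < e"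
proof -
  have iu: "integrable \<mu> u" by (rule circle_integrable_bounded[OF u])
  obtain v where v: "continuous_on UNIV v" "(LINT z|\<mu>. \<bar>u z - v z\<bar>) < e / 2"
    using L1_continuous_dense[OF iu, of "e / 2"] e by auto
  \<comment> \<open>Truncation at height |M| cannot increase the distance to \<open>u\<close>, which
    already lies below that height.\<close>
  define w where "w z = max (- \<bar>M\<bar>) (min \<bar>M\<bar> (v z))" for z
  have w: "continuous_on UNIV w" unfolding w_def by (intro continuous_intros v)
  have iv: "integrable \<mu> v" "integrable \<mu> w"
    by (rule integrable_circle_continuous[of UNIV]; use v w in simp)+
  define d where "d = min 1 (e / 2)"
  have d: "0 < d" "d \<le> 1" "d \<le> e / 2" using e by (auto simp: d_def)
  obtain g where g: "real_polynomial_function g" "\<And>z. z \<in> sphere 0 1 \<Longrightarrow> \<bar>w z - g z\<bar> < d"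
    using Stone_Weierstrass_real_polynomial_function[of "sphere 0 1" w d] d w
      continuous_on_subset[of UNIV w] by auto
  obtain t where t: "trig_poly t" "\<forall>z. norm z = 1 \<longrightarrow> t z = of_real (g z)"
    using trig_poly_real_polynomial[OF g(1)] by blast
  have ig: "integrable \<mu> g"
    by (rule integrable_circle_continuous[of UNIV])
       (use g(1) continuous_on_polymonial_function real_polynomial_function_eq in auto)
  show thesis
  proof (rule that[OF t(1)])
    fix z :: complex assume z: "norm z = 1"
    show "t z = of_real (Re (t z))" using t(2) z by simp
    have "\<bar>w z\<bar> \<le> \<bar>M\<bar>" by (auto simp: w_def)
    then show "\<bar>Re (t z)\<bar> \<le> \<bar>M\<bar> + 1" using t(2) z g(2)[of z] d by auto
  next
    have "(LINT z|\<mu>. \<bar>u z - Re (t z)\<bar>) = (LINT z|\<mu>. \<bar>u z - g z\<bar>)"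
      by (rule Bochner_Integration.integral_cong) (use t in \<open>auto simp: space_circle_measure\<close>)
    also have "\<dots> \<le> (LINT z|\<mu>. \<bar>u z - v z\<bar> + d)"
    proof (rule integral_mono_AE)
      show "AE z in \<mu>. \<bar>u z - g z\<bar> \<le> \<bar>u z - v z\<bar> + d"
        using u(2) AE_space
      proof eventually_elim
        case (elim z)
        then have "\<bar>w z - g z\<bar> < d" using g(2)[of z] by (simp add: space_circle_measure)
        moreover have "\<bar>u z - w z\<bar> \<le> \<bar>u z - v z\<bar>" using elim by (auto simp: w_def)
        ultimately show ?case by linarith
      qed
    qed (use iu iv ig in auto)
    also have "\<dots> = (LINT z|\<mu>. \<bar>u z - v z\<bar>) + d"
      using iu iv circle.prob_space by simp
    also have "\<dots> < e" using v d by simp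
    finally show "(LINT z|\<mu>. \<bar>u z - Re (t z)\<bar>) < e" .
  qed
qed

lemma trig_poly_ess_bounded: "trig_poly t \<Longrightarrow> ess_bounded t"
proof (induction rule: trig_poly.induct)
  case (trig_poly_monomial c n)
  show ?case by (intro ess_bounded_continuous continuous_intros) auto
qed (rule ess_bounded_add)

lemma L1_trig_poly:
  assumes f: "f \<in> borel_measurable \<mu>" "AE z in \<mu>. cmod (f z) \<le> M" and e: "e > 0"
  obtains t where "trig_poly t" "\<And>z. norm z = 1 \<Longrightarrow> cmod (t z) \<le> 2 * (\<bar>M\<bar> + 1)"
    "(LINT z|\<mu>. cmod (f z - t z)) < e"
proof -
  have [measurable]: "f \<in> borel_measurable \<mu>" by fact
  have re: "AE z in \<mu>. \<bar>Re (f z)\<bar> \<le> M" "AE z in \<mu>. \<bar>Im (f z)\<bar> \<le> M"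
    using f(2) by (auto elim!: eventually_mono intro: order_trans abs_Re_le_cmod abs_Im_le_cmod)
  obtain s where s: "trig_poly s" "\<And>z. norm z = 1 \<Longrightarrow> s z = of_real (Re (s z))"
      "\<And>z. norm z = 1 \<Longrightarrow> \<bar>Re (s z)\<bar> \<le> \<bar>M\<bar> + 1" "(LINT z|\<mu>. \<bar>Re (f z) - Re (s z)\<bar>) < e / 2"
    using L1_trig_poly_real[of "\<lambda>z. Re (f z)" M "e / 2"] re(1) e by auto
  obtain t where t: "trig_poly t" "\<And>z. norm z = 1 \<Longrightarrow> t z = of_real (Re (t z))"
      "\<And>z. norm z = 1 \<Longrightarrow> \<bar>Re (t z)\<bar> \<le> \<bar>M\<bar> + 1" "(LINT z|\<mu>. \<bar>Im (f z) - Re (t z)\<bar>) < e / 2"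
    using L1_trig_poly_real[of "\<lambda>z. Im (f z)" M "e / 2"] re(2) e by auto
  have it: "trig_poly (\<lambda>z. \<i> * t z)" using t(1)
  proof (induction rule: trig_poly.induct)
    case (trig_poly_monomial c n)
    then show ?case using trig_poly.trig_poly_monomial[of "\<i> * c" n] by (simp add: mult.assoc)
  next
    case (trig_poly_add f g)
    then show ?case using trig_poly.trig_poly_add by (simp add: distrib_left)
  qed
  have [measurable]: "s \<in> borel_measurable \<mu>" "t \<in> borel_measurable \<mu>"
    using s(1) t(1) trig_poly_ess_bounded ess_bounded_measurable by blast+
  have integ: "integrable \<mu> (\<lambda>z. \<bar>Re (f z) - Re (s z)\<bar>)" "integrable \<mu> (\<lambda>z. \<bar>Im (f z) - Re (t z)\<bar>)"
    using ess_integrable[OF ess_boundedI[OF f]]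
      ess_integrable[OF trig_poly_ess_bounded[OF s(1)]]
      ess_integrable[OF trig_poly_ess_bounded[OF t(1)]] by auto
  have i2: "integrable \<mu> (\<lambda>z. cmod (f z - (s z + \<i> * t z)))"
    by (intro integrable_norm ess_integrable ess_bounded_minus ess_boundedI[OF f]
        trig_poly_ess_bounded trig_poly_add s(1) it)
  show thesis
  proof (rule that[OF trig_poly_add[OF s(1) it]])
    fix z :: complex assume z: "norm z = 1"
    have "cmod (s z + \<i> * t z) \<le> cmod (s z) + cmod (t z)"
      using norm_triangle_ineq[of "s z" "\<i> * t z"] by (simp add: norm_mult)
    also have "\<dots> \<le> 2 * (\<bar>M\<bar> + 1)"
      using s(2,3)[OF z] t(2,3)[OF z] by (metis add_mono mult_2 norm_of_real)
    finally show "cmod (s z + \<i> * t z) \<le> 2 * (\<bar>M\<bar> + 1)" .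
  next
    have "(LINT z|\<mu>. cmod (f z - (s z + \<i> * t z))) \<le>
        (LINT z|\<mu>. \<bar>Re (f z) - Re (s z)\<bar> + \<bar>Im (f z) - Re (t z)\<bar>)"
    proof (rule integral_mono[OF i2])
      fix z assume "z \<in> space \<mu>"
      then have z: "norm z = 1" by (simp add: space_circle_measure)
      have "Re (f z - (s z + \<i> * t z)) = Re (f z) - Re (s z)" "Im (f z - (s z + \<i> * t z)) = Im (f z) - Re (t z)"
        using s(2)[OF z] t(2)[OF z] by (simp_all add: complex_eq_iff)
      then show "cmod (f z - (s z + \<i> * t z)) \<le> \<bar>Re (f z) - Re (s z)\<bar> + \<bar>Im (f z) - Re (t z)\<bar>"
        using cmod_le[of "f z - (s z + \<i> * t z)"] by metis
    qed (use integ in auto)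
    also have "\<dots> < e" using s(4) t(4) integ by simp
    finally show "(LINT z|\<mu>. cmod (f z - (s z + \<i> * t z))) < e" .
  qed
qed

section \<open>The algebra \<open>H\<^sup>\<infinity>\<close>\<close>

lemma fourier_coeff_abs_linf:
  assumes "ess_bounded f"
  shows "fourier_coeff (abs_linf f) n = (LINT z|\<mu>. f z * z powi (- n))"
  using assms by (simp add: fourier_coeff.abs_eq)

text \<open>The representatives of elements of \<open>Hinf\<close> (see \<open>reps_Hinf\<close>),
  freed of integer exponents: the integral against \<open>z ^ Suc n\<close> is the Fourier
  coefficient of index -(n + 1).\<close>

definition hardy :: "(complex \<Rightarrow> complex) \<Rightarrow> bool" where
  "hardy f \<longleftrightarrow> ess_bounded f \<and> (\<forall>n. (LINT z|\<mu>. f z * z ^ Suc n) = 0)"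

lemma reps_Hinf: "f \<in> reps Hinf \<longleftrightarrow> hardy f"
proof -
  have "(\<forall>n<0. (LINT z|\<mu>. f z * z powi (- n)) = 0) \<longleftrightarrow> (\<forall>n. (LINT z|\<mu>. f z * z ^ Suc n) = 0)"
  proof safe
    fix n assume "\<forall>n<0. (LINT z|\<mu>. f z * z powi (- n)) = 0"
    then have "- int (Suc n) < 0 \<longrightarrow> (LINT z|\<mu>. f z * z powi (- (- int (Suc n)))) = 0" by (rule spec)
    then have "(LINT z|\<mu>. f z * z powi (- (- int (Suc n)))) = 0" by (rule mp) simp
    then show "(LINT z|\<mu>. f z * z ^ Suc n) = 0" by (simp only: minus_minus power_int_of_nat)
  next
    fix n :: int assume *: "\<forall>n. (LINT z|\<mu>. f z * z ^ Suc n) = 0" and n: "n < 0"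
    then obtain k where "- n = int (Suc k)"
      by (metis neg_0_less_iff_less zero_less_imp_eq_int gr0_implies_Suc)
    then show "(LINT z|\<mu>. f z * z powi (- n)) = 0" using * by (simp only: power_int_of_nat)
  qed
  then show ?thesis
    by (auto simp: reps_def hardy_def Hinf_def fourier_coeff_abs_linf)
qed

lemma hardy_ess_bounded: "hardy f \<Longrightarrow> ess_bounded f"
  by (simp add: hardy_def)

lemma hardy_integral_power: "hardy f \<Longrightarrow> n > 0 \<Longrightarrow> (LINT z|\<mu>. f z * z ^ n) = 0"
  using gr0_implies_Suc unfolding hardy_def by blast

lemma hardy_integral_analytic_poly:
  assumes "hardy f" "analytic_poly q"
  shows "(LINT z|\<mu>. f z * q z) = (LINT z|\<mu>. f z) * q 0"
  using assms(2)
proof (induction rule: analytic_poly.induct)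
  case (analytic_poly_monomial c n)
  have "(LINT z|\<mu>. f z * (c * z ^ n)) = c * (LINT z|\<mu>. f z * z ^ n)"
    by (subst integral_mult_right_zero[symmetric]) (simp add: mult_ac)
  then show ?case using hardy_integral_power[OF assms(1), of n] by (cases "n = 0") auto
next
  case (analytic_poly_add p q)
  have eb: "ess_bounded f" "ess_bounded p" "ess_bounded q"
    using analytic_poly_add.hyps assms(1) hardy_ess_bounded entire_ess_bounded analytic_poly_entire by blast+
  have "integrable \<mu> (\<lambda>z. f z * p z)" "integrable \<mu> (\<lambda>z. f z * q z)"
    by (intro ess_integrable ess_bounded_mult eb)+
  then show ?case using analytic_poly_add.IH by (simp add: distrib_left)
qed

lemma entire_hardy:
  assumes "p holomorphic_on UNIV"
  shows "hardy p"
  unfolding hardy_def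
proof (intro conjI allI)
  fix n
  have "(\<lambda>z. p z * z ^ Suc n) holomorphic_on UNIV"
    using assms by (intro holomorphic_intros)
  from integral_circle_entire[OF this] show "(LINT z|\<mu>. p z * z ^ Suc n) = 0" by simp
qed (rule entire_ess_bounded[OF assms])

lemma hardy_const: "hardy (\<lambda>_. c)"
  by (intro entire_hardy holomorphic_intros)

lemma hardy_id: "hardy (\<lambda>z. z)"
  by (intro entire_hardy holomorphic_intros)

lemma hardy_add:
  assumes "hardy f" "hardy g"
  shows "hardy (\<lambda>z. f z + g z)"
  unfolding hardy_def
proof (intro conjI allI)
  note eb = assms[THEN hardy_ess_bounded]
  show "ess_bounded (\<lambda>z. f z + g z)" by (intro ess_bounded_intros eb)
  fix n
  have "(LINT z|\<mu>. (f z + g z) * z ^ Suc n) = (LINT z|\<mu>. f z * z ^ Suc n) + (LINT z|\<mu>. g z * z ^ Suc n)"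
    unfolding distrib_right
    by (intro Bochner_Integration.integral_add ess_integrable ess_bounded_intros eb)
  then show "(LINT z|\<mu>. (f z + g z) * z ^ Suc n) = 0"
    using assms by (simp only: hardy_def) simp
qed

lemma hardy_cmult: "hardy f \<Longrightarrow> hardy (\<lambda>z. c * f z)"
  unfolding hardy_def mult.assoc
  by (auto intro!: ess_bounded_intros simp del: power_Suc)

text \<open>Dominated convergence of the Fourier coefficients. The exponentials and infinite
  products to which this is applied converge only pointwise, so closedness in norm would not cover
  them.\<close>

lemma hardy_limit:
  assumes s: "\<And>n. hardy (s n)" and bound: "\<And>n. AE z in \<mu>. cmod (s n z) \<le> c"
    and meas: "f \<in> borel_measurable \<mu>" and lim: "AE z in \<mu>. (\<lambda>n. s n z) \<longlonglongrightarrow> f z"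
  shows "hardy f" "(\<lambda>n. LINT z|\<mu>. s n z) \<longlonglongrightarrow> (LINT z|\<mu>. f z)"
proof -
  have [measurable]: "s n \<in> borel_measurable \<mu>" for n
    using s hardy_ess_bounded ess_bounded_measurable by blast
  have [measurable]: "f \<in> borel_measurable \<mu>" by fact
  have tends: "(\<lambda>n. LINT z|\<mu>. s n z * z ^ k) \<longlonglongrightarrow> (LINT z|\<mu>. f z * z ^ k)" for k
  proof (rule integral_dominated_convergence[where w = "\<lambda>_. c"])
    show "AE z in \<mu>. (\<lambda>n. s n z * z ^ k) \<longlonglongrightarrow> f z * z ^ k"
      using lim by eventually_elim (intro tendsto_intros)
    show "AE z in \<mu>. norm (s n z * z ^ k) \<le> c" for n
      using bound[of n] AE_space
      by eventually_elim (simp add: norm_mult norm_power space_circle_measure)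
  qed auto
  from tends[of 0] show "(\<lambda>n. LINT z|\<mu>. s n z) \<longlonglongrightarrow> (LINT z|\<mu>. f z)" by simp
  show "hardy f"
    unfolding hardy_def
  proof (intro conjI allI)
    have "AE z in \<mu>. \<forall>n. cmod (s n z) \<le> c" using bound by (simp add: AE_all_countable)
    with lim have "AE z in \<mu>. cmod (f z) \<le> c"
      by eventually_elim (auto intro: LIMSEQ_le_const2[OF tendsto_norm])
    with meas show "ess_bounded f" by (rule ess_boundedI)
    fix n
    have "(\<lambda>k. LINT z|\<mu>. s k z * z ^ Suc n) = (\<lambda>_. 0)"
      using s hardy_integral_power by blast
    then show "(LINT z|\<mu>. f z * z ^ Suc n) = 0"
      using tends[of "Suc n"] LIMSEQ_unique[OF tendsto_const] by metis
  qed
qed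

lemma L1_le_sqrt_L2:
  fixes f :: "complex \<Rightarrow> real"
  assumes [measurable]: "f \<in> borel_measurable \<mu>" and "integrable \<mu> (\<lambda>z. (f z)\<^sup>2)"
  shows "integrable \<mu> f" "(LINT z|\<mu>. \<bar>f z\<bar>) \<le> sqrt (LINT z|\<mu>. (f z)\<^sup>2)"
proof -
  show i: "integrable \<mu> f"
    using assms by (rule circle.square_integrable_imp_integrable)
  have "(LINT z|\<mu>. \<bar>f z\<bar>)\<^sup>2 \<le> (LINT z|\<mu>. (f z)\<^sup>2)"
    using circle.variance_positive[of "\<lambda>z. \<bar>f z\<bar>"] circle.variance_eq[of "\<lambda>z. \<bar>f z\<bar>"] i assms(2)
    by simp
  then show "(LINT z|\<mu>. \<bar>f z\<bar>) \<le> sqrt (LINT z|\<mu>. (f z)\<^sup>2)"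
    by (rule real_le_rsqrt)
qed

text \<open>A trigonometric polynomial near \<open>f\<close> is split as p + cnj q. Since f - p is
  orthogonal to cnj q, discarding cnj q can only reduce the L^2 distance to
  \<open>f\<close>.\<close>

lemma hardy_L2_analytic_poly:
  assumes f: "hardy f" and e: "e > 0"
  obtains p where "analytic_poly p" "(LINT z|\<mu>. (cmod (f z - p z))\<^sup>2) < e"
proof -
  obtain M where M: "AE z in \<mu>. cmod (f z) \<le> M" "M > 0"
    using ess_bounded_pos_bound[OF hardy_ess_bounded[OF f]] by metis
  \<comment> \<open>A bound for |f - t|, so that |f - t|^2 <= C |f - t| and an L^1 estimate
    suffices.\<close>
  define C where "C = M + 2 * (M + 1)"
  have C: "C > 0" using M by (simp add: C_def)
  obtain t where t: "trig_poly t" "\<And>z. norm z = 1 \<Longrightarrow> cmod (t z) \<le> 2 * (\<bar>M\<bar> + 1)"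
    "(LINT z|\<mu>. cmod (f z - t z)) < e / C"
    using L1_trig_poly[OF _ M(1), of "e / C"] f e C hardy_ess_bounded ess_bounded_measurable by (metis divide_pos_pos)
  obtain p q where pq: "analytic_poly p" "analytic_poly q" "q 0 = 0"
    "\<forall>z. norm z = 1 \<longrightarrow> t z = p z + cnj (q z)"
    using trig_poly_decompose[OF t(1)] by blast
  have eb: "ess_bounded f" "ess_bounded t" "ess_bounded p" "ess_bounded q"
    using f t(1) pq hardy_ess_bounded trig_poly_ess_bounded entire_ess_bounded analytic_poly_entire by blast+
  note [measurable] = eb[THEN ess_bounded_measurable]
  have "(LINT z|\<mu>. (f z - p z) * q z) = (LINT z|\<mu>. f z * q z) - (LINT z|\<mu>. p z * q z)"
    unfolding left_diff_distrib
    by (intro Bochner_Integration.integral_diff ess_integrable ess_bounded_mult eb)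
  also have "\<dots> = 0"
    using hardy_integral_analytic_poly[OF f pq(2)] pq(3)
      hardy_integral_analytic_poly[OF entire_hardy[OF analytic_poly_entire[OF pq(1)]] pq(2)] by simp
  finally have orth: "(LINT z|\<mu>. (f z - p z) * q z) = 0" .
  have orthRe: "(LINT z|\<mu>. Re ((f z - p z) * q z)) = 0"
    by (subst integral_Re) (auto simp: orth intro!: ess_integrable ess_bounded_intros eb)
  have pw: "(cmod (f z - t z))\<^sup>2 = (cmod (f z - p z))\<^sup>2 + (cmod (q z))\<^sup>2 - 2 * Re ((f z - p z) * q z)"
    if "norm z = 1" for z
  proof -
    have "f z - t z = (f z - p z) - cnj (q z)" using pq(4) that by simp
    moreover have "(cmod (w - cnj y))\<^sup>2 = (cmod w)\<^sup>2 + (cmod y)\<^sup>2 - 2 * Re (w * y)" for w y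
      by (simp only: cmod_power2) (simp add: power2_eq_square algebra_simps)
    ultimately show ?thesis by (simp only:)
  qed
  have "(LINT z|\<mu>. (cmod (f z - p z))\<^sup>2) \<le> (LINT z|\<mu>. (cmod (f z - t z))\<^sup>2)"
  proof -
    have "(LINT z|\<mu>. (cmod (f z - t z))\<^sup>2) =
        (LINT z|\<mu>. (cmod (f z - p z))\<^sup>2 + (cmod (q z))\<^sup>2 - 2 * Re ((f z - p z) * q z))"
      by (rule Bochner_Integration.integral_cong) (auto simp: pw space_circle_measure)
    also have "\<dots> = (LINT z|\<mu>. (cmod (f z - p z))\<^sup>2) + (LINT z|\<mu>. (cmod (q z))\<^sup>2)
        - (LINT z|\<mu>. 2 * Re ((f z - p z) * q z))"
    proof -
      have "integrable \<mu> (\<lambda>z. 2 * Re ((f z - p z) * q z))"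
        by (intro integrable_mult_right integrable_Re ess_integrable ess_bounded_intros eb)
      moreover have "integrable \<mu> (\<lambda>z. (cmod (f z - p z))\<^sup>2)" "integrable \<mu> (\<lambda>z. (cmod (q z))\<^sup>2)"
        by (intro integrable_norm_square ess_bounded_intros eb)+
      ultimately show ?thesis
        by (simp only: Bochner_Integration.integral_diff Bochner_Integration.integral_add
            Bochner_Integration.integrable_add)
    qed
    also have "(LINT z|\<mu>. 2 * Re ((f z - p z) * q z)) = 0"
      using orthRe by (simp only: integral_mult_right_zero)
    finally show ?thesis by simp
  qed
  also have "\<dots> \<le> (LINT z|\<mu>. C * cmod (f z - t z))"
  proof (rule integral_mono_AE)
    show "AE z in \<mu>. (cmod (f z - t z))\<^sup>2 \<le> C * cmod (f z - t z)"
      using M(1) AE_space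
    proof eventually_elim
      case (elim z)
      have "cmod (f z - t z) \<le> C"
        using elim t(2)[of z] norm_triangle_ineq4[of "f z" "t z"] M(2)
        by (auto simp: C_def space_circle_measure)
      then show ?case by (simp add: power2_eq_square mult_right_mono)
    qed
  qed (auto intro!: integrable_norm_square integrable_norm ess_integrable ess_bounded_intros eb)
  also have "\<dots> < e" using t(3) C by (simp add: field_simps)
  finally show thesis using that pq(1) by blast
qed

text \<open>For a polynomial in place of \<open>f\<close> the coefficients of negative index vanish
  by inspection. Replacing \<open>f\<close> by a polynomial \<open>p\<close> costs at most the sup
  norm of \<open>g\<close> times the L^1 norm of f - p.\<close>

lemma hardy_mult:
  assumes f: "hardy f" and g: "hardy g"
  shows "hardy (\<lambda>z. f z * g z)"
  unfolding hardy_def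
proof (intro conjI allI)
  have eb: "ess_bounded f" "ess_bounded g" using f g by (auto simp: hardy_ess_bounded)
  then show "ess_bounded (\<lambda>z. f z * g z)" by (rule ess_bounded_mult)
  obtain M where M: "AE z in \<mu>. cmod (g z) \<le> M" "M > 0"
    using ess_bounded_pos_bound[OF eb(2)] by metis
  fix n
  have "cmod (LINT z|\<mu>. f z * g z * z ^ Suc n) \<le> 0 + e" if e: "e > 0" for e
  proof -
    obtain p where p: "analytic_poly p" "(LINT z|\<mu>. (cmod (f z - p z))\<^sup>2) < (e / M)\<^sup>2"
      using hardy_L2_analytic_poly[OF f, of "(e / M)\<^sup>2"] e M by auto
    have ep: "ess_bounded p" using p(1) entire_ess_bounded analytic_poly_entire by blast
    have "(LINT z|\<mu>. \<bar>cmod (f z - p z)\<bar>) \<le> sqrt (LINT z|\<mu>. (cmod (f z - p z))\<^sup>2)"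
      using eb ep
      by (intro L1_le_sqrt_L2(2) integrable_norm_square ess_bounded_minus) (auto dest: ess_bounded_measurable)
    also have "\<dots> \<le> e / M" using p(2) e M by (intro real_le_lsqrt) auto
    finally have L1: "(LINT z|\<mu>. cmod (f z - p z)) \<le> e / M" by simp
    have shift: "analytic_poly (\<lambda>z. p z * z ^ Suc n)"
      using p(1)
    proof (induction rule: analytic_poly.induct)
      case (analytic_poly_monomial c k)
      show ?case
        using analytic_poly.analytic_poly_monomial[of c "k + Suc n"] by (simp only: power_add mult.assoc)
    next
      case (analytic_poly_add p q)
      then show ?case using analytic_poly.analytic_poly_add by (simp only: distrib_right)
    qed
    have "(LINT z|\<mu>. f z * g z * z ^ Suc n) =
        (LINT z|\<mu>. (f z - p z) * g z * z ^ Suc n + g z * (p z * z ^ Suc n))"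
      by (simp add: algebra_simps)
    also have "\<dots> = (LINT z|\<mu>. (f z - p z) * g z * z ^ Suc n) + (LINT z|\<mu>. g z * (p z * z ^ Suc n))"
      by (intro Bochner_Integration.integral_add ess_integrable ess_bounded_intros eb ep)
    also have "\<dots> = (LINT z|\<mu>. (f z - p z) * g z * z ^ Suc n)"
      unfolding hardy_integral_analytic_poly[OF g shift] by simp
    also have "cmod \<dots> \<le> (LINT z|\<mu>. cmod ((f z - p z) * g z * z ^ Suc n))"
      by (rule integral_norm_bound)
    also have "\<dots> \<le> (LINT z|\<mu>. M * cmod (f z - p z))"
    proof (rule integral_mono_AE)
      show "AE z in \<mu>. cmod ((f z - p z) * g z * z ^ Suc n) \<le> M * cmod (f z - p z)"
        using M(1) AE_space
        by eventually_elim
           (auto simp: norm_mult norm_power space_circle_measure mult.commute[of M] intro: mult_left_mono)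
    qed (auto intro!: integrable_norm integrable_mult_right ess_integrable ess_bounded_intros eb ep
        simp del: power_Suc)
    also have "\<dots> = M * (LINT z|\<mu>. cmod (f z - p z))" by (rule integral_mult_right_zero)
    also have "\<dots> \<le> M * (e / M)" using M by (intro mult_left_mono L1) simp
    finally show ?thesis using M by simp
  qed
  from field_le_epsilon[OF this] show "(LINT z|\<mu>. f z * g z * z ^ Suc n) = 0"
    by (simp only: norm_le_zero_iff)
qed

lemma closed_subalgebra_Hinf: "closed_subalgebra Hinf"
proof -
  have in_Hinf: "abs_linf f \<in> Hinf \<longleftrightarrow> hardy f" if "ess_bounded f" for f
    using reps_Hinf[of f] that by (simp add: reps_def)
  have "complex_subalgebra Hinf"
    unfolding complex_subalgebra_def
  proof (intro conjI ballI allI)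
    show "0 \<in> Hinf" using in_Hinf[OF ess_bounded_const] hardy_const by (simp add: zero_linf.abs_eq)
    fix F G assume "F \<in> Hinf" "G \<in> Hinf"
    then obtain f g where fg: "hardy f" "F = abs_linf f" "hardy g" "G = abs_linf g"
      by (metis in_reps_obtain reps_Hinf)
    then show "F + G \<in> Hinf" "F * G \<in> Hinf"
      by (auto simp: abs_linf_add abs_linf_mult in_Hinf hardy_ess_bounded ess_bounded_add ess_bounded_mult
          hardy_add hardy_mult)
  next
    fix c F assume "F \<in> Hinf"
    then obtain f where fg: "hardy f" "F = abs_linf f"
      by (metis in_reps_obtain reps_Hinf)
    then show "c *\<^sub>C F \<in> Hinf"
      by (auto simp: abs_linf_scaleC in_Hinf hardy_ess_bounded ess_bounded_mult ess_bounded_const hardy_cmult)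
  qed
  moreover have "closed Hinf"
    unfolding closure_subset_eq[symmetric]
  proof
    fix F assume F: "F \<in> closure Hinf"
    obtain f where f: "ess_bounded f" "F = abs_linf f" by (rule abs_linf_surj)
    have "(LINT z|\<mu>. f z * z ^ Suc n) = 0" for n
    proof -
      have "cmod (LINT z|\<mu>. f z * z ^ Suc n) \<le> 0 + e" if e: "e > 0" for e
      proof -
        obtain G where G: "G \<in> Hinf" "dist G F < e" using F e unfolding closure_approachable by blast
        obtain x where x: "hardy x" "G = abs_linf x" using G(1) by (metis in_reps_obtain reps_Hinf)
        note xe = hardy_ess_bounded[OF x(1)]
        have "norm (abs_linf (\<lambda>z. x z - f z)) \<le> e"
          using G(2) x f xe abs_linf_minus[of x f] by (simp add: dist_linf_def)
        then have ae: "AE z in \<mu>. cmod (x z - f z) \<le> e"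
          using xe f by (subst (asm) norm_abs_linf_le_iff) (auto intro: ess_bounded_minus)
        have "(LINT z|\<mu>. f z * z ^ Suc n) = (LINT z|\<mu>. x z * z ^ Suc n) - (LINT z|\<mu>. (x z - f z) * z ^ Suc n)"
          unfolding left_diff_distrib
          by (subst Bochner_Integration.integral_diff)
             (auto intro!: ess_integrable ess_bounded_intros f xe simp del: power_Suc)
        also have "\<dots> = - (LINT z|\<mu>. (x z - f z) * z ^ Suc n)"
          using hardy_integral_power[OF x(1), of "Suc n"] by (simp only: zero_less_Suc) simp
        also have "cmod \<dots> \<le> (LINT z|\<mu>. cmod ((x z - f z) * z ^ Suc n))"
          using integral_norm_bound by (simp del: power_Suc)
        also have "\<dots> \<le> (LINT z|\<mu>. e)"
        proof (rule integral_mono_AE)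
          show "AE z in \<mu>. cmod ((x z - f z) * z ^ Suc n) \<le> e"
            using ae AE_space by eventually_elim (simp only: norm_mult norm_power space_circle_measure, simp)
        qed (auto intro!: integrable_norm ess_integrable ess_bounded_intros f xe simp del: power_Suc)
        also have "\<dots> = 0 + e" using circle.prob_space by simp
        finally show ?thesis .
      qed
      from field_le_epsilon[OF this] show ?thesis by (simp only: norm_le_zero_iff)
    qed
    then have "hardy f" using f by (simp add: hardy_def)
    then show "F \<in> Hinf" using in_Hinf f by simp
  qed
  moreover have "1 \<in> Hinf"
    using in_Hinf[OF ess_bounded_const] hardy_const by (simp add: one_linf.abs_eq)
  ultimately show ?thesis by (simp add: closed_subalgebra_def)
qed

lemma hardy_inverse_one_minus:
  assumes "hardy f" "AE z in \<mu>. cmod (f z) \<le> c" "c < 1"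
  shows "hardy (\<lambda>z. 1 / (1 - f z))"
  using reps_inverse_one_minus[OF closed_subalgebra_Hinf, of f c] assms by (simp add: reps_Hinf)

lemma hardy_minus: "hardy f \<Longrightarrow> hardy g \<Longrightarrow> hardy (\<lambda>z. f z - g z)"
  using reps_minus[OF closed_subalgebra_Hinf] by (simp add: reps_Hinf)

section \<open>Holomorphic extension to the disc\<close>

text \<open>The value at \<open>a\<close> of the holomorphic extension of a function in \<open>H\<^sup>\<infinity>\<close>, as a Cauchy integral.\<close>

definition disc_ext :: "(complex \<Rightarrow> complex) \<Rightarrow> complex \<Rightarrow> complex" where
  "disc_ext f a = (LINT z|\<mu>. f z / (1 - a * cnj z))"

lemma cauchy_kernel_nonzero:
  assumes "cmod a < 1" "cmod z = 1"
  shows "1 - a * cnj z \<noteq> 0"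
proof
  assume "1 - a * cnj z = 0"
  then have "cmod (a * cnj z) = 1" by (metis eq_iff_diff_eq_0 norm_one)
  then show False using assms by (simp add: norm_mult)
qed

lemma circle_mult_cnj: "cmod z = 1 \<Longrightarrow> z * cnj z = 1"
  by (simp add: complex_norm_square[symmetric])

lemma ess_bounded_cauchy_kernel:
  assumes "cmod a < 1"
  shows "ess_bounded (\<lambda>z. 1 / (1 - a * cnj z))"
  using cauchy_kernel_nonzero[OF assms]
  by (intro ess_bounded_continuous continuous_intros) auto

lemma ess_bounded_mult_cauchy_kernel:
  assumes "ess_bounded f" "cmod a < 1"
  shows "ess_bounded (\<lambda>z. f z / (1 - a * cnj z))"
  using ess_bounded_mult[OF assms(1) ess_bounded_cauchy_kernel[OF assms(2)]] by simp

lemma disc_ext_cong: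
  assumes "\<And>z. cmod z = 1 \<Longrightarrow> f z = g z"
  shows "disc_ext f a = disc_ext g a"
  unfolding disc_ext_def
  by (rule Bochner_Integration.integral_cong) (auto simp: assms space_circle_measure)

lemma disc_ext_cong_AE:
  assumes "ess_bounded f" "ess_bounded g" "AE z in \<mu>. f z = g z" "cmod a < 1"
  shows "disc_ext f a = disc_ext g a"
  unfolding disc_ext_def
proof (rule integral_cong_AE)
  show "AE z in \<mu>. f z / (1 - a * cnj z) = g z / (1 - a * cnj z)"
    using assms(3) by eventually_elim simp
qed (intro ess_bounded_measurable ess_bounded_mult_cauchy_kernel assms)+

lemma disc_ext_add:
  assumes "ess_bounded f" "ess_bounded g" "cmod a < 1"
  shows "disc_ext (\<lambda>z. f z + g z) a = disc_ext f a + disc_ext g a"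
  unfolding disc_ext_def add_divide_distrib
  by (intro Bochner_Integration.integral_add ess_integrable ess_bounded_mult_cauchy_kernel assms)

lemma disc_ext_cmult: "disc_ext (\<lambda>z. c * f z) a = c * disc_ext f a"
  unfolding disc_ext_def by (subst integral_mult_right_zero[symmetric]) simp

lemma disc_ext_minus:
  assumes "ess_bounded f" "ess_bounded g" "cmod a < 1"
  shows "disc_ext (\<lambda>z. f z - g z) a = disc_ext f a - disc_ext g a"
  unfolding disc_ext_def diff_divide_distrib
  by (intro Bochner_Integration.integral_diff ess_integrable ess_bounded_mult_cauchy_kernel assms)

lemma disc_ext_0: "disc_ext f 0 = (LINT z|\<mu>. f z)"
  by (simp add: disc_ext_def)

text \<open>On the circle z - a = z (1 - a cnj z), so the Cauchy kernel cancels and the mean of z f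
  remains.\<close>

lemma disc_ext_factor_zero:
  assumes "hardy f" "cmod a < 1"
  shows "disc_ext (\<lambda>z. (z - a) * f z) a = 0"
proof -
  have "(z - a) * f z / (1 - a * cnj z) = f z * z ^ 1" if "cmod z = 1" for z
  proof -
    have "z * (1 - a * cnj z) = z - a * (z * cnj z)" by (simp add: algebra_simps)
    also have "\<dots> = z - a" by (simp add: circle_mult_cnj[OF that])
    finally have "z - a = z * (1 - a * cnj z)" ..
    then show ?thesis using cauchy_kernel_nonzero[OF assms(2) that] by simp
  qed
  then have "disc_ext (\<lambda>z. (z - a) * f z) a = (LINT z|\<mu>. f z * z ^ 1)"
    unfolding disc_ext_def by (intro Bochner_Integration.integral_cong) (auto simp: space_circle_measure)
  then show ?thesis using hardy_integral_power[OF assms(1), of 1] by simp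
qed

text \<open>On the circle the extra factor is 1 / (z - a). The moments \<open>I n\<close> of the
  quotient satisfy I (n + 1) = a I n, because \<open>f\<close> contributes nothing of negative
  index; they all vanish once I 0, the value of the extension at \<open>a\<close>, does.\<close>

lemma hardy_divide:
  assumes f: "hardy f" and a: "cmod a < 1" and zero: "disc_ext f a = 0"
  shows "hardy (\<lambda>z. f z * (cnj z / (1 - a * cnj z)))"
proof -
  define I where "I n = (LINT z|\<mu>. f z * (z ^ n / (1 - a * cnj z)))" for n
  have eb: "ess_bounded f" using f by (rule hardy_ess_bounded)
  have ebk: "ess_bounded (\<lambda>z. g z / (1 - a * cnj z))" if "ess_bounded g" for g
    using that a by (rule ess_bounded_mult_cauchy_kernel)
  have "I n = 0" for n
  proof (induction n)
    case 0
    then show ?case using zero by (simp add: I_def disc_ext_def)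
  next
    case (Suc n)
    have "z ^ Suc n / (1 - a * cnj z) = z ^ Suc n + a * (z ^ n / (1 - a * cnj z))" if "cmod z = 1" for z
    proof -
      have "z ^ Suc n * (1 - a * cnj z) + a * z ^ n = z ^ Suc n - a * z ^ n * (z * cnj z) + a * z ^ n"
        by (simp add: algebra_simps)
      also have "\<dots> = z ^ Suc n" by (simp add: circle_mult_cnj[OF that])
      finally show ?thesis using cauchy_kernel_nonzero[OF a that] by (simp add: field_simps)
    qed
    then have "I (Suc n) = (LINT z|\<mu>. f z * z ^ Suc n + a * (f z * (z ^ n / (1 - a * cnj z))))"
      unfolding I_def
      by (intro Bochner_Integration.integral_cong) (auto simp: space_circle_measure distrib_left)
    also have "\<dots> = (LINT z|\<mu>. f z * z ^ Suc n) + a * I n"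
      unfolding I_def
      by (subst Bochner_Integration.integral_add)
         (auto intro!: ess_integrable ess_bounded_intros ebk eb simp del: power_Suc times_divide_eq_right)
    finally show ?case using Suc hardy_integral_power[OF f, of "Suc n"] by simp
  qed
  moreover have "(LINT z|\<mu>. f z * (cnj z / (1 - a * cnj z)) * z ^ Suc n) = I n" for n
    unfolding I_def
  proof (rule Bochner_Integration.integral_cong)
    fix z assume "z \<in> space \<mu>"
    then have "z * cnj z = 1" by (simp add: circle_mult_cnj space_circle_measure)
    then have "cnj z * z ^ Suc n = z ^ n" by (simp add: mult.assoc[symmetric] mult.commute[of "cnj z" z])
    moreover have "f z * (cnj z / (1 - a * cnj z)) * z ^ Suc n = f z * (cnj z * z ^ Suc n / (1 - a * cnj z))"
      by (simp only: times_divide_eq_left times_divide_eq_right mult.assoc)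
    ultimately show "f z * (cnj z / (1 - a * cnj z)) * z ^ Suc n = f z * (z ^ n / (1 - a * cnj z))"
      by (simp only:)
  qed simp
  ultimately show ?thesis
    unfolding hardy_def by (auto intro!: ess_bounded_mult ebk ess_bounded_intros eb simp del: power_Suc times_divide_eq_right)
qed

text \<open>The conjugate of the Cauchy kernel is holomorphic beyond the circle, so the mean value
  property applies to it.\<close>

lemma disc_ext_const:
  assumes a: "cmod a < 1"
  shows "disc_ext (\<lambda>_. c) a = c"
proof -
  have "(LINT z|\<mu>. 1 / (1 - cnj a * z)) = (1::complex)"
  proof -
    \<comment> \<open>The radius is 2 / (1 + |a|): larger than 1, smaller than 1 / |a|, and
      meaningful at a = 0.\<close>
    have "(\<lambda>z. 1 / (1 - cnj a * z)) holomorphic_on ball 0 (1 / (cmod a + (1 - cmod a) / 2))"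
    proof (intro holomorphic_intros)
      fix z :: complex assume z: "z \<in> ball 0 (1 / (cmod a + (1 - cmod a) / 2))"
      have "cmod (cnj a * z) \<le> (cmod a + (1 - cmod a) / 2) * cmod z"
        using a by (simp add: norm_mult mult_right_mono)
      also have "\<dots> < 1" using z a by (simp add: field_simps add_pos_nonneg)
      finally show "1 - cnj a * z \<noteq> 0" by (metis eq_iff_diff_eq_0 less_irrefl norm_one)
    qed
    from integral_circle_holomorphic[OF this, of 1] show ?thesis using a by (simp add: field_simps add_pos_nonneg)
  qed
  moreover have "disc_ext (\<lambda>_. 1) a = cnj (LINT z|\<mu>. 1 / (1 - cnj a * z))"
    unfolding disc_ext_def by (subst Bochner_Integration.integral_cnj[symmetric]) simp
  ultimately show ?thesis using disc_ext_cmult[of c "\<lambda>_. 1" a] by simp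
qed

lemma disc_ext_id: "cmod a < 1 \<Longrightarrow> disc_ext (\<lambda>z. z) a = a"
  using disc_ext_factor_zero[OF hardy_const, of a 1] disc_ext_minus[OF ess_bounded_id ess_bounded_const, of a a]
  by (simp add: disc_ext_const)

text \<open>Division with remainder by z - a inside H^infinity. The multiplicative and shift
  properties of the extension all rest on it.\<close>

lemma hardy_factor:
  assumes f: "hardy f" and a: "cmod a < 1"
  obtains k where "hardy k" "\<And>z. cmod z = 1 \<Longrightarrow> f z = disc_ext f a + (z - a) * k z"
proof
  define w where "w = disc_ext f a"
  show "hardy (\<lambda>z. (f z - w) * (cnj z / (1 - a * cnj z)))"
    using f a by (intro hardy_divide hardy_minus hardy_const)
      (auto simp: disc_ext_minus hardy_ess_bounded ess_bounded_const disc_ext_const w_def)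
  fix z assume z: "cmod z = 1"
  have "(z - a) * cnj z = 1 - a * cnj z" using circle_mult_cnj[OF z] by (simp add: algebra_simps)
  then have "(z - a) * (cnj z / (1 - a * cnj z)) = 1"
    using cauchy_kernel_nonzero[OF a z] by simp
  then show "f z = disc_ext f a + (z - a) * ((f z - w) * (cnj z / (1 - a * cnj z)))"
  proof -
    assume u: "(z - a) * (cnj z / (1 - a * cnj z)) = 1"
    have "(z - a) * ((f z - w) * (cnj z / (1 - a * cnj z))) = (f z - w) * ((z - a) * (cnj z / (1 - a * cnj z)))"
      by (simp only: mult_ac)
    then show ?thesis unfolding u w_def by simp
  qed
qed

text \<open>Writing f g = f(a) g + (z - a) k g leaves a second term that the evaluation at
  \<open>a\<close> kills.\<close>

lemma disc_ext_mult:
  assumes f: "hardy f" and g: "hardy g" and a: "cmod a < 1"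
  shows "disc_ext (\<lambda>z. f z * g z) a = disc_ext f a * disc_ext g a"
proof -
  obtain k where k: "hardy k" "\<And>z. cmod z = 1 \<Longrightarrow> f z = disc_ext f a + (z - a) * k z"
    using hardy_factor[OF f a] by blast
  have "disc_ext (\<lambda>z. f z * g z) a = disc_ext (\<lambda>z. disc_ext f a * g z + (z - a) * (k z * g z)) a"
    by (rule disc_ext_cong) (subst k(2), auto simp: algebra_simps)
  also have "\<dots> = disc_ext f a * disc_ext g a"
    using disc_ext_factor_zero[OF hardy_mult[OF k(1) g] a] a k(1) g
    by (subst disc_ext_add) (auto simp: disc_ext_cmult hardy_ess_bounded intro!: ess_bounded_intros)
  finally show ?thesis .
qed

text \<open>The Cauchy kernel has L^1 norm greater than 1 for nonzero \<open>a\<close>, so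
  estimating the integral loses a constant; multiplicativity gives the sharp bound.\<close>

lemma disc_ext_bound:
  assumes f: "hardy f" and c: "AE z in \<mu>. cmod (f z) \<le> c" and a: "cmod a < 1"
  shows "cmod (disc_ext f a) \<le> c"
  by (rule multiplicative_functional_bound[OF closed_subalgebra_Hinf, of "\<lambda>f. disc_ext f a"])
     (use f c a in \<open>simp_all add: reps_Hinf disc_ext_mult disc_ext_minus disc_ext_const hardy_ess_bounded disc_ext_cong_AE\<close>)

lemma disc_ext_sums:
  assumes f: "ess_bounded f" and a: "cmod a < 1"
  shows "(\<lambda>n. (LINT z|\<mu>. f z * cnj z ^ n) * a ^ n) sums disc_ext f a"
proof -
  obtain M where M: "AE z in \<mu>. cmod (f z) \<le> M" "M > 0"
    using ess_bounded_pos_bound[OF f] by metis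
  have int: "integrable \<mu> (\<lambda>z. f z * (a * cnj z) ^ n)" for n
    by (intro ess_integrable ess_bounded_intros f)
  have bound: "AE z in \<mu>. norm (f z * (a * cnj z) ^ n) \<le> M * cmod a ^ n" for n
    using M(1) AE_space
    by eventually_elim (auto simp: norm_mult norm_power space_circle_measure intro!: mult_right_mono)
  have geo: "summable (\<lambda>n. M * cmod a ^ n)" using a by (intro summable_mult summable_geometric) simp
  have "(\<lambda>n. LINT z|\<mu>. f z * (a * cnj z) ^ n) sums (LINT z|\<mu>. (\<Sum>n. f z * (a * cnj z) ^ n))"
  proof (rule sums_integral[OF int])
    have "AE z in \<mu>. \<forall>n. norm (f z * (a * cnj z) ^ n) \<le> M * cmod a ^ n"
      using bound by (simp add: AE_all_countable)
    then show "AE z in \<mu>. summable (\<lambda>n. norm (f z * (a * cnj z) ^ n))"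
      by eventually_elim (rule summable_comparison_test'[OF geo], simp)
    show "summable (\<lambda>n. LINT z|\<mu>. norm (f z * (a * cnj z) ^ n))"
    proof (rule summable_comparison_test'[OF geo])
      fix n :: nat
      have "(LINT z|\<mu>. norm (f z * (a * cnj z) ^ n)) \<le> (LINT z|\<mu>. M * cmod a ^ n)"
        by (rule integral_mono_AE) (use bound int in auto)
      then show "norm (LINT z|\<mu>. norm (f z * (a * cnj z) ^ n)) \<le> M * cmod a ^ n"
        using circle.prob_space by (simp add: integral_nonneg_AE)
    qed
  qed
  moreover have "(LINT z|\<mu>. f z * (a * cnj z) ^ n) = (LINT z|\<mu>. f z * cnj z ^ n) * a ^ n" for n
    by (subst integral_mult_left_zero[symmetric]) (simp add: power_mult_distrib mult_ac)
  moreover have "(LINT z|\<mu>. (\<Sum>n. f z * (a * cnj z) ^ n)) = disc_ext f a"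
    unfolding disc_ext_def
  proof (rule Bochner_Integration.integral_cong)
    fix z assume "z \<in> space \<mu>"
    then have "cmod (a * cnj z) < 1" using a by (simp add: norm_mult space_circle_measure)
    then show "(\<Sum>n. f z * (a * cnj z) ^ n) = f z / (1 - a * cnj z)"
      by (subst suminf_mult) (auto simp: suminf_geometric)
  qed simp
  ultimately show ?thesis by simp
qed

lemma disc_ext_holomorphic:
  assumes "ess_bounded f"
  shows "disc_ext f holomorphic_on ball 0 1"
  by (rule power_series_holomorphic[where a = "\<lambda>n. LINT z|\<mu>. f z * cnj z ^ n"])
     (use disc_ext_sums[OF assms] in auto)

lemma disc_ext_circle_ess_bounded:
  assumes "ess_bounded f" "0 \<le> r" "r < 1"
  shows "ess_bounded (\<lambda>z. disc_ext f (of_real r * z))"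
proof (intro ess_bounded_continuous)
  have "continuous_on ((\<lambda>z. of_real r * z) ` sphere 0 1) (disc_ext f)"
    by (rule continuous_on_subset[OF holomorphic_on_imp_continuous_on[OF disc_ext_holomorphic[OF assms(1)]]])
       (use assms in \<open>auto simp: norm_mult\<close>)
  then show "continuous_on (sphere 0 1) (\<lambda>z. disc_ext f (of_real r * z))"
    by (rule continuous_on_compose2) (auto intro!: continuous_intros)
qed

text \<open>Writing f = c + z k lowers every Fourier index by one, and the extension splits in the
  same way; hence an induction on \<open>n\<close> over all \<open>f\<close>.\<close>

lemma fourier_disc_ext:
  assumes f: "hardy f" and r: "0 \<le> r" "r < 1"
  shows "(LINT z|\<mu>. disc_ext f (of_real r * z) * cnj z ^ n) = of_real r ^ n * (LINT z|\<mu>. f z * cnj z ^ n)"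
  using f
proof (induction n arbitrary: f)
  case 0
  show ?case
    using integral_circle_holomorphic[OF disc_ext_holomorphic[OF hardy_ess_bounded[OF 0]] r]
    by (simp add: disc_ext_0)
next
  case (Suc n)
  define c where "c = disc_ext f 0"
  obtain k where k: "hardy k" "\<And>z. cmod z = 1 \<Longrightarrow> f z = c + z * k z"
    using hardy_factor[OF Suc.prems, of 0] by (auto simp: c_def)
  note eb = hardy_ess_bounded[OF Suc.prems] hardy_ess_bounded[OF k(1)]
  have ext: "disc_ext f w = c + w * disc_ext k w" if "cmod w < 1" for w
  proof -
    have "disc_ext f w = disc_ext (\<lambda>z. c + z * k z) w" by (rule disc_ext_cong) (rule k(2))
    also have "\<dots> = c + w * disc_ext k w"
      using that eb k(1) by (simp add: disc_ext_add disc_ext_const ess_bounded_intros disc_ext_mult hardy_id disc_ext_id)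
    finally show ?thesis .
  qed
  have cz: "(LINT z|\<mu>. c * cnj z ^ Suc n) = 0"
    using integral_circle_power[of "Suc n"] Bochner_Integration.integral_cnj[of \<mu> "\<lambda>z. z ^ Suc n"]
    by (simp del: power_Suc)
  have cancel: "x * cnj z ^ Suc n * z = x * cnj z ^ n" if "cmod z = 1" for x z
    using circle_mult_cnj[OF that] by (simp add: mult_ac)
  have "(LINT z|\<mu>. disc_ext f (of_real r * z) * cnj z ^ Suc n) =
      (LINT z|\<mu>. c * cnj z ^ Suc n + of_real r * (disc_ext k (of_real r * z) * cnj z ^ n))"
  proof (rule Bochner_Integration.integral_cong)
    fix z assume "z \<in> space \<mu>"
    then have z: "cmod z = 1" by (simp add: space_circle_measure)
    then have "disc_ext f (of_real r * z) = c + of_real r * z * disc_ext k (of_real r * z)"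
      using r by (intro ext) (simp add: norm_mult)
    then have "disc_ext f (of_real r * z) * cnj z ^ Suc n =
        c * cnj z ^ Suc n + of_real r * disc_ext k (of_real r * z) * cnj z ^ Suc n * z"
      by (simp only: distrib_left distrib_right mult_ac)
    also have "\<dots> = c * cnj z ^ Suc n + of_real r * (disc_ext k (of_real r * z) * cnj z ^ n)"
      unfolding cancel[OF z] by (simp only: mult.assoc)
    finally show "disc_ext f (of_real r * z) * cnj z ^ Suc n =
        c * cnj z ^ Suc n + of_real r * (disc_ext k (of_real r * z) * cnj z ^ n)" .
  qed simp
  also have "\<dots> = (LINT z|\<mu>. c * cnj z ^ Suc n) +
      of_real r * (LINT z|\<mu>. disc_ext k (of_real r * z) * cnj z ^ n)"
    by (subst Bochner_Integration.integral_add)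
       (auto intro!: ess_integrable ess_bounded_intros disc_ext_circle_ess_bounded eb r simp del: power_Suc)
  also have "\<dots> = of_real r ^ Suc n * (LINT z|\<mu>. k z * cnj z ^ n)"
    using cz Suc.IH[OF k(1)] by simp
  also have "(LINT z|\<mu>. k z * cnj z ^ n) = (LINT z|\<mu>. c * cnj z ^ Suc n) + (LINT z|\<mu>. k z * cnj z ^ n)"
    using cz by simp
  also have "\<dots> = (LINT z|\<mu>. c * cnj z ^ Suc n + k z * cnj z ^ n)"
    by (subst Bochner_Integration.integral_add)
       (auto intro!: ess_integrable ess_bounded_intros eb simp del: power_Suc)
  also have "\<dots> = (LINT z|\<mu>. f z * cnj z ^ Suc n)"
  proof (rule Bochner_Integration.integral_cong)
    fix z assume "z \<in> space \<mu>"
    then have z: "cmod z = 1" by (simp add: space_circle_measure)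
    have "f z * cnj z ^ Suc n = c * cnj z ^ Suc n + k z * cnj z ^ Suc n * z"
      unfolding k(2)[OF z] by (simp only: distrib_left distrib_right mult_ac)
    then show "c * cnj z ^ Suc n + k z * cnj z ^ n = f z * cnj z ^ Suc n"
      unfolding cancel[OF z] by (rule sym)
  qed simp
  finally show ?case .
qed

section \<open>Outer functions\<close>

text \<open>The sum of the norms has finite integral, hence is finite almost everywhere.\<close>

lemma AE_summable_of_L1:
  fixes f :: "nat \<Rightarrow> complex \<Rightarrow> 'a::{banach, second_countable_topology}"
  assumes int: "\<And>n. integrable \<mu> (f n)" and bound: "\<And>n. (LINT z|\<mu>. norm (f n z)) \<le> (1 / 2) ^ n"
  shows "AE z in \<mu>. summable (\<lambda>n. norm (f n z))"
proof -
  have [measurable]: "f n \<in> borel_measurable \<mu>" for n using int by (rule borel_measurable_integrable)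
  have "(\<integral>\<^sup>+z. (\<Sum>n. ennreal (norm (f n z))) \<partial>\<mu>) = (\<Sum>n. \<integral>\<^sup>+z. ennreal (norm (f n z)) \<partial>\<mu>)"
    by (rule nn_integral_suminf) measurable
  also have "\<dots> \<le> (\<Sum>n. ennreal ((1 / 2) ^ n))"
  proof (intro suminf_le summableI)
    fix n
    have "(\<integral>\<^sup>+z. ennreal (norm (f n z)) \<partial>\<mu>) = ennreal (LINT z|\<mu>. norm (f n z))"
      by (rule nn_integral_eq_integral) (auto intro: int)
    then show "(\<integral>\<^sup>+z. ennreal (norm (f n z)) \<partial>\<mu>) \<le> ennreal ((1 / 2) ^ n)"
      using bound[of n] by (simp add: ennreal_leI)
  qed
  also have "\<dots> = ennreal (\<Sum>n. (1 / 2) ^ n)"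
    by (rule suminf_ennreal2) (auto intro: summable_geometric)
  also have "\<dots> < \<infinity>" by simp
  finally have "(\<integral>\<^sup>+z. (\<Sum>n. ennreal (norm (f n z))) \<partial>\<mu>) \<noteq> \<infinity>" by simp
  then have "AE z in \<mu>. (\<Sum>n. ennreal (norm (f n z))) \<noteq> \<infinity>"
    by (intro nn_integral_PInf_AE) auto
  then show ?thesis
    by eventually_elim (auto intro: summable_suminf_not_top)
qed

lemma AE_convergent_of_L1:
  fixes s :: "nat \<Rightarrow> complex \<Rightarrow> complex"
  assumes int: "\<And>n. integrable \<mu> (s n)"
    and bound: "\<And>n. (LINT z|\<mu>. cmod (s (Suc n) z - s n z)) \<le> (1 / 2) ^ n"
  obtains F where "F \<in> borel_measurable \<mu>" "AE z in \<mu>. (\<lambda>n. s n z) \<longlonglongrightarrow> F z"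
proof -
  define F where "F z = lim (\<lambda>n. s n z)" for z
  have [measurable]: "s n \<in> borel_measurable \<mu>" for n using int by (rule borel_measurable_integrable)
  have F: "F \<in> borel_measurable \<mu>" unfolding F_def by measurable
  have "AE z in \<mu>. summable (\<lambda>n. norm (s (Suc n) z - s n z))"
    by (rule AE_summable_of_L1[OF Bochner_Integration.integrable_diff[OF int int] bound])
  then have "AE z in \<mu>. (\<lambda>n. s n z) \<longlonglongrightarrow> F z"
  proof eventually_elim
    case (elim z)
    then have "summable (\<lambda>n. s (Suc n) z - s n z)" by (rule summable_norm_cancel)
    then have "convergent (\<lambda>n. \<Sum>i<n. s (Suc i) z - s i z)"
      by (simp only: summable_iff_convergent)
    then have "convergent (\<lambda>n. (\<Sum>i<n. s (Suc i) z - s i z) + s 0 z)"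
      by (intro convergent_add convergent_const)
    also have "(\<lambda>n. (\<Sum>i<n. s (Suc i) z - s i z) + s 0 z) = (\<lambda>n. s n z)"
      using sum_lessThan_telescope[of "\<lambda>n. s n z"] by simp
    finally show ?case by (simp add: convergent_LIMSEQ_iff F_def)
  qed
  with F show thesis by (rule that)
qed

text \<open>Harmonic conjugation is a contraction in L^2: the mean of Re^2 - Im^2 is the real part
  of (p 0)^2, which is nonnegative when \<open>p 0\<close> is real.\<close>

lemma entire_Im_L2:
  assumes p: "p holomorphic_on UNIV" and 0: "Im (p 0) = 0"
  shows "(LINT z|\<mu>. (Im (p z))\<^sup>2) \<le> (LINT z|\<mu>. (Re (p z))\<^sup>2)"
proof -
  have cont: "continuous_on (sphere 0 1) p"
    using p by (meson holomorphic_on_imp_continuous_on continuous_on_subset subset_UNIV)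
  have int: "integrable \<mu> (\<lambda>z. (Re (p z))\<^sup>2)" "integrable \<mu> (\<lambda>z. (Im (p z))\<^sup>2)"
    by (intro integrable_circle_continuous[OF _ order_refl] continuous_intros cont)+
  have intp: "integrable \<mu> (\<lambda>z. (p z)\<^sup>2)"
    by (intro ess_integrable ess_bounded_power entire_ess_bounded p)
  have "(LINT z|\<mu>. (p z)\<^sup>2) = (p 0)\<^sup>2"
    using p by (intro integral_circle_entire holomorphic_intros)
  then have "(LINT z|\<mu>. Re ((p z)\<^sup>2)) = Re ((p 0)\<^sup>2)"
    by (simp only: integral_Re[OF intp])
  moreover have "Re ((p 0)\<^sup>2) \<ge> 0" using 0 by (simp add: power2_eq_square)
  moreover have "(\<lambda>z. Re ((p z)\<^sup>2)) = (\<lambda>z. (Re (p z))\<^sup>2 - (Im (p z))\<^sup>2)"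
    by (simp add: power2_eq_square)
  ultimately show ?thesis using int by simp
qed

lemma L1_Re_entire:
  assumes u: "u \<in> borel_measurable \<mu>" "AE z in \<mu>. \<bar>u z\<bar> \<le> M" and e: "e > 0"
  obtains p where "p holomorphic_on UNIV" "Im (p 0) = 0"
    "\<And>z. norm z = 1 \<Longrightarrow> \<bar>Re (p z)\<bar> \<le> \<bar>M\<bar> + 1" "(LINT z|\<mu>. \<bar>u z - Re (p z)\<bar>) < e"
proof -
  obtain t where t: "trig_poly t" "\<And>z. norm z = 1 \<Longrightarrow> \<bar>Re (t z)\<bar> \<le> \<bar>M\<bar> + 1"
      "(LINT z|\<mu>. \<bar>u z - Re (t z)\<bar>) < e"
    using L1_trig_poly_real[OF u e] by metis
  obtain p q where pq: "analytic_poly p" "analytic_poly q"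
      "\<forall>z. norm z = 1 \<longrightarrow> t z = p z + cnj (q z)"
    using trig_poly_decompose[OF t(1)] by blast
  \<comment> \<open>On the circle cnj q and q have the same real part, so p + q is an entire
    function with real part Re t; the subtracted constant makes its value at 0 real.\<close>
  define P where "P z = p z + q z - \<i> * of_real (Im (p 0 + q 0))" for z
  have Re: "Re (P z) = Re (t z)" if "norm z = 1" for z
    using pq(3) that by (simp add: P_def)
  show thesis
  proof (rule that[of P])
    show "P holomorphic_on UNIV"
      unfolding P_def using pq by (intro holomorphic_intros analytic_poly_entire)
    show "(LINT z|\<mu>. \<bar>u z - Re (P z)\<bar>) < e"
    proof -
      have "(LINT z|\<mu>. \<bar>u z - Re (P z)\<bar>) = (LINT z|\<mu>. \<bar>u z - Re (t z)\<bar>)"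
        by (rule Bochner_Integration.integral_cong) (auto simp: Re space_circle_measure)
      then show ?thesis using t(3) by simp
    qed
  qed (use t Re in \<open>auto simp: P_def\<close>)
qed

text \<open>
  Outer functions are obtained without any boundary value theory: if the entire functions \<open>p n\<close>
  have real parts tending to \<open>u\<close> boundedly and in \<open>L\<^sup>2\<close>, then the bounded functions
  \<open>exp (p n)\<close> converge almost everywhere along a fast sequence.
\<close>

lemma hardy_exp:
  assumes u: "u \<in> borel_measurable \<mu>" "AE z in \<mu>. \<bar>u z\<bar> \<le> M"
  obtains F where "hardy F" "AE z in \<mu>. cmod (F z) = exp (u z)"
    "(LINT z|\<mu>. F z) = of_real (exp (LINT z|\<mu>. u z))"
proof -
  have [measurable]: "u \<in> borel_measurable \<mu>" by fact
  have iu: "integrable \<mu> u" by (rule circle_integrable_bounded[OF u])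
  define B where "B = \<bar>M\<bar> + 1"
  have B: "B \<ge> 1" by (simp add: B_def)
  \<comment> \<open>The estimate of the L^2 norm of p (n + 1) - p n below loses a factor 8 B: 2 from
    the conjugate part, 2 B from bounding one factor of the square, and 2 from the triangle
    inequality. What remains is 4^-n for the square of the norm.\<close>
  define e where "e n = (1 / 4) ^ n / (8 * B)" for n :: nat
  have e: "e n > 0" "8 * B * e n = (1 / 4) ^ n" for n using B by (auto simp: e_def)
  have e2: "e n \<le> (1 / 2) ^ n" for n
  proof -
    have "e n \<le> (1 / 4) ^ n / 1" unfolding e_def using B by (intro divide_left_mono) auto
    also have "\<dots> \<le> (1 / 2) ^ n" using power_mono[of "1 / 4 :: real" "1 / 2" n] by simp
    finally show ?thesis .
  qed
  have "\<exists>p. p holomorphic_on UNIV \<and> Im (p 0) = 0 \<and> (\<forall>z. norm z = 1 \<longrightarrow> \<bar>Re (p z)\<bar> \<le> B) \<and>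
      (LINT z|\<mu>. \<bar>u z - Re (p z)\<bar>) < e n" for n
    by (rule L1_Re_entire[OF u e(1)[of n]]) (auto simp: B_def)
  then obtain p where p: "\<And>n. p n holomorphic_on UNIV" "\<And>n. Im (p n 0) = 0"
      "\<And>n z. norm z = 1 \<Longrightarrow> \<bar>Re (p n z)\<bar> \<le> B" "\<And>n. (LINT z|\<mu>. \<bar>u z - Re (p n z)\<bar>) < e n"
    by metis
  have ep: "ess_bounded (p n)" for n using p(1) by (rule entire_ess_bounded)
  have [measurable]: "p n \<in> borel_measurable \<mu>" for n using ep ess_bounded_measurable by blast
  have iRe: "integrable \<mu> (\<lambda>z. Re (p n z))" for n by (intro integrable_Re ess_integrable ep)
  have cauchy: "(LINT z|\<mu>. cmod (p (Suc n) z - p n z)) \<le> (1 / 2) ^ n" for n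
  proof -
    define d where "d z = p (Suc n) z - p n z" for z
    have d: "d holomorphic_on UNIV" "Im (d 0) = 0"
      unfolding d_def using p by (auto intro!: holomorphic_intros)
    have ed: "ess_bounded d" using d(1) by (rule entire_ess_bounded)
    have [measurable]: "d \<in> borel_measurable \<mu>" using ed by (rule ess_bounded_measurable)
    have bnd: "\<bar>Re (d z)\<bar> \<le> 2 * B" if "norm z = 1" for z
      using p(3)[OF that, of n] p(3)[OF that, of "Suc n"] by (simp add: d_def)
    have iRed: "integrable \<mu> (\<lambda>z. Re (d z))" by (intro integrable_Re ess_integrable ed)
    have i2: "integrable \<mu> (\<lambda>z. (cmod (d z))\<^sup>2)" by (rule integrable_norm_square[OF ed])
    have i2': "integrable \<mu> (\<lambda>z. (Re (d z))\<^sup>2)" "integrable \<mu> (\<lambda>z. (Im (d z))\<^sup>2)"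
      by (rule Bochner_Integration.integrable_bound[OF i2]; simp add: cmod_power2)+
    have "(LINT z|\<mu>. \<bar>Re (d z)\<bar>) \<le> (LINT z|\<mu>. \<bar>u z - Re (p (Suc n) z)\<bar> + \<bar>u z - Re (p n z)\<bar>)"
      by (rule integral_mono) (use iu iRe iRed in \<open>auto simp: d_def\<close>)
    also have "\<dots> \<le> e (Suc n) + e n"
      using p(4)[of n] p(4)[of "Suc n"] iu iRe by simp
    also have "e (Suc n) = e n / 4" by (simp add: e_def)
    also have "e n / 4 + e n \<le> 2 * e n" using e(1)[of n] by simp
    finally have L1: "(LINT z|\<mu>. \<bar>Re (d z)\<bar>) \<le> 2 * e n" .
    have "(LINT z|\<mu>. (cmod (d z))\<^sup>2) = (LINT z|\<mu>. (Re (d z))\<^sup>2) + (LINT z|\<mu>. (Im (d z))\<^sup>2)"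
      using i2' by (simp add: cmod_power2)
    also have "\<dots> \<le> 2 * (LINT z|\<mu>. (Re (d z))\<^sup>2)"
      using entire_Im_L2[OF d] by simp
    also have "(LINT z|\<mu>. (Re (d z))\<^sup>2) \<le> (LINT z|\<mu>. 2 * B * \<bar>Re (d z)\<bar>)"
    proof (rule integral_mono)
      fix z assume "z \<in> space \<mu>"
      then show "(Re (d z))\<^sup>2 \<le> 2 * B * \<bar>Re (d z)\<bar>"
        using bnd[of z] mult_right_mono[of "\<bar>Re (d z)\<bar>" "2 * B" "\<bar>Re (d z)\<bar>"]
        by (simp add: space_circle_measure power2_eq_square)
    qed (use i2' iRed in auto)
    also have "\<dots> \<le> 2 * B * (2 * e n)" using L1 B by simp
    finally have "(LINT z|\<mu>. (cmod (d z))\<^sup>2) \<le> (1 / 4) ^ n" using e(2)[of n] by simp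
    then have "sqrt (LINT z|\<mu>. (cmod (d z))\<^sup>2) \<le> sqrt ((1 / 4) ^ n)" by simp
    also have "\<dots> = (1 / 2) ^ n"
      by (rule real_sqrt_unique) (auto simp: power2_eq_square power_mult_distrib[symmetric])
    finally show ?thesis
      using L1_le_sqrt_L2(2)[of "\<lambda>z. cmod (d z)"] i2 by (simp add: d_def)
  qed
  obtain P where P: "P \<in> borel_measurable \<mu>" "AE z in \<mu>. (\<lambda>n. p n z) \<longlonglongrightarrow> P z"
    by (rule AE_convergent_of_L1[of p]) (use cauchy ess_integrable[OF ep] in auto)
  \<comment> \<open>The same rates make the real parts converge to \<open>u\<close> along this very
    sequence, which identifies the real part of the limit.\<close>
  have "AE z in \<mu>. summable (\<lambda>n. norm (u z - Re (p n z)))"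
  proof (rule AE_summable_of_L1)
    fix n
    show "(LINT z|\<mu>. norm (u z - Re (p n z))) \<le> (1 / 2) ^ n"
      using order_trans[OF less_imp_le[OF p(4)[of n]] e2[of n]] by simp
  qed (use iu iRe in simp)
  then have ReP: "AE z in \<mu>. Re (P z) = u z"
    using P(2)
  proof eventually_elim
    case (elim z)
    have "(\<lambda>n. u z - Re (p n z)) \<longlonglongrightarrow> u z - Re (P z)"
      using elim(2) by (intro tendsto_intros)
    moreover have "(\<lambda>n. u z - Re (p n z)) \<longlonglongrightarrow> 0"
      using summable_LIMSEQ_zero[OF elim(1)] by (simp only: tendsto_norm_zero_iff)
    ultimately show ?case using LIMSEQ_unique by force
  qed
  define F where "F z = exp (P z)" for z
  have [measurable]: "P \<in> borel_measurable \<mu>" by fact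
  have "exp \<in> borel_measurable (borel :: complex measure)"
    by (intro borel_measurable_continuous_onI continuous_intros)
  then have Fm: "F \<in> borel_measurable \<mu>"
    unfolding F_def using measurable_compose[OF P(1)] by blast
  have he: "(\<lambda>z. exp (p n z)) holomorphic_on UNIV" for n
    using p(1) by (intro holomorphic_intros)
  have lim: "AE z in \<mu>. (\<lambda>n. exp (p n z)) \<longlonglongrightarrow> F z"
    using P(2) unfolding F_def by eventually_elim (intro tendsto_intros)
  have bound: "AE z in \<mu>. cmod (exp (p n z)) \<le> exp B" for n
    by (rule AE_circleI) (use p(3) in \<open>auto intro: order_trans abs_ge_self\<close>)
  note hl = hardy_limit[OF entire_hardy[OF he] bound Fm lim]
  \<comment> \<open>Here the normalization of \<open>p n 0\<close> to a real number is used: it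
    makes the mean of exp (p n) the exponential of the mean of Re (p n).\<close>
  have val: "(LINT z|\<mu>. exp (p n z)) = of_real (exp (LINT z|\<mu>. Re (p n z)))" for n
  proof -
    have "(LINT z|\<mu>. Re (p n z)) = Re (p n 0)"
      by (simp only: integral_Re[OF ess_integrable[OF ep]] integral_circle_entire[OF p(1)])
    moreover have "p n 0 = of_real (Re (p n 0))" using p(2)[of n] by (simp add: complex_eq_iff)
    ultimately show ?thesis
      unfolding integral_circle_entire[OF he] by (metis exp_of_real)
  qed
  have "(\<lambda>n. LINT z|\<mu>. Re (p n z)) \<longlonglongrightarrow> (LINT z|\<mu>. u z)"
  proof (rule LIM_zero_cancel, rule Lim_null_comparison)
    show "\<forall>\<^sub>F n in sequentially. norm ((LINT z|\<mu>. Re (p n z)) - (LINT z|\<mu>. u z)) \<le> (1 / 2) ^ n"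
    proof (rule always_eventually, rule allI)
      fix n
      have "norm ((LINT z|\<mu>. Re (p n z)) - (LINT z|\<mu>. u z)) = \<bar>LINT z|\<mu>. u z - Re (p n z)\<bar>"
        using iu iRe by simp
      also have "\<dots> \<le> (LINT z|\<mu>. \<bar>u z - Re (p n z)\<bar>)" by (rule integral_abs_bound)
      finally show "norm ((LINT z|\<mu>. Re (p n z)) - (LINT z|\<mu>. u z)) \<le> (1 / 2) ^ n"
        using p(4)[of n] e2[of n] by linarith
    qed
  qed (rule LIMSEQ_power_zero, simp)
  then have "(\<lambda>n. complex_of_real (exp (LINT z|\<mu>. Re (p n z)))) \<longlonglongrightarrow> of_real (exp (LINT z|\<mu>. u z))"
    by (intro tendsto_intros)
  then have "(LINT z|\<mu>. F z) = of_real (exp (LINT z|\<mu>. u z))"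
    using hl(2) unfolding val by (rule LIMSEQ_unique[rotated])
  moreover have "AE z in \<mu>. cmod (F z) = exp (u z)"
    using ReP by eventually_elim (simp add: F_def)
  ultimately show thesis using that hl(1) by blast
qed

section \<open>Douglas algebras contain \<open>1 / z\<close>\<close>

lemma closed_unital_douglas:
  assumes "douglas_algebra D"
  shows "closed_subalgebra D"
  using assms closed_subalgebra_Hinf
  by (auto simp: douglas_algebra_def closed_subalgebra_def)

lemma hardy_in_douglas:
  assumes "douglas_algebra D" "hardy f"
  shows "f \<in> reps D"
  using assms reps_mono[of Hinf D] by (auto simp: douglas_algebra_def reps_Hinf[symmetric])

text \<open>From ln x <= x - 1 at x = |1 + w|^2. The error is quadratic, so for small perturbations
  the sign of the mean of Re w decides.\<close>

lemma ln_norm_one_plus_le: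
  assumes "1 + w \<noteq> 0"
  shows "ln (cmod (1 + w)) \<le> Re w + (cmod w)\<^sup>2 / 2"
proof -
  have "2 * ln (cmod (1 + w)) = ln ((cmod (1 + w))\<^sup>2)"
    using assms by (simp add: ln_realpow)
  also have "\<dots> \<le> (cmod (1 + w))\<^sup>2 - 1"
    using assms by (intro ln_le_minus_one) simp
  also have "\<dots> = 2 * Re w + (cmod w)\<^sup>2"
    unfolding cmod_power2 by (simp add: power2_eq_square algebra_simps)
  finally show ?thesis by simp
qed

text \<open>
  Perturbing \<open>1\<close> by a small multiple of \<open>z d z\<close> with negative mean and correcting the modulus by an
  outer function lowers the norm below the modulus of the mean. Hence some \<open>1 + z d z\<close> has norm
  less than \<open>1\<close>.
\<close>

lemma douglas_small_perturbation:
  assumes D: "douglas_algebra D"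
  obtains d c where "d \<in> reps D" "c < 1" "AE z in \<mu>. cmod (1 + z * d z) \<le> c"
proof -
  note cu = closed_unital_douglas[OF D]
  obtain F where "F \<in> D" "F \<notin> Hinf" using D by (auto simp: douglas_algebra_def)
  then obtain f where f: "f \<in> reps D" "\<not> hardy f"
    by (metis in_reps_obtain reps_Hinf reps_def mem_Collect_eq)
  then obtain n where n: "(LINT z|\<mu>. f z * z ^ Suc n) \<noteq> 0"
    using reps_ess_bounded unfolding hardy_def by blast
  define I where "I = (LINT z|\<mu>. f z * z ^ Suc n)"
  \<comment> \<open>The factor z^n moves the nonzero coefficient of index -(n + 1) to index -1, and
    the scaling gives z g(z) the mean -1.\<close>
  define g where "g z = (- 1 / I) * (f z * z ^ n)" for z
  have zD: "(\<lambda>z. z) \<in> reps D" by (intro hardy_in_douglas D hardy_id)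
  have g: "g \<in> reps D"
    unfolding g_def by (intro reps_mult reps_const reps_power cu f zD)
  have eg: "ess_bounded g" using g by (rule reps_ess_bounded)
  have "(LINT z|\<mu>. z * g z) = (LINT z|\<mu>. (- 1 / I) * (f z * z ^ Suc n))"
    by (simp add: g_def mult_ac)
  also have "\<dots> = (- 1 / I) * I" unfolding I_def by (rule integral_mult_right_zero)
  finally have Ig: "(LINT z|\<mu>. z * g z) = - 1" using n by (simp add: I_def)
  obtain K where K: "K > 0" "AE z in \<mu>. cmod (g z) \<le> K" using ess_bounded_pos_bound[OF eg] by metis
  \<comment> \<open>The bound t K <= 1/2 keeps 1 + w away from 0; t K^2 <= 1 keeps the quadratic
    error at most t / 2, half of the linear gain t.\<close>
  define t where "t = min (1 / (2 * K)) (1 / K\<^sup>2)"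
  have t: "t > 0" "t * K \<le> 1 / 2" "t * K\<^sup>2 \<le> 1"
  proof -
    show "t > 0" using K by (simp add: t_def)
    have "t * K \<le> 1 / (2 * K) * K" using K by (intro mult_right_mono) (auto simp: t_def)
    then show "t * K \<le> 1 / 2" using K by simp
    have "t * K\<^sup>2 \<le> 1 / K\<^sup>2 * K\<^sup>2" by (intro mult_right_mono) (auto simp: t_def)
    then show "t * K\<^sup>2 \<le> 1" using K by simp
  qed
  define w where "w z = of_real t * (z * g z)" for z
  have ew: "ess_bounded w" unfolding w_def by (intro ess_bounded_intros eg)
  have [measurable]: "w \<in> borel_measurable \<mu>" using ew by (rule ess_bounded_measurable)
  have wle: "AE z in \<mu>. cmod (w z) \<le> t * K"
    using K(2) AE_space
    by eventually_elim (use t in \<open>auto simp: w_def norm_mult space_circle_measure\<close>)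
  have lower: "AE z in \<mu>. 1 / 2 \<le> cmod (1 + w z) \<and> cmod (1 + w z) \<le> 2"
    using wle
  proof eventually_elim
    case (elim z)
    have "cmod 1 - cmod (w z) \<le> cmod (1 + w z)" using norm_diff_ineq[of 1 "w z"] by simp
    moreover have "cmod (1 + w z) \<le> 1 + cmod (w z)" using norm_triangle_ineq[of 1 "w z"] by simp
    ultimately show ?case using elim t(2) by auto
  qed
  define v where "v z = ln (cmod (1 + w z))" for z
  have [measurable]: "v \<in> borel_measurable \<mu>" unfolding v_def by measurable
  have vb: "AE z in \<mu>. \<bar>v z\<bar> \<le> ln 2"
    using lower
  proof eventually_elim
    case (elim z)
    then have "ln (1 / 2) \<le> v z" "v z \<le> ln 2" unfolding v_def by (auto intro!: ln_mono)
    then show ?case by (simp add: ln_div abs_le_iff)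
  qed
  have iv: "integrable \<mu> v" by (rule circle_integrable_bounded[OF _ vb]) measurable
  have iw: "integrable \<mu> (\<lambda>z. Re (w z))" by (intro integrable_Re ess_integrable ew)
  have "(LINT z|\<mu>. v z) \<le> (LINT z|\<mu>. Re (w z) + (t * K)\<^sup>2 / 2)"
  proof (rule integral_mono_AE)
    show "AE z in \<mu>. v z \<le> Re (w z) + (t * K)\<^sup>2 / 2"
      using lower wle
    proof eventually_elim
      case (elim z)
      then have "1 + w z \<noteq> 0" by auto
      then have "v z \<le> Re (w z) + (cmod (w z))\<^sup>2 / 2" unfolding v_def by (rule ln_norm_one_plus_le)
      also have "(cmod (w z))\<^sup>2 \<le> (t * K)\<^sup>2" using elim by (intro power_mono) auto
      finally show ?case by simp
    qed
  qed (use iv iw in auto)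
  also have "\<dots> = Re (LINT z|\<mu>. w z) + (t * K)\<^sup>2 / 2"
    using iw circle.prob_space integral_Re[OF ess_integrable[OF ew]] by simp
  also have "(LINT z|\<mu>. w z) = - of_real t"
    unfolding w_def integral_mult_right_zero Ig by simp
  also have "(t * K)\<^sup>2 / 2 \<le> t / 2"
  proof -
    have "(t * K)\<^sup>2 = t * (t * K\<^sup>2)" by (simp add: power2_eq_square)
    also have "\<dots> \<le> t * 1" using t by (intro mult_left_mono) auto
    finally show ?thesis by simp
  qed
  finally have neg: "(LINT z|\<mu>. v z) < 0" using t(1) by simp
  \<comment> \<open>Outer with |h| = 1 / |1 + w|, so (1 + w) h is unimodular although
    \<open>h\<close> has mean a > 1.\<close>
  obtain h where h: "hardy h" "AE z in \<mu>. cmod (h z) = exp (- v z)"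
      "(LINT z|\<mu>. h z) = of_real (exp (LINT z|\<mu>. - v z))"
    by (rule hardy_exp[of "\<lambda>z. - v z" "ln 2"]) (use vb in auto)
  define a where "a = exp (LINT z|\<mu>. - v z)"
  have a: "a > 1" using neg by (simp add: a_def)
  have "disc_ext h 0 = of_real a" by (simp add: disc_ext_0 h(3) a_def)
  then obtain k where k: "hardy k" "\<And>z. cmod z = 1 \<Longrightarrow> h z = of_real a + z * k z"
    using hardy_factor[OF h(1), of 0] by auto
  \<comment> \<open>Solves a (1 + z d) = (1 + w) h, whose right-hand side has modulus 1.\<close>
  define d where "d z = (1 / of_real a) * (k z + of_real t * (g z * h z))" for z
  have dD: "d \<in> reps D"
    unfolding d_def by (intro reps_mult reps_add reps_const cu g hardy_in_douglas[OF D] k(1) h(1))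
  have "AE z in \<mu>. cmod (1 + z * d z) \<le> 1 / a"
    using h(2) lower AE_space
  proof eventually_elim
    case (elim z)
    then have z: "cmod z = 1" by (simp add: space_circle_measure)
    have "of_real a * (1 + z * d z) = (of_real a + z * k z) + w z * h z"
      using a by (simp add: d_def w_def field_simps)
    also have "\<dots> = (1 + w z) * h z" by (simp add: k(2)[OF z, symmetric] distrib_right)
    finally have "a * cmod (1 + z * d z) = cmod (1 + w z) * cmod (h z)"
      using a by (metis abs_of_pos norm_mult norm_of_real less_trans zero_less_one)
    also have "\<dots> = 1"
    proof -
      have "cmod (1 + w z) > 0" using elim by auto
      then show ?thesis using elim(1) by (simp add: v_def exp_minus)
    qed
    finally show ?case using a by (simp add: field_simps)
  qed
  then show thesis using that[OF dD, of "1 / a"] a by simp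
qed

text \<open>Since 1 + z d has norm below 1, the Neumann series inverts - z d within
  \<open>D\<close>; multiplying the inverse by - d leaves 1 / z.\<close>

lemma douglas_cnj:
  assumes D: "douglas_algebra D"
  shows "cnj \<in> reps D"
proof -
  note cu = closed_unital_douglas[OF D]
  obtain d c where d: "d \<in> reps D" "c < 1" "AE z in \<mu>. cmod (1 + z * d z) \<le> c"
    by (rule douglas_small_perturbation[OF D])
  have "(\<lambda>z. 1 + z * d z) \<in> reps D"
    by (intro reps_add reps_mult reps_const cu d hardy_in_douglas[OF D] hardy_id)
  then have "(\<lambda>z. 1 / (1 - (1 + z * d z))) \<in> reps D"
    by (rule reps_inverse_one_minus[OF cu _ d(3,2)])
  then have "(\<lambda>z. (- 1) * (d z * (1 / (1 - (1 + z * d z))))) \<in> reps D"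
    by (intro reps_mult reps_const cu d)
  then show ?thesis
  proof (rule reps_cong_AE)
    show "AE z in \<mu>. (- 1) * (d z * (1 / (1 - (1 + z * d z)))) = cnj z"
      using d(3) AE_space
    proof eventually_elim
      case (elim z)
      have "d z \<noteq> 0" using elim(1) d(2) by auto
      then have "(- 1) * (d z * (1 / (1 - (1 + z * d z)))) = inverse z"
        by (simp add: field_simps)
      then show ?case using elim(2) by (simp add: inverse_circle space_circle_measure)
    qed
    show "cnj \<in> borel_measurable \<mu>" by (intro measurable_circle_continuous continuous_intros)
  qed
qed

section \<open>Inner functions close to \<open>1\<close>\<close>

lemma hardy_cong:
  assumes "hardy f" "\<And>z. cmod z = 1 \<Longrightarrow> f z = g z"
  shows "hardy g"
proof -
  have "g \<in> borel_measurable \<mu>"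
    using ess_bounded_measurable[OF hardy_ess_bounded[OF assms(1)]]
    by (rule measurable_cong[THEN iffD1, rotated]) (auto simp: assms(2) space_circle_measure)
  then show ?thesis
    using reps_cong_AE[of f Hinf g] assms by (auto simp: reps_Hinf intro: AE_circleI)
qed

section \<open>Blaschke factors and removal of zeros\<close>

definition blaschke :: "complex \<Rightarrow> complex \<Rightarrow> complex" where
  "blaschke a z = (z - a) / (1 - cnj a * z)"

lemma blaschke_denominator_nonzero:
  assumes "cmod a < 1" "cmod z \<le> 1"
  shows "1 - cnj a * z \<noteq> 0"
proof
  assume "1 - cnj a * z = 0"
  then have "cmod (cnj a * z) = 1" by (metis eq_iff_diff_eq_0 norm_one)
  moreover have "cmod a * cmod z \<le> cmod a * 1" using assms by (intro mult_left_mono) auto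
  ultimately show False using assms by (simp add: norm_mult)
qed

lemma norm_blaschke:
  assumes a: "cmod a < 1" and z: "cmod z = 1"
  shows "cmod (blaschke a z) = 1"
proof -
  have "(z - a) * cnj z = cnj (1 - cnj a * z)" using circle_mult_cnj[OF z] by (simp add: algebra_simps)
  then have "cmod ((z - a) * cnj z) = cmod (1 - cnj a * z)" by (simp only: complex_mod_cnj)
  then have "cmod (z - a) = cmod (1 - cnj a * z)" using z by (simp add: norm_mult)
  then show ?thesis
    using blaschke_denominator_nonzero[OF a, of z] z by (simp add: blaschke_def norm_divide)
qed

lemma hardy_blaschke:
  assumes a: "cmod a < 1"
  shows "hardy (blaschke a)"
proof -
  have "hardy (\<lambda>z. 1 / (1 - cnj a * z))"
    by (rule hardy_inverse_one_minus[of _ "cmod a"])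
       (use a in \<open>auto intro!: hardy_cmult hardy_id AE_circleI simp: norm_mult\<close>)
  from hardy_mult[OF hardy_minus[OF hardy_id hardy_const[of a]] this]
  show ?thesis by (rule hardy_cong) (simp add: blaschke_def)
qed

lemma disc_ext_blaschke:
  assumes a: "cmod a < 1" and w: "cmod w < 1"
  shows "disc_ext (blaschke a) w * (1 - cnj a * w) = w - a"
proof -
  have 1: "hardy (\<lambda>z. 1 - cnj a * z)" by (intro hardy_minus hardy_cmult hardy_const hardy_id)
  have lin: "disc_ext (\<lambda>z. 1 - cnj a * z) w = 1 - cnj a * w"
    using w disc_ext_cmult[of "cnj a" "\<lambda>z. z" w]
    by (subst disc_ext_minus) (auto intro!: ess_bounded_intros simp: disc_ext_const disc_ext_id)
  have "disc_ext (blaschke a) w * (1 - cnj a * w) = disc_ext (\<lambda>z. blaschke a z * (1 - cnj a * z)) w"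
    by (simp add: disc_ext_mult[OF hardy_blaschke[OF a] 1 w] lin)
  also have "\<dots> = disc_ext (\<lambda>z. z - a) w"
    by (rule disc_ext_cong) (use blaschke_denominator_nonzero[OF a] in \<open>simp add: blaschke_def\<close>)
  also have "\<dots> = w - a"
    using w by (subst disc_ext_minus) (auto intro!: ess_bounded_intros simp: disc_ext_const disc_ext_id)
  finally show ?thesis .
qed

text \<open>On the circle this conjugate is the inverse of the Blaschke factor, so dividing by such
  a factor stays in \<open>D\<close>.\<close>

lemma cnj_blaschke_in_douglas:
  assumes D: "douglas_algebra D" and a: "cmod a < 1"
  shows "(\<lambda>z. cnj (blaschke a z)) \<in> reps D"
proof -
  note cu = closed_unital_douglas[OF D]
  have "(\<lambda>z. 1 / (1 - a * cnj z)) \<in> reps D"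
    by (rule reps_inverse_one_minus[OF cu, of _ "cmod a"])
       (use a in \<open>auto intro!: reps_mult reps_const cu douglas_cnj D AE_circleI simp: norm_mult\<close>)
  then have "(\<lambda>z. (cnj z - cnj a) * (1 / (1 - a * cnj z))) \<in> reps D"
    by (intro reps_mult reps_minus reps_const cu douglas_cnj D)
  then show ?thesis by (simp add: blaschke_def)
qed

text \<open>Division by z - a followed by multiplication with 1 - cnj a z, which restores the
  modulus on the circle.\<close>

lemma hardy_remove_zero:
  assumes h: "hardy h" and a: "cmod a < 1" and zero: "disc_ext h a = 0"
  shows "hardy (\<lambda>z. cnj (blaschke a z) * h z)"
proof -
  have "hardy (\<lambda>z. (1 - cnj a * z) * (h z * (cnj z / (1 - a * cnj z))))"
    by (intro hardy_mult hardy_minus hardy_cmult hardy_const hardy_id hardy_divide h a zero)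
  then show ?thesis
  proof (rule hardy_cong)
    fix z :: complex assume z: "cmod z = 1"
    have "(1 - cnj a * z) * cnj z = cnj z - cnj a" using circle_mult_cnj[OF z] by (simp add: algebra_simps)
    have "(1 - cnj a * z) * (h z * (cnj z / (1 - a * cnj z))) = ((1 - cnj a * z) * cnj z) * h z / (1 - a * cnj z)"
      by (simp only: times_divide_eq_left times_divide_eq_right mult_ac)
    also have "\<dots> = cnj (blaschke a z) * h z"
      unfolding \<open>(1 - cnj a * z) * cnj z = cnj z - cnj a\<close> by (simp add: blaschke_def)
    finally show "(1 - cnj a * z) * (h z * (cnj z / (1 - a * cnj z))) = cnj (blaschke a z) * h z" .
  qed
qed

text \<open>
  Each removed zero \<open>a\<close> with \<open>\<bar>a\<bar> < R\<close> multiplies \<open>\<bar>h(0)\<bar>\<close> by \<open>1 / \<bar>a\<bar> > 1 / R\<close>, while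
  \<open>\<bar>h(0)\<bar>\<close> never exceeds \<open>1\<close>. So only finitely many zeros can be removed.
\<close>

lemma remove_zeros:
  assumes D: "douglas_algebra D" and R: "0 < R" "R < 1"
    and h: "hardy h" "unimodular h" "disc_ext h 0 \<noteq> 0"
  obtains q where "q \<in> reps D" "unimodular q" "hardy (\<lambda>z. cnj (q z))"
    "hardy (\<lambda>z. q z * h z)" "\<forall>a. cmod a < R \<longrightarrow> disc_ext (\<lambda>z. q z * h z) a \<noteq> 0"
proof -
  note cu = closed_unital_douglas[OF D]
  \<comment> \<open>The exponent \<open>N\<close> bounds the number of removals still possible. At N
    = 0 the hypothesis would say |h(0)| > 1, and every removal lowers the admissible
    \<open>N\<close> by one.\<close>
  have main: "\<exists>q\<in>reps D. unimodular q \<and> hardy (\<lambda>z. cnj (q z)) \<and>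
      hardy (\<lambda>z. q z * h z) \<and> (\<forall>a. cmod a < R \<longrightarrow> disc_ext (\<lambda>z. q z * h z) a \<noteq> 0)"
    if "hardy h" "unimodular h" "R ^ N < cmod (disc_ext h 0)" for N h
    using that
  proof (induction N arbitrary: h)
    case 0
    have "cmod (disc_ext h 0) \<le> 1" by (rule disc_ext_bound) (use 0 in auto)
    then show ?case using 0 by simp
  next
    case (Suc N)
    show ?case
    proof (cases "\<exists>a. cmod a < R \<and> disc_ext h a = 0")
      case False
      then show ?thesis
        using Suc.prems by (intro bexI[of _ "\<lambda>_. 1"]) (auto intro: reps_const cu hardy_const)
    next
      case True
      then obtain a where a: "cmod a < R" "disc_ext h a = 0" by blast
      then have a1: "cmod a < 1" using R by simp
      define h1 where "h1 z = cnj (blaschke a z) * h z" for z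
      have h1: "hardy h1" unfolding h1_def by (intro hardy_remove_zero Suc.prems a1 a)
      have h1n: "unimodular h1"
        using Suc.prems(2) AE_space
        by eventually_elim (simp add: h1_def norm_mult norm_blaschke[OF a1] space_circle_measure)
      have "disc_ext h 0 = disc_ext (\<lambda>z. blaschke a z * h1 z) 0"
      proof (rule disc_ext_cong)
        fix z :: complex assume z: "cmod z = 1"
        have "blaschke a z * cnj (blaschke a z) = 1"
          by (rule circle_mult_cnj[OF norm_blaschke[OF a1 z]])
        then show "h z = blaschke a z * h1 z" by (simp add: h1_def mult.assoc[symmetric])
      qed
      also have "\<dots> = disc_ext (blaschke a) 0 * disc_ext h1 0"
        by (intro disc_ext_mult hardy_blaschke a1 h1) simp
      also have "disc_ext (blaschke a) 0 = - a"
        using disc_ext_blaschke[OF a1, of 0] by simp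
      finally have eq: "cmod (disc_ext h 0) = cmod a * cmod (disc_ext h1 0)" by (simp add: norm_mult)
      also have "\<dots> \<le> R * cmod (disc_ext h1 0)" using a by (intro mult_right_mono) auto
      finally have "R * R ^ N < R * cmod (disc_ext h1 0)" using Suc.prems(3) by simp
      then have "R ^ N < cmod (disc_ext h1 0)" using R by simp
      from Suc.IH[OF h1 h1n this] obtain q where q: "q \<in> reps D" "unimodular q"
        "hardy (\<lambda>z. cnj (q z))" "hardy (\<lambda>z. q z * h1 z)"
        "\<forall>a. cmod a < R \<longrightarrow> disc_ext (\<lambda>z. q z * h1 z) a \<noteq> 0" by blast
      have assoc: "(\<lambda>z. q z * cnj (blaschke a z) * h z) = (\<lambda>z. q z * h1 z)"
        by (simp add: h1_def mult.assoc)
      show ?thesis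
      proof (intro bexI[of _ "\<lambda>z. q z * cnj (blaschke a z)"] conjI)
        show "AE z in \<mu>. cmod (q z * cnj (blaschke a z)) = 1"
          using q(2) AE_space
          by eventually_elim (simp add: norm_mult norm_blaschke[OF a1] space_circle_measure)
        show "hardy (\<lambda>z. cnj (q z * cnj (blaschke a z)))"
          using hardy_mult[OF q(3) hardy_blaschke[OF a1]] by simp
        show "(\<lambda>z. q z * cnj (blaschke a z)) \<in> reps D"
          by (intro reps_mult cu q cnj_blaschke_in_douglas D a1)
      qed (use q in \<open>simp_all only: assoc\<close>)
    qed
  qed
  obtain N where N: "R ^ N < cmod (disc_ext h 0)"
    using real_arch_pow_inv[of "cmod (disc_ext h 0)" R] R h(3) by auto
  show thesis using main[OF h(1,2) N] that by blast
qed

section \<open>Radial means of inner functions\<close>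

lemma hardy_radial_trig_poly:
  assumes f: "hardy f" and t: "trig_poly t"
  shows "((\<lambda>r. LINT z|\<mu>. disc_ext f (of_real r * z) * cnj (t z)) \<longlongrightarrow> (LINT z|\<mu>. f z * cnj (t z))) (at_left 1)"
  using t
proof (induction rule: trig_poly.induct)
  case (trig_poly_monomial c n)
  note ev = eventually_at_left_real[of 0 "1 :: real", simplified]
  show ?case
  proof (cases "n \<ge> 0")
    case True
    then obtain k where n: "n = int k" using nonneg_int_cases by blast
    define J where "J = (LINT z|\<mu>. f z * cnj z ^ k)"
    have pull: "(LINT z|\<mu>. g z * cnj (c * z powi n)) = cnj c * (LINT z|\<mu>. g z * cnj z ^ k)" for g
      by (subst integral_mult_right_zero[symmetric]) (simp add: n mult_ac)
    \<comment> \<open>The k-th coefficient of the dilated function is r^k times that of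
      \<open>f\<close>, so this pairing is a monomial in \<open>r\<close>.\<close>
    have "((\<lambda>r. cnj c * (of_real r ^ k * J)) \<longlongrightarrow> cnj c * (of_real 1 ^ k * J)) (at_left 1)"
      by (intro tendsto_intros)
    then have "((\<lambda>r. cnj c * (LINT z|\<mu>. disc_ext f (of_real r * z) * cnj z ^ k)) \<longlongrightarrow>
        cnj c * (of_real 1 ^ k * J)) (at_left 1)"
    proof (rule Lim_transform_eventually)
      show "\<forall>\<^sub>F r in at_left 1. cnj c * (of_real r ^ k * J) =
          cnj c * (LINT z|\<mu>. disc_ext f (of_real r * z) * cnj z ^ k)"
        using ev by eventually_elim (simp add: fourier_disc_ext[OF f] J_def)
    qed
    then show ?thesis unfolding pull J_def by simp
  next
    case False
    then obtain k where k: "n = - int k" "k > 0"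
      by (metis linorder_not_le neg_int_cases)
    have pull: "(LINT z|\<mu>. g z * cnj (c * z powi n)) = cnj c * (LINT z|\<mu>. g z * z ^ k)" for g
      by (subst integral_mult_right_zero[symmetric], rule Bochner_Integration.integral_cong)
         (auto simp: k powi_minus_circle space_circle_measure mult_ac)
    \<comment> \<open>For negative index the coefficient of the dilated function is, up to a power
      of \<open>r\<close>, the mean of a holomorphic function that vanishes at 0.\<close>
    have zero: "(LINT z|\<mu>. disc_ext f (of_real r * z) * z ^ k) = 0" if r: "r \<in> {0<..<1}" for r
    proof -
      have "(\<lambda>w. disc_ext f w * w ^ k) holomorphic_on ball 0 1"
        by (intro holomorphic_intros disc_ext_holomorphic hardy_ess_bounded f)
      then have "(LINT z|\<mu>. disc_ext f (of_real r * z) * (of_real r * z) ^ k) = 0"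
        using integral_circle_holomorphic[of "\<lambda>w. disc_ext f w * w ^ k" 1 r] r k by simp
      moreover have "(LINT z|\<mu>. disc_ext f (of_real r * z) * (of_real r * z) ^ k) =
          of_real r ^ k * (LINT z|\<mu>. disc_ext f (of_real r * z) * z ^ k)"
        by (subst integral_mult_right_zero[symmetric]) (simp add: power_mult_distrib mult_ac)
      ultimately show ?thesis using r by simp
    qed
    show ?thesis
      unfolding pull hardy_integral_power[OF f k(2)]
    proof (rule tendsto_eventually)
      show "\<forall>\<^sub>F r in at_left 1. cnj c * (LINT z|\<mu>. disc_ext f (of_real r * z) * z ^ k) = cnj c * 0"
        using ev by eventually_elim (simp add: zero)
    qed
  qed
next
  case (trig_poly_add s t)
  note eb = trig_poly_ess_bounded[OF trig_poly_add.hyps(1)] trig_poly_ess_bounded[OF trig_poly_add.hyps(2)]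
  note ev = eventually_at_left_real[of 0 "1 :: real", simplified]
  have split: "(LINT z|\<mu>. g z * cnj (s z + t z)) = (LINT z|\<mu>. g z * cnj (s z)) + (LINT z|\<mu>. g z * cnj (t z))"
    if "ess_bounded g" for g
    unfolding complex_cnj_add distrib_left
    by (intro Bochner_Integration.integral_add ess_integrable ess_bounded_intros that eb)
  have "((\<lambda>r. (LINT z|\<mu>. disc_ext f (of_real r * z) * cnj (s z)) + (LINT z|\<mu>. disc_ext f (of_real r * z) * cnj (t z)))
      \<longlongrightarrow> (LINT z|\<mu>. f z * cnj (s z + t z))) (at_left 1)"
    unfolding split[OF hardy_ess_bounded[OF f]] by (intro tendsto_add trig_poly_add.IH)
  then show ?case
  proof (rule Lim_transform_eventually)
    show "\<forall>\<^sub>F r in at_left 1. (LINT z|\<mu>. disc_ext f (of_real r * z) * cnj (s z)) + (LINT z|\<mu>. disc_ext f (of_real r * z) * cnj (t z))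
        = (LINT z|\<mu>. disc_ext f (of_real r * z) * cnj (s z + t z))"
      using ev
    proof eventually_elim
      case (elim r)
      then show ?case
        by (intro split[symmetric] disc_ext_circle_ess_bounded hardy_ess_bounded f) auto
    qed
  qed
qed

text \<open>For a trigonometric polynomial \<open>t\<close> near \<open>h\<close>, the pairing of
  h(r z) with \<open>t\<close> tends to that of \<open>h\<close> with \<open>t\<close>, whose real
  part is nearly 1 because |h| = 1. Since |h(r z)| is at least Re (h(r z) cnj (h z)), its mean must
  then be nearly 1 as well.\<close>

lemma inner_radial_limit:
  assumes h: "hardy h" "unimodular h" and e: "e > 0"
  obtains r where "0 < r" "r < 1" "(LINT z|\<mu>. 1 - cmod (disc_ext h (of_real r * z))) < e"
proof -
  have eh: "ess_bounded h" using h(1) by (rule hardy_ess_bounded)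
  have [measurable]: "h \<in> borel_measurable \<mu>" using eh by (rule ess_bounded_measurable)
  obtain t where t: "trig_poly t" "(LINT z|\<mu>. cmod (h z - t z)) < e / 4"
    by (rule L1_trig_poly[of h 1 "e / 4"]) (use h(2) e in \<open>auto elim: eventually_mono\<close>)
  have et: "ess_bounded t" using t(1) by (rule trig_poly_ess_bounded)
  define L where "L r = (LINT z|\<mu>. disc_ext h (of_real r * z) * cnj (t z))" for r :: real
  define L1 where "L1 = (LINT z|\<mu>. h z * cnj (t z))"
  have "(L \<longlongrightarrow> L1) (at_left 1)"
    unfolding L_def L1_def by (rule hardy_radial_trig_poly[OF h(1) t(1)])
  then have "\<forall>\<^sub>F r in at_left 1. dist (L r) L1 < e / 4"
    using e by (intro tendstoD) auto
  moreover have "\<forall>\<^sub>F r in at_left 1. r \<in> {0<..<1::real}"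
    by (rule eventually_at_left_real) simp
  ultimately have "\<forall>\<^sub>F r in at_left (1::real). dist (L r) L1 < e / 4 \<and> r \<in> {0<..<1::real}"
    by eventually_elim simp
  then have "\<exists>r. dist (L r) L1 < e / 4 \<and> r \<in> {0<..<1}"
    by (rule eventually_happens'[rotated]) simp
  then obtain r where r: "dist (L r) L1 < e / 4" "0 < r" "r < 1" by auto
  have er: "ess_bounded (\<lambda>z. disc_ext h (of_real r * z))"
    using r by (intro disc_ext_circle_ess_bounded eh) auto
  \<comment> \<open>Replacing \<open>h\<close> by \<open>t\<close> in a pairing with a function
    bounded by 1 costs at most |h - t|.\<close>
  have approx: "Re (g z * cnj (t z)) \<ge> Re (g z * cnj (h z)) - cmod (h z - t z) \<and>
      Re (g z * cnj (h z)) \<ge> Re (g z * cnj (t z)) - cmod (h z - t z)" if "cmod (g z) \<le> 1" for g and z :: complex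
  proof -
    have "\<bar>Re (g z * cnj (h z - t z))\<bar> \<le> cmod (g z * cnj (h z - t z))" by (rule abs_Re_le_cmod)
    also have "\<dots> = cmod (g z) * cmod (h z - t z)" by (simp only: norm_mult complex_mod_cnj)
    also have "\<dots> \<le> 1 * cmod (h z - t z)" using that by (intro mult_right_mono) auto
    finally have "\<bar>Re (g z * cnj (h z)) - Re (g z * cnj (t z))\<bar> \<le> cmod (h z - t z)"
      by (simp add: algebra_simps)
    then show ?thesis by linarith
  qed
  have ext1: "cmod (disc_ext h (of_real r * z)) \<le> 1" if "cmod z = 1" for z
    by (rule disc_ext_bound[OF h(1)]) (use h(2) r that in \<open>auto elim: eventually_mono simp: norm_mult\<close>)
  have ihd: "integrable \<mu> (\<lambda>z. cmod (h z - t z))"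
    by (intro integrable_norm ess_integrable ess_bounded_minus eh et)
  have iht: "integrable \<mu> (\<lambda>z. Re (h z * cnj (t z)))" "integrable \<mu> (\<lambda>z. Re (disc_ext h (of_real r * z) * cnj (t z)))"
    by (intro integrable_Re ess_integrable ess_bounded_intros eh et er)+
  have "1 - e / 4 \<le> (LINT z|\<mu>. 1 - cmod (h z - t z))"
    using t(2) ihd circle.prob_space by simp
  also have "\<dots> \<le> (LINT z|\<mu>. Re (h z * cnj (t z)))"
  proof (rule integral_mono_AE)
    show "AE z in \<mu>. 1 - cmod (h z - t z) \<le> Re (h z * cnj (t z))"
      using h(2)
    proof eventually_elim
      case (elim z)
      then show ?case using approx[of h z] circle_mult_cnj[OF elim] by simp
    qed
  qed (use ihd iht in auto)
  also have "\<dots> = Re L1"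
    unfolding L1_def by (intro integral_Re ess_integrable ess_bounded_intros eh et)
  finally have L1: "1 - e / 4 \<le> Re L1" .
  have "(LINT z|\<mu>. 1 - cmod (disc_ext h (of_real r * z))) \<le>
      (LINT z|\<mu>. 1 - Re (disc_ext h (of_real r * z) * cnj (t z)) + cmod (h z - t z))"
  proof (rule integral_mono_AE)
    show "AE z in \<mu>. 1 - cmod (disc_ext h (of_real r * z)) \<le>
        1 - Re (disc_ext h (of_real r * z) * cnj (t z)) + cmod (h z - t z)"
      using h(2) AE_space
    proof eventually_elim
      case (elim z)
      then have z: "cmod z = 1" by (simp add: space_circle_measure)
      have "Re (disc_ext h (of_real r * z) * cnj (h z)) \<le> cmod (disc_ext h (of_real r * z) * cnj (h z))"
        by (rule complex_Re_le_cmod)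
      also have "\<dots> = cmod (disc_ext h (of_real r * z))" using elim by (simp add: norm_mult)
      finally show ?case
        using approx[of "\<lambda>z. disc_ext h (of_real r * z)" z] ext1[OF z] by linarith
    qed
  qed (use ihd iht er in \<open>auto intro!: integrable_norm ess_integrable\<close>)
  also have "\<dots> = 1 - (LINT z|\<mu>. Re (disc_ext h (of_real r * z) * cnj (t z))) + (LINT z|\<mu>. cmod (h z - t z))"
    using ihd iht circle.prob_space by simp
  also have "(LINT z|\<mu>. Re (disc_ext h (of_real r * z) * cnj (t z))) = Re (L r)"
    unfolding L_def by (intro integral_Re ess_integrable ess_bounded_intros er et)
  also have "1 - Re (L r) + (LINT z|\<mu>. cmod (h z - t z)) < e"
  proof -
    have "\<bar>Re (L r - L1)\<bar> \<le> dist (L r) L1" unfolding dist_norm by (rule abs_Re_le_cmod)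
    then show ?thesis using L1 r(1) t(2) e by simp
  qed
  finally show thesis using that r by blast
qed

section \<open>Logarithmic means and Frostman's theorem\<close>

lemma integral_ln_norm_one_minus:
  assumes a: "cmod a < 1"
  shows "(LINT z|\<mu>. ln (cmod (1 - a * z))) = 0"
proof -
  \<comment> \<open>Lies between 1 and 1 / |a|, so 1 - a w stays in the right half-plane for |w| < R
    and its principal logarithm is holomorphic there.\<close>
  define R where "R = 2 / (1 + cmod a)"
  have R: "R > 1" "cmod a * R < 1" using a by (auto simp: R_def field_simps add_pos_nonneg)
  have pos: "0 < Re (1 - a * w)" if "cmod w < R" for w
  proof -
    have "Re (a * w) \<le> cmod a * cmod w" by (metis complex_Re_le_cmod norm_mult)
    also have "\<dots> \<le> cmod a * R" using that by (intro mult_left_mono) auto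
    finally show ?thesis using R by simp
  qed
  have "(\<lambda>w. Ln (1 - a * w)) holomorphic_on ball 0 R"
  proof (intro holomorphic_intros)
    fix w :: complex assume "w \<in> ball 0 R"
    then show "1 - a * w \<notin> \<real>\<^sub>\<le>\<^sub>0" using pos[of w] by (auto simp: complex_nonpos_Reals_iff)
  qed
  from integral_circle_holomorphic[OF this, of 1] R
  have 0: "(LINT z|\<mu>. Ln (1 - a * z)) = 0" by simp
  have "ess_bounded (\<lambda>z. Ln (1 - a * z))"
  proof (intro ess_bounded_continuous continuous_intros)
    fix z :: complex assume "z \<in> sphere 0 1"
    then show "1 - a * z \<notin> \<real>\<^sub>\<le>\<^sub>0" using pos[of z] R by (auto simp: complex_nonpos_Reals_iff)
  qed
  then have "(LINT z|\<mu>. Re (Ln (1 - a * z))) = 0"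
    using 0 by (subst integral_Re) (auto intro: ess_integrable)
  moreover have "(LINT z|\<mu>. Re (Ln (1 - a * z))) = (LINT z|\<mu>. ln (cmod (1 - a * z)))"
  proof (rule Bochner_Integration.integral_cong)
    fix z assume "z \<in> space \<mu>"
    then have "0 < Re (1 - a * z)" using pos[of z] R by (simp add: space_circle_measure)
    then have "1 - a * z \<noteq> 0" by (metis less_irrefl zero_complex.simps(1))
    then show "Re (Ln (1 - a * z)) = ln (cmod (1 - a * z))" by (rule Re_Ln)
  qed simp
  ultimately show ?thesis by simp
qed

lemma integral_ln_norm_one_minus_cnj:
  assumes "cmod a < 1"
  shows "(LINT z|\<mu>. ln (cmod (1 - a * cnj z))) = 0"
proof -
  have "cmod (1 - a * cnj z) = cmod (1 - cnj a * z)" for z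
    by (metis complex_cnj_cnj complex_cnj_diff complex_cnj_mult complex_cnj_one complex_mod_cnj)
  then show ?thesis using integral_ln_norm_one_minus[of "cnj a"] assms by simp
qed

lemma norm_one_minus_pos:
  assumes "cmod a < 1" "cmod z \<le> 1"
  shows "0 < cmod (1 - a * z)"
  using blaschke_denominator_nonzero[of "cnj a" z] assms by simp

lemma norm_blaschke_le:
  assumes a: "cmod a < 1" and w: "cmod w \<le> 1"
  shows "cmod (blaschke a w) \<le> 1"
proof -
  have "(1 - (cmod a)\<^sup>2) * (1 - (cmod w)\<^sup>2) = (cmod (1 - cnj a * w))\<^sup>2 - (cmod (w - a))\<^sup>2"
    unfolding cmod_power2 by (simp add: power2_eq_square algebra_simps)
  moreover have "0 \<le> (1 - (cmod a)\<^sup>2) * (1 - (cmod w)\<^sup>2)"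
    using power_le_one[of "cmod a" 2] power_le_one[of "cmod w" 2] a w by (intro mult_nonneg_nonneg) simp_all
  ultimately have "(cmod (w - a))\<^sup>2 \<le> (cmod (1 - cnj a * w))\<^sup>2" by simp
  then have "cmod (w - a) \<le> cmod (1 - cnj a * w)" by (rule power2_le_imp_le) simp
  then show ?thesis
    using norm_one_minus_pos[of "cnj a" w] assms by (simp add: blaschke_def norm_divide)
qed

text \<open>
  The mean of \<open>ln \<bar>c - l\<bar>\<close> over the circle \<open>\<bar>l\<bar> = s\<close> is \<open>ln (max \<bar>c\<bar> s)\<close>. This is bounded, and
  close to \<open>0\<close> when \<open>\<bar>c\<bar>\<close> is close to \<open>1\<close>.
\<close>

lemma blaschke_mean:
  assumes s: "0 < s" "s < 1" and c: "cmod c \<le> 1" "cmod c \<noteq> s"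
  shows "(\<integral>\<^sup>+l. ennreal (- ln (cmod (blaschke (of_real s * l) c))) \<partial>\<mu>) \<le> ennreal ((1 - cmod c) / s)"
proof -
  define m where "m = max (cmod c) s"
  have m: "m > 0" "m \<le> 1" "s \<le> m" "cmod c \<le> m" using s c by (auto simp: m_def)
  define F where "F l = ln (cmod (c - of_real s * l))" for l :: complex
  define G where "G l = ln (cmod (1 - (of_real s * c) * cnj l))" for l :: complex
  have sc: "cmod (of_real s * c) < 1"
  proof -
    have "cmod (of_real s * c) = s * cmod c" using s by (simp add: norm_mult)
    also have "\<dots> \<le> s * 1" using s c by (intro mult_left_mono) auto
    also have "\<dots> < 1" using s by simp
    finally show ?thesis .
  qed
  \<comment> \<open>The exclusion |c| \<noteq> s keeps the logarithm of |c - s l| continuous on the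
    circle.\<close>
  have ne: "c - of_real s * l \<noteq> 0" if "cmod l = 1" for l
    using c(2) s that by (auto simp: norm_mult)
  have ne': "1 - (of_real s * c) * cnj l \<noteq> 0" if "cmod l = 1" for l
    using cauchy_kernel_nonzero[OF sc that] .
  have "continuous_on (sphere 0 1) F" "continuous_on (sphere 0 1) G"
    unfolding F_def G_def using ne ne' by (intro continuous_intros; auto)+
  then have int: "integrable \<mu> F" "integrable \<mu> G"
    by (auto intro: integrable_circle_continuous)
  have G0: "(LINT l|\<mu>. G l) = 0"
    unfolding G_def by (rule integral_ln_norm_one_minus_cnj[OF sc])
  \<comment> \<open>The larger of \<open>c\<close> and \<open>s l\<close> is factored out; what
    remains is 1 - a l or 1 - a cnj l with |a| < 1, whose logarithmic mean is 0.\<close>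
  have F0: "(LINT l|\<mu>. F l) = ln m"
  proof (cases "cmod c > s")
    case True
    then have c0: "c \<noteq> 0" using s by auto
    define a where "a = of_real s / c"
    have a: "cmod a < 1" using True s c0 by (simp add: a_def norm_divide)
    have "F l = ln (cmod c) + ln (cmod (1 - a * l))" if "cmod l = 1" for l
    proof -
      have "c - of_real s * l = c * (1 - a * l)" using c0 by (simp add: a_def field_simps)
      then have "cmod (c - of_real s * l) = cmod c * cmod (1 - a * l)" by (simp only: norm_mult)
      then show ?thesis
        using c0 norm_one_minus_pos[OF a, of l] that by (simp add: F_def ln_mult)
    qed
    then have "(LINT l|\<mu>. F l) = (LINT l|\<mu>. ln (cmod c) + ln (cmod (1 - a * l)))"
      by (intro Bochner_Integration.integral_cong) (auto simp: space_circle_measure)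
    also have "\<dots> = ln (cmod c)"
    proof (subst Bochner_Integration.integral_add)
      show "integrable \<mu> (\<lambda>l. ln (cmod (1 - a * l)))"
        using norm_one_minus_pos[OF a]
        by (intro integrable_circle_continuous[OF _ order_refl] continuous_intros) auto
    qed (use integral_ln_norm_one_minus[OF a] circle.prob_space in auto)
    finally show ?thesis using True by (simp add: m_def)
  next
    case False
    then have cs: "cmod c < s" using c by simp
    define a where "a = c / of_real s"
    have a: "cmod a < 1" using cs s by (simp add: a_def norm_divide)
    have "F l = ln s + ln (cmod (1 - a * cnj l))" if l: "cmod l = 1" for l
    proof -
      have "c - of_real s * l = (- of_real s * l) * (1 - a * cnj l)"
      proof -
        have "(- of_real s * l) * (1 - a * cnj l) = - of_real s * l + of_real s * a * (l * cnj l)"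
          by (simp add: algebra_simps)
        also have "\<dots> = c - of_real s * l" using s by (simp add: circle_mult_cnj[OF l] a_def)
        finally show ?thesis ..
      qed
      then have "cmod (c - of_real s * l) = s * cmod (1 - a * cnj l)"
        using l s by (simp add: norm_mult)
      then show ?thesis
        using s norm_one_minus_pos[OF a, of "cnj l"] l by (simp add: F_def ln_mult)
    qed
    then have "(LINT l|\<mu>. F l) = (LINT l|\<mu>. ln s + ln (cmod (1 - a * cnj l)))"
      by (intro Bochner_Integration.integral_cong) (auto simp: space_circle_measure)
    also have "\<dots> = ln s"
    proof (subst Bochner_Integration.integral_add)
      show "integrable \<mu> (\<lambda>l. ln (cmod (1 - a * cnj l)))"
        using cauchy_kernel_nonzero[OF a]
        by (intro integrable_circle_continuous[OF _ order_refl] continuous_intros) auto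
    qed (use integral_ln_norm_one_minus_cnj[OF a] circle.prob_space in auto)
    finally show ?thesis using cs by (simp add: m_def)
  qed
  have eq: "- ln (cmod (blaschke (of_real s * l) c)) = G l - F l" if l: "cmod l = 1" for l
    using ne[OF l] ne'[OF l] by (simp add: blaschke_def norm_divide F_def G_def ln_div mult_ac)
  have "(\<integral>\<^sup>+l. ennreal (- ln (cmod (blaschke (of_real s * l) c))) \<partial>\<mu>) = (\<integral>\<^sup>+l. ennreal (G l - F l) \<partial>\<mu>)"
    by (rule nn_integral_cong) (simp add: eq space_circle_measure)
  also have "\<dots> = ennreal (LINT l|\<mu>. G l - F l)"
  proof (rule nn_integral_eq_integral)
    show "AE l in \<mu>. 0 \<le> G l - F l"
    proof (rule AE_circleI)
      fix l :: complex assume l: "cmod l = 1"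
      have "cmod (of_real s * l) < 1" using l s by (simp add: norm_mult)
      then have "cmod (blaschke (of_real s * l) c) \<le> 1" by (rule norm_blaschke_le) (rule c)
      moreover have "cmod (blaschke (of_real s * l) c) > 0"
        using ne[OF l] ne'[OF l] by (simp add: blaschke_def mult_ac)
      ultimately show "0 \<le> G l - F l" unfolding eq[OF l, symmetric] by simp
    qed
  qed (use int in auto)
  also have "(LINT l|\<mu>. G l - F l) = - ln m" using int F0 G0 by simp
  also have "- ln m \<le> (1 - cmod c) / s"
  proof -
    have "- ln m = ln (1 / m)" using m by (simp add: ln_div)
    also have "\<dots> \<le> 1 / m - 1" using m by (intro ln_le_minus_one) simp
    also have "\<dots> = (1 - m) / m" using m by (simp add: field_simps)
    also have "\<dots> \<le> (1 - cmod c) / s" using m s by (intro frac_le) auto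
    finally show ?thesis .
  qed
  finally show ?thesis by (simp add: ennreal_leI)
qed

text \<open>By Fubini and \<open>blaschke_mean\<close>, averaging the logarithmic mean over all
  \<open>l\<close> on a circle gives at most a multiple of the mean of 1 - |h(r z)|, which is small
  for \<open>r\<close> near 1. Some \<open>l\<close> is nearly as good as the average.\<close>

lemma frostman:
  assumes h: "hardy h" "unimodular h" and s: "0 < s" "s < 1" and e: "e > 0"
  obtains l r where "0 < cmod l" "cmod l < s" "0 < r" "r < 1"
    "AE z in \<mu>. disc_ext h (of_real r * z) \<noteq> l"
    "(\<integral>\<^sup>+z. ennreal (- ln (cmod (blaschke l (disc_ext h (of_real r * z))))) \<partial>\<mu>) \<le> ennreal e"
proof -
  obtain r where r: "0 < r" "r < 1" "(LINT z|\<mu>. 1 - cmod (disc_ext h (of_real r * z))) < e * s / 4"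
    using inner_radial_limit[OF h, of "e * s / 4"] e s by auto
  define H where "H z = disc_ext h (of_real r * z)" for z
  have eH: "ess_bounded H"
    unfolding H_def using r by (intro disc_ext_circle_ess_bounded hardy_ess_bounded h) auto
  have Hm [measurable]: "H \<in> borel_measurable \<mu>" using eH by (rule ess_bounded_measurable)
  have H1: "cmod (H z) \<le> 1" if "cmod z = 1" for z
    unfolding H_def
    by (rule disc_ext_bound[OF h(1)]) (use h(2) r that in \<open>auto elim: eventually_mono simp: norm_mult\<close>)
  define M where "M = distr \<mu> borel (\<lambda>z. cmod (H z))"
  interpret M: prob_space M unfolding M_def by (rule circle.prob_space_distr) measurable
  \<comment> \<open>\<open>blaschke_mean\<close> excludes |H z| = p, so \<open>p\<close> must avoid
    the countably many values that |H| takes with positive probability. The bound p > s / 2 keeps 1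
    / p under control.\<close>
  have "uncountable {s / 2<..<s}" using s by (simp add: uncountable_open_interval)
  then have "\<not> {s / 2<..<s} \<subseteq> {x. measure M {x} \<noteq> 0}"
    using M.countable_support countable_subset by blast
  then obtain p where p: "s / 2 < p" "p < s" "measure M {p} = 0" by auto
  have p01: "0 < p" "p < 1" using p s by auto
  have "measure \<mu> ((\<lambda>z. cmod (H z)) -` {p} \<inter> space \<mu>) = 0"
    using p(3) unfolding M_def by (subst (asm) measure_distr) auto
  then have "AE z in \<mu>. z \<notin> (\<lambda>z. cmod (H z)) -` {p} \<inter> space \<mu>"
    by (subst circle.prob_eq_0[symmetric]) auto
  then have Hp: "AE z in \<mu>. cmod (H z) \<noteq> p" using AE_space by eventually_elim auto
  define \<Phi> where "\<Phi> = (\<lambda>(l, z). ennreal (- ln (cmod (blaschke (of_real p * l) (H z)))))"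
  have cnj_meas: "cnj \<in> borel_measurable borel"
    by (intro borel_measurable_continuous_onI continuous_intros)
  have \<Phi>m: "\<Phi> \<in> borel_measurable (\<mu> \<Otimes>\<^sub>M \<mu>)"
  proof -
    have [measurable]: "(\<lambda>x. cnj (fst x)) \<in> borel_measurable (\<mu> \<Otimes>\<^sub>M \<mu>)"
      using measurable_compose[OF measurable_compose[OF measurable_fst measurable_circle_id] cnj_meas] .
    have [measurable]: "(\<lambda>x. fst x) \<in> borel_measurable (\<mu> \<Otimes>\<^sub>M \<mu>)"
      using measurable_compose[OF measurable_fst measurable_circle_id] .
    have "\<Phi> = (\<lambda>x. ennreal (- ln (cmod ((H (snd x) - of_real p * fst x) / (1 - of_real p * cnj (fst x) * H (snd x))))))"
      by (auto simp: \<Phi>_def blaschke_def)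
    also have "\<dots> \<in> borel_measurable (\<mu> \<Otimes>\<^sub>M \<mu>)" by measurable
    finally show ?thesis .
  qed
  interpret P: pair_sigma_finite \<mu> \<mu> ..
  have "(\<integral>\<^sup>+l. (\<integral>\<^sup>+z. \<Phi> (l, z) \<partial>\<mu>) \<partial>\<mu>) = (\<integral>\<^sup>+z. (\<integral>\<^sup>+l. \<Phi> (l, z) \<partial>\<mu>) \<partial>\<mu>)"
    using P.Fubini[OF \<Phi>m] by simp
  also have "\<dots> \<le> (\<integral>\<^sup>+z. ennreal ((1 - cmod (H z)) / p) \<partial>\<mu>)"
  proof (rule nn_integral_mono_AE)
    show "AE z in \<mu>. (\<integral>\<^sup>+l. \<Phi> (l, z) \<partial>\<mu>) \<le> ennreal ((1 - cmod (H z)) / p)"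
      using Hp AE_space
      by eventually_elim (use blaschke_mean[OF p01] H1 in \<open>simp add: \<Phi>_def space_circle_measure\<close>)
  qed
  also have "\<dots> = ennreal (LINT z|\<mu>. (1 - cmod (H z)) / p)"
  proof (rule nn_integral_eq_integral)
    have "integrable \<mu> (\<lambda>z. 1 - cmod (H z))"
      by (intro Bochner_Integration.integrable_diff integrable_norm ess_integrable eH) simp
    then show "integrable \<mu> (\<lambda>z. (1 - cmod (H z)) / p)" by (rule integrable_divide_zero)
    show "AE z in \<mu>. 0 \<le> (1 - cmod (H z)) / p"
      by (rule AE_circleI) (use H1 p01 in auto)
  qed
  also have "(LINT z|\<mu>. (1 - cmod (H z)) / p) = (LINT z|\<mu>. 1 - cmod (H z)) / p"
    by (rule integral_divide_zero)
  also have "\<dots> \<le> (e * s / 4) / (s / 2)"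
    using r(3) p s e by (intro frac_le) (auto simp: H_def)
  also have "\<dots> = e / 2" using s by simp
  finally have total: "(\<integral>\<^sup>+l. (\<integral>\<^sup>+z. \<Phi> (l, z) \<partial>\<mu>) \<partial>\<mu>) \<le> ennreal (e / 2)"
    by (simp add: ennreal_leI)
  \<comment> \<open>The average is at most e / 2; the slack provides the contradiction if all values
    exceeded \<open>e\<close>.\<close>
  have "\<exists>l\<in>space \<mu>. (\<integral>\<^sup>+z. \<Phi> (l, z) \<partial>\<mu>) \<le> ennreal e"
  proof (rule ccontr)
    assume "\<not> ?thesis"
    then have "(\<integral>\<^sup>+l. ennreal e \<partial>\<mu>) \<le> (\<integral>\<^sup>+l. (\<integral>\<^sup>+z. \<Phi> (l, z) \<partial>\<mu>) \<partial>\<mu>)"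
      by (intro nn_integral_mono) (auto simp: not_le)
    also note total
    finally have "ennreal e \<le> ennreal (e / 2)" by (simp add: circle.emeasure_space_1)
    then show False using e by (simp add: ennreal_le_iff)
  qed
  then obtain l where l: "cmod l = 1" "(\<integral>\<^sup>+z. \<Phi> (l, z) \<partial>\<mu>) \<le> ennreal e"
    by (auto simp: space_circle_measure)
  show thesis
  proof (rule that[of "of_real p * l" r])
    show "AE z in \<mu>. disc_ext h (of_real r * z) \<noteq> of_real p * l"
      using Hp by eventually_elim (use l p01 in \<open>auto simp: H_def norm_mult\<close>)
  qed (use l p p01 r in \<open>auto simp: norm_mult \<Phi>_def H_def\<close>)
qed

text \<open>Here \<open>blaschke l\<close> acts on values, as an automorphism of the disc, and not
  as a factor with a zero at \<open>l\<close>. The extension commutes with it because it commutes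
  with products, once denominators are cleared.\<close>

lemma disc_ext_blaschke_comp:
  assumes h: "hardy h" "AE z in \<mu>. cmod (h z) \<le> 1" and l: "cmod l < 1"
  shows "hardy (\<lambda>z. blaschke l (h z))"
    and "cmod w < 1 \<Longrightarrow> disc_ext (\<lambda>z. blaschke l (h z)) w = blaschke l (disc_ext h w)"
proof -
  have hl: "hardy (\<lambda>z. cnj l * h z)" by (intro hardy_cmult h)
  have bl: "AE z in \<mu>. cmod (cnj l * h z) \<le> cmod l"
    using h(2) by eventually_elim (simp add: norm_mult mult_left_le)
  have inv: "hardy (\<lambda>z. 1 / (1 - cnj l * h z))" by (rule hardy_inverse_one_minus[OF hl bl l])
  have num: "hardy (\<lambda>z. h z - l)" and den: "hardy (\<lambda>z. 1 - cnj l * h z)"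
    by (intro hardy_minus hardy_const h hl)+
  show B: "hardy (\<lambda>z. blaschke l (h z))"
    using hardy_mult[OF num inv] by (simp add: blaschke_def)
  show "disc_ext (\<lambda>z. blaschke l (h z)) w = blaschke l (disc_ext h w)" if w: "cmod w < 1"
  proof -
    have lin: "disc_ext (\<lambda>z. 1 - cnj l * h z) w = 1 - cnj l * disc_ext h w"
      using disc_ext_cmult[of "cnj l" h w]
      by (simp add: disc_ext_minus[OF ess_bounded_const hardy_ess_bounded[OF hl] w] disc_ext_const[OF w])
    have "disc_ext (\<lambda>z. blaschke l (h z)) w * (1 - cnj l * disc_ext h w)
        = disc_ext (\<lambda>z. blaschke l (h z) * (1 - cnj l * h z)) w"
      by (simp only: disc_ext_mult[OF B den w] lin)
    also have "\<dots> = disc_ext (\<lambda>z. h z - l) w"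
    proof (rule disc_ext_cong_AE[OF _ _ _ w])
      show "AE z in \<mu>. blaschke l (h z) * (1 - cnj l * h z) = h z - l"
        using h(2)
      proof eventually_elim
        case (elim z)
        then show ?case using blaschke_denominator_nonzero[OF l, of "h z"] by (simp add: blaschke_def)
      qed
    qed (intro hardy_ess_bounded hardy_mult B den num)+
    also have "\<dots> = disc_ext h w - l"
      by (simp add: disc_ext_minus[OF hardy_ess_bounded[OF h(1)] ess_bounded_const w] disc_ext_const[OF w])
    finally have "disc_ext (\<lambda>z. blaschke l (h z)) w * (1 - cnj l * disc_ext h w) = disc_ext h w - l" .
    moreover have "1 - cnj l * disc_ext h w \<noteq> 0"
      by (intro blaschke_denominator_nonzero l disc_ext_bound[OF h] w)
    ultimately show ?thesis by (simp add: blaschke_def field_simps)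
  qed
qed

text \<open>Jensen's formula in the zero-free case: ln |K| is the real part of a holomorphic
  logarithm.\<close>

lemma nonvanishing_mean_value:
  assumes K: "K holomorphic_on ball 0 R" "\<And>w. cmod w < R \<Longrightarrow> K w \<noteq> 0" and r: "0 \<le> r" "r < R"
  shows "integrable \<mu> (\<lambda>z. ln (cmod (K (of_real r * z))))"
    and "(LINT z|\<mu>. ln (cmod (K (of_real r * z)))) = ln (cmod (K 0))"
proof -
  obtain g where g: "g holomorphic_on ball 0 R" "\<And>w. w \<in> ball 0 R \<Longrightarrow> exp (g w) = K w"
    by (rule holomorphic_logarithm_exists[of "ball 0 R" K 0]) (use K r in auto)
  have Re: "Re (g w) = ln (cmod (K w))" if "cmod w < R" for w
    using g(2)[of w] that by (metis dist_0_norm ln_exp mem_ball norm_exp_eq_Re)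
  have rz: "cmod (of_real r * z) < R" if "cmod z = 1" for z using that r by (simp add: norm_mult)
  have "continuous_on ((\<lambda>z. of_real r * z) ` sphere 0 1) g"
    by (rule continuous_on_subset[OF holomorphic_on_imp_continuous_on[OF g(1)]])
       (use rz in auto)
  then have "continuous_on (sphere 0 1) (\<lambda>z. g (of_real r * z))"
    by (rule continuous_on_compose2) (auto intro!: continuous_intros)
  then have int: "integrable \<mu> (\<lambda>z. g (of_real r * z))"
    by (intro ess_integrable ess_bounded_continuous)
  have eq: "integrable \<mu> (\<lambda>z. Re (g (of_real r * z))) \<longleftrightarrow> integrable \<mu> (\<lambda>z. ln (cmod (K (of_real r * z))))"
    by (rule Bochner_Integration.integrable_cong) (auto simp: Re rz space_circle_measure)
  then show "integrable \<mu> (\<lambda>z. ln (cmod (K (of_real r * z))))"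
    using integrable_Re[OF int] by blast
  have "(LINT z|\<mu>. ln (cmod (K (of_real r * z)))) = (LINT z|\<mu>. Re (g (of_real r * z)))"
    by (rule Bochner_Integration.integral_cong) (auto simp: Re rz space_circle_measure)
  also have "\<dots> = Re (g 0)"
    unfolding integral_Re[OF int] integral_circle_holomorphic[OF g(1) r] ..
  also have "\<dots> = ln (cmod (K 0))" using r by (intro Re) auto
  finally show "(LINT z|\<mu>. ln (cmod (K (of_real r * z)))) = ln (cmod (K 0))" .
qed

text \<open>After the Frostman shift the logarithmic mean over |z| = r is at least -e. Dividing out
  the zeros in a slightly larger disc raises the modulus, hence this mean, and makes it equal to the
  logarithm of the modulus at 0. So that modulus is at least exp (-e).\<close>

lemma inner_approx_one:
  assumes D: "douglas_algebra D" and h: "hardy h" "unimodular h" "(LINT z|\<mu>. h z) = 0"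
    and s: "0 < s" "s < 1" and e: "e > 0"
  obtains l q where "cmod l < s" "q \<in> reps D" "unimodular q"
    "hardy (\<lambda>z. q z * blaschke l (h z))"
    "1 - e \<le> cmod (LINT z|\<mu>. q z * blaschke l (h z))"
proof -
  obtain l r where l: "0 < cmod l" "cmod l < s" and r: "0 < r" "r < 1"
    and ne: "AE z in \<mu>. disc_ext h (of_real r * z) \<noteq> l"
    and int: "(\<integral>\<^sup>+z. ennreal (- ln (cmod (blaschke l (disc_ext h (of_real r * z))))) \<partial>\<mu>) \<le> ennreal e"
    by (rule frostman[OF h(1,2) s e])
  have l1: "cmod l < 1" using l s by simp
  have h1: "AE z in \<mu>. cmod (h z) \<le> 1" using h(2) by (auto elim: eventually_mono)
  define B where "B z = blaschke l (h z)" for z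
  have B: "hardy B" "\<And>w. cmod w < 1 \<Longrightarrow> disc_ext B w = blaschke l (disc_ext h w)"
    using disc_ext_blaschke_comp[OF h(1) h1 l1] unfolding B_def by blast+
  have B1: "unimodular B"
    using h(2) unfolding B_def by eventually_elim (rule norm_blaschke[OF l1])
  \<comment> \<open>The zero mean of \<open>h\<close> and l \<noteq> 0 ensure that the shifted
    function does not vanish at 0, where the removed zeros are counted.\<close>
  have "disc_ext B 0 = - l" using B(2)[of 0] h(3) by (simp add: disc_ext_0 blaschke_def)
  then have B0: "disc_ext B 0 \<noteq> 0" using l by auto
  \<comment> \<open>Any radius strictly between \<open>r\<close> and 1 serves: the circle |z| = r
    has to lie inside the zero-free disc.\<close>
  define R where "R = (1 + r) / 2"
  have R: "0 < R" "R < 1" "r < R" using r by (auto simp: R_def)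
  obtain q where q: "q \<in> reps D" "unimodular q" "hardy (\<lambda>z. cnj (q z))"
    "hardy (\<lambda>z. q z * B z)" "\<forall>a. cmod a < R \<longrightarrow> disc_ext (\<lambda>z. q z * B z) a \<noteq> 0"
    by (rule remove_zeros[OF D R(1,2) B(1) B1 B0])
  define K where "K = disc_ext (\<lambda>z. q z * B z)"
  have qB1: "AE z in \<mu>. cmod (q z * B z) \<le> 1"
    using q(2) B1 by eventually_elim (simp add: norm_mult)
  \<comment> \<open>The function \<open>B\<close> is the quotient \<open>q B\<close> times
    \<open>cnj q\<close>, and \<open>cnj q\<close> has an extension bounded by 1.\<close>
  have BK: "cmod (disc_ext B w) \<le> cmod (K w)" if w: "cmod w < 1" for w
  proof -
    have "disc_ext B w = disc_ext (\<lambda>z. cnj (q z) * (q z * B z)) w"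
    proof (rule disc_ext_cong_AE[OF _ _ _ w])
      show "AE z in \<mu>. B z = cnj (q z) * (q z * B z)"
        using q(2)
      proof eventually_elim
        case (elim z)
        then show ?case
          using circle_mult_cnj[of "q z"] by (simp add: mult.assoc[symmetric] mult.commute[of "cnj _"])
      qed
    qed (intro hardy_ess_bounded hardy_mult B q)+
    also have "\<dots> = disc_ext (\<lambda>z. cnj (q z)) w * K w"
      unfolding K_def by (rule disc_ext_mult[OF q(3,4) w])
    finally have "cmod (disc_ext B w) = cmod (disc_ext (\<lambda>z. cnj (q z)) w) * cmod (K w)"
      by (simp add: norm_mult)
    also have "\<dots> \<le> 1 * cmod (K w)"
    proof (rule mult_right_mono)
      show "cmod (disc_ext (\<lambda>z. cnj (q z)) w) \<le> 1"
        by (rule disc_ext_bound[OF q(3) _ w]) (use q(2) in \<open>auto elim: eventually_mono\<close>)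
    qed simp
    finally show ?thesis by simp
  qed
  have Khol: "K holomorphic_on ball 0 R"
    unfolding K_def
    by (rule holomorphic_on_subset[OF disc_ext_holomorphic[OF hardy_ess_bounded[OF q(4)]]]) (use R in auto)
  have Kne: "K w \<noteq> 0" if "cmod w < R" for w using q(5) that by (simp add: K_def)
  note mv = nonvanishing_mean_value[OF Khol Kne less_imp_le[OF r(1)] R(3)]
  have K1: "cmod (K w) \<le> 1" if "cmod w < 1" for w
    unfolding K_def by (rule disc_ext_bound[OF q(4) qB1 that])
  have rz: "cmod (of_real r * z) < R" "cmod (of_real r * z) < 1" if "cmod z = 1" for z
    using that r R by (simp_all add: norm_mult)
  have "ennreal (- ln (cmod (K 0))) = ennreal (LINT z|\<mu>. - ln (cmod (K (of_real r * z))))"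
    using mv by simp
  also have "\<dots> = (\<integral>\<^sup>+z. ennreal (- ln (cmod (K (of_real r * z)))) \<partial>\<mu>)"
    by (rule nn_integral_eq_integral[symmetric])
       (use mv(1) K1 Kne rz in \<open>auto intro!: AE_circleI\<close>)
  also have "\<dots> \<le> (\<integral>\<^sup>+z. ennreal (- ln (cmod (blaschke l (disc_ext h (of_real r * z))))) \<partial>\<mu>)"
  proof (rule nn_integral_mono_AE)
    show "AE z in \<mu>. ennreal (- ln (cmod (K (of_real r * z)))) \<le>
        ennreal (- ln (cmod (blaschke l (disc_ext h (of_real r * z)))))"
      using ne AE_space
    proof eventually_elim
      case (elim z)
      then have z: "cmod z = 1" by (simp add: space_circle_measure)
      have "cmod (disc_ext h (of_real r * z)) \<le> 1" by (rule disc_ext_bound[OF h(1) h1 rz(2)[OF z]])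
      then have "blaschke l (disc_ext h (of_real r * z)) \<noteq> 0"
        using blaschke_denominator_nonzero[OF l1] elim by (simp add: blaschke_def)
      moreover have "cmod (blaschke l (disc_ext h (of_real r * z))) \<le> cmod (K (of_real r * z))"
        using BK[OF rz(2)[OF z]] B(2)[OF rz(2)[OF z]] by simp
      ultimately show ?case by (intro ennreal_leI) (simp add: ln_mono)
    qed
  qed
  also note int
  finally have "- ln (cmod (K 0)) \<le> e" using e by (simp add: ennreal_le_iff)
  then have "- e \<le> ln (cmod (K 0))" by simp
  then have "exp (- e) \<le> cmod (K 0)" using Kne[of 0] R by (simp add: ln_ge_iff)
  moreover have "1 - e \<le> exp (- e)" using exp_ge_add_one_self[of "- e"] by simp
  ultimately have "1 - e \<le> cmod (K 0)" by simp
  then have fin: "1 - e \<le> cmod (LINT z|\<mu>. q z * B z)" by (simp add: K_def disc_ext_0)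
  show thesis
    by (rule that[of l q]) (use l q fin in \<open>simp_all add: B_def\<close>)
qed

section \<open>Indicators in Douglas algebras\<close>

lemma indicator_almost_quotient:
  assumes E: "E \<in> sets \<mu>" and e: "e > 0"
  obtains h w where "hardy h" "unimodular h" "(LINT z|\<mu>. h z) = 0" "hardy w"
    "AE z in \<mu>. cmod (w z - h z * indicator E z) \<le> e"
proof -
  \<comment> \<open>With exp L - 1 = 1 / e both errors equal \<open>e\<close>: off \<open>E\<close>,
    |1 / (1 + G)| <= 1 / (exp L - 1); on \<open>E\<close>, |G / (1 + G)| <= exp (-L) / (1 - exp
    (-L)), which is the same number.\<close>
  define L where "L = ln (1 + 1 / e)"
  have L: "exp L = 1 + 1 / e" "L > 0" using e by (auto simp: L_def ln_gt_zero add_pos_pos)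
  have Em: "(indicator E :: complex \<Rightarrow> real) \<in> borel_measurable \<mu>" using E by (rule borel_measurable_indicator)
  define u where "u z = L - 2 * L * indicator E z" for z
  have um: "u \<in> borel_measurable \<mu>" unfolding u_def using Em by measurable
  have ub: "AE z in \<mu>. \<bar>u z\<bar> \<le> L" using L by (auto simp: u_def indicator_def)
  obtain G where G: "hardy G" "AE z in \<mu>. cmod (G z) = exp (u z)"
    by (rule hardy_exp[OF um ub])
  define c where "c = 1 - exp (- L)"
  have c: "0 < c" "c \<le> exp L - 1"
  proof -
    show "0 < c" using L by (simp add: c_def)
    have "2 \<le> exp L + exp (- L)"
    proof -
      have "0 \<le> (exp (L / 2) - exp (- L / 2))\<^sup>2" by simp
      also have "\<dots> = exp L + exp (- L) - 2"
        by (simp add: power2_eq_square algebra_simps flip: exp_add)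
      finally show ?thesis by simp
    qed
    then show "c \<le> exp L - 1" by (simp add: c_def)
  qed
  have lower: "AE z in \<mu>. (z \<in> E \<longrightarrow> c \<le> cmod (1 + G z)) \<and> (z \<notin> E \<longrightarrow> exp L - 1 \<le> cmod (1 + G z))"
    using G(2)
  proof eventually_elim
    case (elim z)
    have "cmod 1 - cmod (G z) \<le> cmod (1 + G z)" "cmod (G z) - cmod 1 \<le> cmod (1 + G z)"
      using norm_diff_ineq[of 1 "G z"] norm_diff_ineq[of "G z" 1] by (simp_all add: add.commute)
    then show ?case using elim by (auto simp: c_def u_def)
  qed
  then have lower': "AE z in \<mu>. c \<le> cmod (1 + G z)"
    by eventually_elim (use c in auto)
  have upper: "AE z in \<mu>. cmod (1 + G z) \<le> 1 + exp L"
    using G(2) ub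
  proof eventually_elim
    case (elim z)
    then have "exp (u z) \<le> exp L" by simp
    moreover have "cmod (1 + G z) \<le> 1 + exp (u z)"
      using norm_triangle_ineq[of 1 "G z"] elim by simp
    ultimately show ?case by linarith
  qed
  define v where "v z = - ln (cmod (1 + G z))" for z
  have [measurable]: "G \<in> borel_measurable \<mu>" using G(1) hardy_ess_bounded ess_bounded_measurable by blast
  have vm: "v \<in> borel_measurable \<mu>" unfolding v_def by measurable
  have "AE z in \<mu>. \<bar>v z\<bar> \<le> max (- ln c) (ln (1 + exp L))"
    using lower' upper
  proof eventually_elim
    case (elim z)
    then have "ln c \<le> ln (cmod (1 + G z))" "ln (cmod (1 + G z)) \<le> ln (1 + exp L)"
      using c by (auto intro!: ln_mono)
    then show ?case by (auto simp: v_def)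
  qed
  then obtain W where W: "hardy W" "AE z in \<mu>. cmod (W z) = exp (v z)"
    using hardy_exp[OF vm] by metis
  have Wn: "AE z in \<mu>. cmod (W z) = 1 / cmod (1 + G z)"
    using W(2) lower'
  proof eventually_elim
    case (elim z)
    then have "cmod (1 + G z) > 0" using c by linarith
    then show ?case using elim by (simp add: v_def exp_minus inverse_eq_divide)
  qed
  have GW: "hardy (\<lambda>z. (1 + G z) * W z)" by (intro hardy_mult hardy_add hardy_const G W)
  show thesis
  proof (rule that)
    \<comment> \<open>As |W| = 1 / |1 + G|, the numerator and denominator of 1 / (1 + G) = W / ((1 +
      G) W) both lie in H^infinity with an inner denominator. The extra factor \<open>z\<close>
      makes its mean 0, as \<open>inner_approx_one\<close> requires.\<close>
    show "hardy (\<lambda>z. z * ((1 + G z) * W z))" "hardy (\<lambda>z. z * W z)"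
      by (intro hardy_mult hardy_id GW W)+
    show "AE z in \<mu>. cmod (z * ((1 + G z) * W z)) = 1"
      using Wn lower' AE_space
    proof eventually_elim
      case (elim z)
      then have "cmod (1 + G z) > 0" using c by linarith
      then show ?case using elim by (simp add: norm_mult space_circle_measure)
    qed
    show "(LINT z|\<mu>. z * ((1 + G z) * W z)) = 0"
      using hardy_integral_power[OF GW, of 1] by (simp add: mult.commute)
    show "AE z in \<mu>. cmod (z * W z - z * ((1 + G z) * W z) * indicator E z) \<le> e"
      using Wn lower G(2) AE_space
    proof eventually_elim
      case (elim z)
      then have z: "cmod z = 1" by (simp add: space_circle_measure)
      show ?case
      proof (cases "z \<in> E")
        case True
        then have "z * W z - z * ((1 + G z) * W z) * indicator E z = - (z * G z * W z)"
          by (simp add: algebra_simps)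
        then have "cmod (z * W z - z * ((1 + G z) * W z) * indicator E z) = exp (- L) / cmod (1 + G z)"
          using True elim z by (simp add: norm_mult u_def)
        also have "\<dots> \<le> exp (- L) / c" using elim True c by (intro divide_left_mono mult_pos_pos) auto
        also have "\<dots> = e"
          using e by (simp add: c_def exp_minus L(1) field_simps)
        finally show ?thesis .
      next
        case False
        then have "cmod (z * W z - z * ((1 + G z) * W z) * indicator E z) = 1 / cmod (1 + G z)"
          using elim z by (simp add: norm_mult)
        also have "\<dots> \<le> 1 / (exp L - 1)"
          using elim False e by (intro divide_left_mono mult_pos_pos) (auto simp: L(1) intro: less_le_trans)
        also have "\<dots> = e" using e by (simp add: L(1))
        finally show ?thesis .
      qed
    qed
  qed
qed

text \<open>The approximant is q w up to rotation: \<open>w\<close> is near h 1_E, and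
  \<open>h\<close> differs from its Frostman shift by at most 2 |l| / (1 - |l|).\<close>

lemma indicator_almost_in_douglas:
  assumes D: "douglas_algebra D" and E: "E \<in> sets \<mu>" and e: "0 < e" "e < 1"
  obtains b g \<beta> where "hardy b" "unimodular b" "(LINT z|\<mu>. b z) = of_real \<beta>" "1 - e \<le> \<beta>"
    "g \<in> reps D" "AE z in \<mu>. cmod (g z - b z * indicator E z) \<le> e"
proof -
  note cu = closed_unital_douglas[OF D]
  obtain h w where h: "hardy h" "unimodular h" "(LINT z|\<mu>. h z) = 0" and w: "hardy w"
    "AE z in \<mu>. cmod (w z - h z * indicator E z) \<le> e / 2"
    using indicator_almost_quotient[OF E, of "e / 2"] e by auto
  \<comment> \<open>For |l| < s the quantity 2 |l| / (1 - |l|) is at most e / 2, the half of the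
    error left by \<open>w\<close>.\<close>
  define s where "s = e / (4 + e)"
  have s: "0 < s" "s < 1" using e by (auto simp: s_def)
  obtain l q where l: "cmod l < s" and q: "q \<in> reps D" "unimodular q"
    "hardy (\<lambda>z. q z * blaschke l (h z))"
    "1 - e \<le> cmod (LINT z|\<mu>. q z * blaschke l (h z))"
    by (rule inner_approx_one[OF D h s e(1)])
  have l1: "cmod l < 1" using l s by simp
  define I where "I = (LINT z|\<mu>. q z * blaschke l (h z))"
  have I0: "I \<noteq> 0" using q(4) e by (auto simp: I_def)
  \<comment> \<open>A rotation making the mean real and positive, so that a mean close to 1 forces
    closeness to the constant 1.\<close>
  define k where "k = cnj I / of_real (cmod I)"
  have k1: "cmod k = 1" using I0 by (simp add: k_def norm_divide)
  have kI: "k * I = of_real (cmod I)"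
  proof -
    have "k * I = (I * cnj I) / of_real (cmod I)" by (simp add: k_def)
    also have "I * cnj I = of_real (cmod I) * of_real (cmod I)"
      by (simp add: complex_norm_square[symmetric] power2_eq_square)
    finally show ?thesis using I0 by simp
  qed
  define b where "b z = k * (q z * blaschke l (h z))" for z
  show thesis
  proof (rule that)
    show "hardy b" unfolding b_def by (intro hardy_cmult q)
    show "unimodular b"
      using q(2) h(2) by eventually_elim (simp add: b_def norm_mult k1 norm_blaschke[OF l1])
    show "(LINT z|\<mu>. b z) = of_real (cmod I)"
      unfolding b_def integral_mult_right_zero I_def[symmetric] by (rule kI)
    show "1 - e \<le> cmod I" using q(4) by (simp add: I_def)
    show "(\<lambda>z. k * (q z * w z)) \<in> reps D"
      by (intro reps_mult reps_const cu q hardy_in_douglas[OF D] w)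
    show "AE z in \<mu>. cmod (k * (q z * w z) - b z * indicator E z) \<le> e"
      using q(2) h(2) w(2)
    proof eventually_elim
      case (elim z)
      define B where "B = blaschke l (h z)"
      have den: "1 - cmod l \<le> cmod (1 - cnj l * h z)"
        using norm_triangle_ineq2[of 1 "cnj l * h z"] elim by (simp add: norm_mult)
      have ne: "1 - cnj l * h z \<noteq> 0" using blaschke_denominator_nonzero[OF l1, of "h z"] elim by simp
      have "h z - B = (l - cnj l * (h z)\<^sup>2) / (1 - cnj l * h z)"
        using ne by (simp add: B_def blaschke_def field_simps power2_eq_square)
      then have "cmod (h z - B) = cmod (l - cnj l * (h z)\<^sup>2) / cmod (1 - cnj l * h z)"
        by (simp add: norm_divide)
      also have "\<dots> \<le> (2 * cmod l) / (1 - cmod l)"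
      proof (rule frac_le)
        show "cmod (l - cnj l * (h z)\<^sup>2) \<le> 2 * cmod l"
          using norm_triangle_ineq4[of l "cnj l * (h z)\<^sup>2"] elim by (simp add: norm_mult norm_power)
      qed (use l1 den in auto)
      also have "\<dots> \<le> e / 2"
      proof -
        have "cmod l * (4 + e) \<le> e" using l e by (simp add: s_def pos_less_divide_eq less_imp_le)
        then have "2 * cmod l \<le> e / 2 * (1 - cmod l)" by (simp add: algebra_simps)
        then show ?thesis using l1 by (simp add: pos_divide_le_eq)
      qed
      finally have hB: "cmod (h z - B) \<le> e / 2" .
      have "k * (q z * w z) - b z * indicator E z = k * q z * ((w z - h z * indicator E z) + (h z - B) * indicator E z)"
        by (simp add: b_def B_def algebra_simps)
      then have "cmod (k * (q z * w z) - b z * indicator E z) =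
          cmod ((w z - h z * indicator E z) + (h z - B) * indicator E z)"
        using elim by (simp add: norm_mult k1)
      also have "\<dots> \<le> cmod (w z - h z * indicator E z) + cmod ((h z - B) * indicator E z)"
        by (rule norm_triangle_ineq)
      also have "cmod ((h z - B) * indicator E z) \<le> e / 2"
        using hB e by (simp add: indicator_def)
      finally show ?case using elim by simp
    qed
  qed
qed

text \<open>For |b| = 1 one has |b - 1|^2 = 2 - 2 Re b, so the mean controls the L^2 distance to 1.
  Partial products have modulus 1, hence consecutive ones differ in L^1 by at most 2^-N.\<close>

lemma inner_product_converges:
  fixes b :: "nat \<Rightarrow> complex \<Rightarrow> complex"
  assumes b: "\<And>k. hardy (b k)" "\<And>k. AE z in \<mu>. cmod (b k z) = 1"
    and \<beta>: "\<And>k. (LINT z|\<mu>. b k z) = of_real (\<beta> k)" "\<And>k. 1 - \<beta> k \<le> (1 / 4) ^ k / 2"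
  obtains R where "hardy R" "unimodular R" "AE z in \<mu>. (\<lambda>N. \<Prod>k<N. b k z) \<longlonglongrightarrow> R z"
proof -
  define P where "P N z = (\<Prod>k<N. b k z)" for N z
  have P: "hardy (P N)" for N
    using reps_prod[OF closed_subalgebra_Hinf, of "{..<N}" b] b(1) by (simp add: reps_Hinf P_def[abs_def])
  have b1: "AE z in \<mu>. \<forall>k. cmod (b k z) = 1" using b(2) by (simp add: AE_all_countable)
  then have P1: "AE z in \<mu>. \<forall>N. cmod (P N z) = 1"
    by eventually_elim (simp add: P_def prod_norm[symmetric])
  have eb: "ess_bounded (b k)" "ess_bounded (P k)" for k using b(1) P by (simp_all add: hardy_ess_bounded)
  have [measurable]: "b k \<in> borel_measurable \<mu>" "P k \<in> borel_measurable \<mu>" for k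
    using eb ess_bounded_measurable by blast+
  have dist: "(LINT z|\<mu>. cmod (P (Suc N) z - P N z)) \<le> (1 / 2) ^ N" for N
  proof -
    have sq: "AE z in \<mu>. (cmod (b N z - 1))\<^sup>2 = 2 - 2 * Re (b N z)"
      using b(2)[of N]
    proof eventually_elim
      case (elim z)
      have "(cmod (b N z - 1))\<^sup>2 = (cmod (b N z))\<^sup>2 + 1 - 2 * Re (b N z)"
        unfolding cmod_power2 by (simp add: power2_eq_square algebra_simps)
      then show ?case using elim by simp
    qed
    have iRe: "integrable \<mu> (\<lambda>z. 2 - 2 * Re (b N z))"
      using integrable_Re[OF ess_integrable[OF eb(1)[of N]]] by simp
    have i2: "integrable \<mu> (\<lambda>z. (cmod (b N z - 1))\<^sup>2)"
      by (rule Bochner_Integration.integrable_cong_AE[THEN iffD2, OF _ _ sq iRe]) measurable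
    have "(LINT z|\<mu>. (cmod (b N z - 1))\<^sup>2) = (LINT z|\<mu>. 2 - 2 * Re (b N z))"
      by (rule integral_cong_AE[OF _ _ sq]) measurable
    also have "\<dots> = 2 - 2 * \<beta> N"
    proof -
      have "(LINT z|\<mu>. Re (b N z)) = \<beta> N"
        using integral_Re[OF ess_integrable[OF eb(1)[of N]]] \<beta>(1)[of N] by simp
      then show ?thesis
        using integrable_Re[OF ess_integrable[OF eb(1)[of N]]] circle.prob_space by simp
    qed
    also have "\<dots> \<le> (1 / 4) ^ N" using \<beta>(2)[of N] by simp
    also have "\<dots> = ((1 / 2) ^ N)\<^sup>2" by (simp add: power2_eq_square power_mult_distrib[symmetric])
    finally have L2: "(LINT z|\<mu>. (cmod (b N z - 1))\<^sup>2) \<le> ((1 / 2) ^ N)\<^sup>2" .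
    have "(LINT z|\<mu>. cmod (P (Suc N) z - P N z)) = (LINT z|\<mu>. \<bar>cmod (b N z - 1)\<bar>)"
    proof (rule integral_cong_AE)
      show "AE z in \<mu>. cmod (P (Suc N) z - P N z) = \<bar>cmod (b N z - 1)\<bar>"
        using P1
      proof eventually_elim
        case (elim z)
        have "P (Suc N) z - P N z = P N z * (b N z - 1)" by (simp add: P_def algebra_simps)
        then show ?case using elim by (simp add: norm_mult)
      qed
    qed measurable
    also have "\<dots> \<le> sqrt (LINT z|\<mu>. (cmod (b N z - 1))\<^sup>2)"
      by (rule L1_le_sqrt_L2(2)[OF _ i2]) measurable
    also have "\<dots> \<le> (1 / 2) ^ N" using L2 by (intro real_le_lsqrt) auto
    finally show ?thesis .
  qed
  obtain R where R: "R \<in> borel_measurable \<mu>" "AE z in \<mu>. (\<lambda>N. P N z) \<longlonglongrightarrow> R z"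
    by (rule AE_convergent_of_L1[OF ess_integrable[OF eb(2)] dist])
  show thesis
  proof (rule that[of R])
    show "hardy R"
    proof (rule hardy_limit(1)[OF P _ R])
      show "AE z in \<mu>. cmod (P n z) \<le> 1" for n using P1 by eventually_elim simp
    qed
    show "unimodular R"
      using R(2) P1
    proof eventually_elim
      case (elim z)
      have "(\<lambda>N. cmod (P N z)) \<longlonglongrightarrow> cmod (R z)" using elim(1) by (rule tendsto_norm)
      then show ?case using elim(2) LIMSEQ_unique[OF _ tendsto_const] by simp
    qed
    show "AE z in \<mu>. (\<lambda>N. \<Prod>k<N. b k z) \<longlonglongrightarrow> R z" using R(2) by (simp add: P_def)
  qed
qed

text \<open>
  A special case of Axler's theorem that every \<open>f\<close> in \<open>L\<^sup>\<infinity>\<close> has the form \<open>g / b\<close> with \<open>b\<close> a Blaschke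
  product and \<open>g\<close> in \<open>H\<^sup>\<infinity> + C\<close>.
\<close>

theorem inner_times_indicator_in_douglas:
  assumes D: "douglas_algebra D" and E: "E \<in> sets \<mu>"
  obtains R where "unimodular R" "(\<lambda>z. R z * indicator E z) \<in> reps D"
proof -
  note cu = closed_unital_douglas[OF D]
  \<comment> \<open>The decay demanded by \<open>inner_product_converges\<close>; the same sequence
    bounds the distance to \<open>D\<close>.\<close>
  define e where "e k = (1 / 4 :: real) ^ k / 2" for k :: nat
  have e: "0 < e k" "e k < 1" for k
  proof -
    have "(1 / 4 :: real) ^ k \<le> 1" by (rule power_le_one) auto
    then show "0 < e k" "e k < 1" by (auto simp: e_def)
  qed
  define Q where "Q k b g \<beta> \<longleftrightarrow> hardy b \<and> unimodular b \<and> (LINT z|\<mu>. b z) = of_real \<beta> \<and>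
    1 - e k \<le> \<beta> \<and> g \<in> reps D \<and> (AE z in \<mu>. cmod (g z - b z * indicator E z) \<le> e k)" for k b g \<beta>
  have "\<exists>b g \<beta>. Q k b g \<beta>" for k
    unfolding Q_def by (rule indicator_almost_in_douglas[OF D E e[of k]]) blast
  then have "\<forall>k. \<exists>b g \<beta>. Q k b g \<beta>" ..
  then obtain b where "\<forall>k. \<exists>g \<beta>. Q k (b k) g \<beta>" by (rule choice[THEN exE])
  then obtain g where "\<forall>k. \<exists>\<beta>. Q k (b k) (g k) \<beta>" by (rule choice[THEN exE])
  then obtain \<beta> where Q: "\<forall>k. Q k (b k) (g k) (\<beta> k)" by (rule choice[THEN exE])
  have b: "\<And>k. hardy (b k)" "\<And>k. AE z in \<mu>. cmod (b k z) = 1"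
    and \<beta>: "\<And>k. (LINT z|\<mu>. b k z) = of_real (\<beta> k)" "\<And>k. 1 - e k \<le> \<beta> k"
    and g: "\<And>k. g k \<in> reps D" "\<And>k. AE z in \<mu>. cmod (g k z - b k z * indicator E z) \<le> e k"
    using Q unfolding Q_def by blast+
  have \<beta>': "1 - \<beta> k \<le> (1 / 4) ^ k / 2" for k using \<beta>(2)[of k] by (simp add: e_def)
  obtain R where R: "hardy R" "unimodular R" "AE z in \<mu>. (\<lambda>N. \<Prod>k<N. b k z) \<longlonglongrightarrow> R z"
    by (rule inner_product_converges[OF b \<beta>(1) \<beta>'])
  have Em: "(\<lambda>z. indicator E z :: complex) \<in> borel_measurable \<mu>" using E by (rule borel_measurable_indicator)
  have [measurable]: "R \<in> borel_measurable \<mu>" using R(1) hardy_ess_bounded ess_bounded_measurable by blast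
  have "(\<lambda>z. R z * indicator E z) \<in> reps D"
  proof (rule reps_closed[OF cu])
    show "ess_bounded (\<lambda>z. R z * indicator E z)"
    proof (rule ess_bounded_mult)
      show "ess_bounded (\<lambda>z. indicator E z)"
        by (rule ess_boundedI[OF Em, of 1]) (auto simp: indicator_def)
    qed (rule hardy_ess_bounded[OF R(1)])
    fix d :: real assume d: "d > 0"
    obtain n where n: "e n \<le> d"
    proof -
      obtain n where "(1 / 4 :: real) ^ n < d" using real_arch_pow_inv[OF d, of "1 / 4"] by auto
      moreover have "e n \<le> (1 / 4) ^ n" by (simp add: e_def)
      ultimately show thesis using that[of n] by simp
    qed
    \<comment> \<open>With the n-th factor replaced by 1 the product represents R / b n and
      converges for the same reason, so this quotient belongs to H^infinity.\<close>
    define c where "c k = (if k = n then (\<lambda>_. 1) else b k)" for k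
    obtain T where T: "hardy T" "unimodular T" "AE z in \<mu>. (\<lambda>N. \<Prod>k<N. c k z) \<longlonglongrightarrow> T z"
    proof (rule inner_product_converges[of c "\<lambda>k. if k = n then 1 else \<beta> k"])
      show "hardy (c k)" "unimodular (c k)"
        "(LINT z|\<mu>. c k z) = of_real (if k = n then 1 else \<beta> k)"
        "1 - (if k = n then 1 else \<beta> k) \<le> (1 / 4) ^ k / 2" for k
        using b \<beta>(1) \<beta>' by (auto simp: c_def hardy_const circle.prob_space)
    qed
    have RT: "AE z in \<mu>. R z = b n z * T z"
      using R(3) T(3)
    proof eventually_elim
      case (elim z)
      have step: "(\<Prod>k<N. b k z) = b n z * (\<Prod>k<N. c k z)" if "n < N" for N
      proof -
        have "(\<Prod>k<N. b k z) = b n z * (\<Prod>k\<in>{..<N} - {n}. b k z)"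
          using that by (subst prod.remove[of _ n]) auto
        also have "(\<Prod>k\<in>{..<N} - {n}. b k z) = (\<Prod>k\<in>{..<N} - {n}. c k z)"
          by (rule prod.cong) (auto simp: c_def)
        also have "\<dots> = (\<Prod>k<N. c k z)"
          using that by (subst (2) prod.remove[of _ n]) (auto simp: c_def)
        finally show ?thesis .
      qed
      have "\<forall>\<^sub>F N in sequentially. b n z * (\<Prod>k<N. c k z) = (\<Prod>k<N. b k z)"
        by (rule eventually_mono[OF eventually_gt_at_top[of n]]) (rule step[symmetric])
      moreover have "(\<lambda>N. b n z * (\<Prod>k<N. c k z)) \<longlonglongrightarrow> b n z * T z"
        by (intro tendsto_intros elim)
      ultimately have "(\<lambda>N. \<Prod>k<N. b k z) \<longlonglongrightarrow> b n z * T z"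
        by (rule Lim_transform_eventually[rotated])
      then show ?case using elim(1) by (rule LIMSEQ_unique[rotated])
    qed
    show "\<exists>f\<in>reps D. AE z in \<mu>. cmod (R z * indicator E z - f z) \<le> d"
    proof (intro bexI)
      show "(\<lambda>z. T z * g n z) \<in> reps D" by (intro reps_mult cu g hardy_in_douglas[OF D] T)
      show "AE z in \<mu>. cmod (R z * indicator E z - T z * g n z) \<le> d"
        using RT T(2) g(2)[of n]
      proof eventually_elim
        case (elim z)
        have "R z * indicator E z - T z * g n z = - (T z * (g n z - b n z * indicator E z))"
          by (simp add: elim(1) algebra_simps)
        then show ?case using elim n by (simp add: norm_mult)
      qed
    qed
  qed
  then show thesis using that R(2) by blast
qed

section \<open>Characters and the Shilov boundary\<close>

lemma ultrafilter_exists: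
  assumes "F0 \<noteq> (bot :: 'a filter)"
  obtains F where "F \<noteq> bot" "F \<le> F0" "\<forall>P. eventually P F \<or> eventually (\<lambda>x. \<not> P x) F"
proof -
  define A where "A = {F. F \<noteq> bot \<and> F \<le> F0}"
  have "\<exists>M\<in>A. \<forall>G\<in>A. G \<le> M \<longrightarrow> G = M"
  proof (rule predicate_Zorn)
    show "partial_order_on A (relation_of (\<lambda>F G. G \<le> F) A)"
      by (rule partial_order_on_relation_ofI) auto
    fix C assume "C \<in> Chains (relation_of (\<lambda>F G. G \<le> F) A)"
    then have C: "C \<subseteq> A" "\<forall>F\<in>C. \<forall>G\<in>C. G \<le> F \<or> F \<le> G"
      by (auto simp: Chains_def relation_of_def)
    show "\<exists>U\<in>A. \<forall>F\<in>C. U \<le> F"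
    proof (cases "C = {}")
      case True
      then show ?thesis using assms by (auto simp: A_def)
    next
      case False
      \<comment> \<open>A chain is directed, so what holds eventually for its infimum already holds
        for a member; thus the infimum stays proper.\<close>
      have "eventually P (Inf C) \<longleftrightarrow> (\<exists>F\<in>C. eventually P F)" for P
      proof (rule eventually_Inf_base[OF False])
        fix F G assume "F \<in> C" "G \<in> C"
        then show "\<exists>H\<in>C. H \<le> inf F G" using C(2) by (metis inf.absorb1 inf.absorb2 order_refl)
      qed
      then have "Inf C \<noteq> bot"
        using C(1) by (auto simp: A_def trivial_limit_def)
      moreover obtain F where "F \<in> C" "F \<le> F0" using False C(1) by (auto simp: A_def)
      then have "Inf C \<le> F0" by (rule Inf_lower2)
      ultimately show ?thesis by (auto simp: A_def intro: Inf_lower)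
    qed
  qed
  then obtain F where F: "F \<noteq> bot" "F \<le> F0" and min: "\<forall>G\<in>A. G \<le> F \<longrightarrow> G = F"
    by (auto simp: A_def)
  show thesis
  proof (rule that[OF F], intro allI)
    fix P
    show "eventually P F \<or> eventually (\<lambda>x. \<not> P x) F"
      unfolding disj_imp
    proof (rule impI)
      assume nP: "\<not> eventually P F"
      \<comment> \<open>If \<open>P\<close> does not hold eventually, restricting to its complement
        gives a proper filter below the minimal one, hence the same filter.\<close>
      define G where "G = inf F (principal {x. \<not> P x})"
      have evG: "eventually Q G \<longleftrightarrow> eventually (\<lambda>x. \<not> P x \<longrightarrow> Q x) F" for Q
        by (simp add: G_def eventually_inf_principal)
      have "G \<noteq> bot" using nP evG[of "\<lambda>_. False"] by (simp add: trivial_limit_def)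
      moreover have "G \<le> F" by (simp add: G_def)
      ultimately have "G = F" using min F(2) by (auto simp: A_def)
      then show "eventually (\<lambda>x. \<not> P x) F" using evG[of "\<lambda>x. \<not> P x"] by simp
    qed
  qed
qed

text \<open>Compactness of a closed disc yields a cluster point, and an ultrafilter converges to
  each of its cluster points.\<close>

lemma ultrafilter_convergent:
  fixes g :: "'a \<Rightarrow> complex"
  assumes F: "F \<noteq> bot" "\<forall>P. eventually P F \<or> eventually (\<lambda>x. \<not> P x) F"
    and g: "eventually (\<lambda>x. cmod (g x) \<le> M) F"
  shows "\<exists>l. (g \<longlongrightarrow> l) F"
proof -
  have "filtermap g F \<noteq> bot" using F(1) by (simp add: filtermap_bot_iff)
  moreover have "eventually (\<lambda>w. w \<in> cball 0 M) (filtermap g F)" using g by (simp add: eventually_filtermap)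
  ultimately obtain l where l: "inf (nhds l) (filtermap g F) \<noteq> bot"
    using compact_cball[of 0 M] unfolding compact_filter by blast
  have "(g \<longlongrightarrow> l) F"
    unfolding tendsto_def
  proof (intro allI impI)
    fix S assume S: "open S" "l \<in> S"
    show "eventually (\<lambda>x. g x \<in> S) F"
    proof (rule ccontr)
      assume "\<not> ?thesis"
      then have "eventually (\<lambda>w. w \<notin> S) (filtermap g F)"
        using F(2)[rule_format, of "\<lambda>x. g x \<in> S"] by (simp add: eventually_filtermap)
      moreover have "eventually (\<lambda>w. w \<in> S) (nhds l)" using S by (rule eventually_nhds_in_open)
      ultimately have "eventually (\<lambda>_. False) (inf (nhds l) (filtermap g F))"
        unfolding eventually_inf by blast
      then show False using l by (simp add: eventually_False)
    qed
  qed
  then show ?thesis ..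
qed

section \<open>Characters on representatives and the Gelfand topology\<close>

context
  fixes A :: "linf set"
  assumes A: "closed_subalgebra A"
begin

lemma character_add:
  "x \<in> characters A \<Longrightarrow> f \<in> reps A \<Longrightarrow> g \<in> reps A \<Longrightarrow>
    x (abs_linf (\<lambda>z. f z + g z)) = x (abs_linf f) + x (abs_linf g)"
  by (auto simp: characters_def reps_def simp flip: abs_linf_add)

lemma character_mult:
  "x \<in> characters A \<Longrightarrow> f \<in> reps A \<Longrightarrow> g \<in> reps A \<Longrightarrow>
    x (abs_linf (\<lambda>z. f z * g z)) = x (abs_linf f) * x (abs_linf g)"
  by (auto simp: characters_def reps_def simp flip: abs_linf_mult)

lemma character_cmult:
  "x \<in> characters A \<Longrightarrow> f \<in> reps A \<Longrightarrow> x (abs_linf (\<lambda>z. c * f z)) = c * x (abs_linf f)"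
  by (auto simp: characters_def reps_def simp flip: abs_linf_scaleC)

lemma character_const:
  assumes x: "x \<in> characters A"
  shows "x (abs_linf (\<lambda>_. c)) = c"
proof -
  obtain F where "F \<in> A" "x F \<noteq> 0" using x by (auto simp: characters_def)
  then obtain f where f: "f \<in> reps A" "x (abs_linf f) \<noteq> 0" by (metis in_reps_obtain)
  have "x (abs_linf f) * 1 = x (abs_linf f) * x (abs_linf (\<lambda>_. 1))"
    using character_mult[OF x f(1) reps_const[OF A, of 1]] by simp
  then have "x (abs_linf (\<lambda>_. 1)) = 1" using f(2) by (simp only: mult_cancel_left) simp
  then show ?thesis using character_cmult[OF x reps_const[OF A, of 1], of c] by simp
qed

lemma character_minus:
  assumes "x \<in> characters A" "f \<in> reps A" "g \<in> reps A"
  shows "x (abs_linf (\<lambda>z. f z - g z)) = x (abs_linf f) - x (abs_linf g)"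
  using character_add[OF assms(1,2) reps_mult[OF A reps_const[OF A, of "-1"] assms(3)]]
    character_cmult[OF assms(1,3), of "-1"] by simp

lemma character_power:
  assumes "x \<in> characters A" "f \<in> reps A"
  shows "x (abs_linf (\<lambda>z. f z ^ n)) = x (abs_linf f) ^ n"
  by (induction n)
     (auto simp: character_const[OF assms(1)] character_mult[OF assms reps_power[OF A assms(2)]])

lemma character_bound:
  assumes x: "x \<in> characters A" and f: "f \<in> reps A" and c: "AE z in \<mu>. cmod (f z) \<le> c"
  shows "cmod (x (abs_linf f)) \<le> c"
proof (rule multiplicative_functional_bound[OF A, of "\<lambda>f. x (abs_linf f)", OF _ _ _ _ f c])
  show "x (abs_linf g) = x (abs_linf h)"
    if "g \<in> reps A" "h \<in> reps A" "AE z in \<mu>. g z = h z" for g h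
    using that abs_linf_eq_iff[of g h] by (simp add: reps_ess_bounded)
qed (use x in \<open>simp_all add: character_mult character_minus character_const\<close>)

text \<open>Evaluating \<open>x\<close> at \<open>g ^ n * f\<close> and letting \<open>n\<close> tend to infinity removes the factor \<open>f\<close>.\<close>

lemma character_bound_on_support:
  assumes x: "x \<in> characters A" and f: "f \<in> reps A" "x (abs_linf f) \<noteq> 0" and g: "g \<in> reps A"
    and s: "0 \<le> s" "AE z in \<mu>. f z \<noteq> 0 \<longrightarrow> cmod (g z) \<le> s"
  shows "cmod (x (abs_linf g)) \<le> s"
proof (rule ccontr)
  define t where "t = cmod (x (abs_linf g))"
  assume "\<not> ?thesis"
  then have t: "s < t" "0 < t" using s by (auto simp: t_def)
  obtain M where M: "M > 0" "AE z in \<mu>. cmod (f z) \<le> M"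
    using ess_bounded_pos_bound[OF reps_ess_bounded[OF f(1)]] by metis
  have le: "t ^ n * cmod (x (abs_linf f)) \<le> s ^ n * M" for n
  proof -
    have gn: "(\<lambda>z. g z ^ n) \<in> reps A" by (intro reps_power A g)
    have "cmod (x (abs_linf (\<lambda>z. g z ^ n * f z))) \<le> s ^ n * M"
    proof (rule character_bound[OF x])
      show "AE z in \<mu>. cmod (g z ^ n * f z) \<le> s ^ n * M"
        using M(2) s(2)
      proof eventually_elim
        case (elim z)
        show ?case
        proof (cases "f z = 0")
          case False
          then show ?thesis
            using elim M s by (auto simp: norm_mult norm_power intro!: mult_mono power_mono)
        qed (use M s in simp)
      qed
    qed (intro reps_mult A gn f)
    then show ?thesis
      by (simp add: character_mult[OF x gn f(1)] character_power[OF x g] norm_mult norm_power t_def)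
  qed
  have "0 < cmod (x (abs_linf f)) / M" using f(2) M by simp
  moreover have "s / t < 1" using t by simp
  ultimately obtain n where n: "(s / t) ^ n < cmod (x (abs_linf f)) / M"
    using real_arch_pow_inv by blast
  have "s ^ n / t ^ n < cmod (x (abs_linf f)) / M" using n by (simp add: power_divide)
  then have "s ^ n * M < t ^ n * cmod (x (abs_linf f))"
    using M t by (simp add: field_simps)
  then show False using le[of n] by simp
qed

lemma gelfand_open_basic:
  assumes "finite G" "G \<subseteq> A"
  shows "openin (gelfand_topology A) {y \<in> characters A. \<forall>F\<in>G. cmod (y F - c F) < e}"
  using assms
proof (induction G)
  case empty
  then show ?case using openin_topspace[of "gelfand_topology A"] by simp
next
  case (insert F G)
  have "continuous_map (gelfand_topology A) euclidean (\<lambda>y. y F)"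
    unfolding gelfand_topology_def using insert.prems
    by (intro continuous_map_from_subtopology continuous_map_product_projection) auto
  then have "openin (gelfand_topology A) {y \<in> topspace (gelfand_topology A). y F \<in> ball (c F) e}"
    by (rule openin_continuous_map_preimage) simp
  then have "openin (gelfand_topology A) ({y \<in> topspace (gelfand_topology A). y F \<in> ball (c F) e} \<inter>
      {y \<in> characters A. \<forall>F\<in>G. cmod (y F - c F) < e})"
    using insert by (intro openin_Int) auto
  also have "{y \<in> topspace (gelfand_topology A). y F \<in> ball (c F) e} \<inter>
      {y \<in> characters A. \<forall>F\<in>G. cmod (y F - c F) < e} =
      {y \<in> characters A. \<forall>F\<in>insert F G. cmod (y F - c F) < e}"
    by (auto simp: dist_norm norm_minus_commute)
  finally show ?case .
qed

lemma gelfand_open_neighbourhood: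
  assumes V: "openin (gelfand_topology A) V" and x: "x \<in> V"
  obtains G e where "finite G" "G \<subseteq> A" "e > 0"
    "{y \<in> characters A. \<forall>F\<in>G. cmod (y F - x F) < e} \<subseteq> V"
proof -
  obtain T where T: "openin (product_topology (\<lambda>_. euclidean) A) T" "V = T \<inter> characters A"
    using V unfolding gelfand_topology_def openin_subtopology by blast
  obtain U where U: "finite {F \<in> A. U F \<noteq> topspace euclidean}" "\<forall>F\<in>A. openin euclidean (U F)"
      "x \<in> Pi\<^sub>E A U" "Pi\<^sub>E A U \<subseteq> T"
    using T x unfolding openin_product_topology_alt by blast
  define G where "G = {F \<in> A. U F \<noteq> topspace euclidean}"
  have "\<exists>e>0. \<forall>F\<in>H. ball (x F) e \<subseteq> U F" if "finite H" "H \<subseteq> A" for H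
    using that
  proof (induction H)
    case empty
    show ?case by (intro exI[of _ 1]) auto
  next
    case (insert F H)
    then obtain e where e: "e > 0" "\<forall>F\<in>H. ball (x F) e \<subseteq> U F" by auto
    have "open (U F)" "x F \<in> U F" using U(2,3) insert.prems by (auto simp: PiE_def Pi_def)
    then obtain d where d: "d > 0" "ball (x F) d \<subseteq> U F" using open_contains_ball by blast
    show ?case
      using e d by (intro exI[of _ "min e d"]) (auto simp: ball_def subset_eq)
  qed
  then obtain e where e: "e > 0" "\<forall>F\<in>G. ball (x F) e \<subseteq> U F"
    using U(1) unfolding G_def by (metis (no_types, lifting) mem_Collect_eq subsetI)
  show thesis
  proof (rule that[of G e])
    show "{y \<in> characters A. \<forall>F\<in>G. cmod (y F - x F) < e} \<subseteq> V"
    proof clarify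
      fix y assume y: "y \<in> characters A" "\<forall>F\<in>G. cmod (y F - x F) < e"
      have "y F \<in> U F" if "F \<in> A" for F
      proof (cases "F \<in> G")
        case True
        then have "y F \<in> ball (x F) e" using y(2) by (simp add: dist_norm norm_minus_commute)
        then show ?thesis using e(2) True by blast
      next
        case False
        then show ?thesis using that by (auto simp: G_def)
      qed
      moreover have "y \<in> extensional A" using y(1) by (simp add: characters_def)
      ultimately have "y \<in> Pi\<^sub>E A U" by (simp add: PiE_def)
      then show "y \<in> V" using U(4) T(2) y(1) by blast
    qed
  qed (use U(1) e G_def in auto)
qed

end

text \<open>
  The characters at which every finite family of elements of \<open>A\<close> takes values in its joint essential
  range. They are the restrictions to \<open>A\<close> of characters of \<open>L\<^sup>\<infinity>\<close>.
\<close>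

definition boundary_characters :: "linf set \<Rightarrow> (linf \<Rightarrow> complex) set" where
  "boundary_characters A = {x \<in> characters A. \<forall>G e. finite G \<longrightarrow> G \<subseteq> reps A \<longrightarrow> e > 0 \<longrightarrow>
     \<not> (AE z in \<mu>. \<exists>g\<in>G. e \<le> cmod (g z - x (abs_linf g)))}"

text \<open>A gap \<open>e\<close> between \<open>x\<close> and the values of a finite family
  persists with gap e / 2 for all characters within e / 2 of \<open>x\<close> on that
  family.\<close>

lemma boundary_characters_closed:
  assumes A: "closed_subalgebra A"
  shows "closedin (gelfand_topology A) (boundary_characters A)"
  unfolding closedin_def topspace_gelfand_topology
proof (intro conjI)
  show "boundary_characters A \<subseteq> characters A" by (auto simp: boundary_characters_def)
  show "openin (gelfand_topology A) (characters A - boundary_characters A)"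
  proof (subst openin_subopen, intro ballI)
    fix x assume x: "x \<in> characters A - boundary_characters A"
    then obtain G e where G: "finite G" "G \<subseteq> reps A" "e > 0"
        "AE z in \<mu>. \<exists>g\<in>G. e \<le> cmod (g z - x (abs_linf g))"
      unfolding boundary_characters_def by blast
    define U where "U = {y \<in> characters A. \<forall>F\<in>abs_linf ` G. cmod (y F - x F) < e / 2}"
    have "openin (gelfand_topology A) U"
      unfolding U_def by (rule gelfand_open_basic[OF A]) (use G in \<open>auto simp: reps_def\<close>)
    moreover have "x \<in> U" using x G(3) by (simp add: U_def)
    moreover have "U \<subseteq> characters A - boundary_characters A"
    proof
      fix y assume y: "y \<in> U"
      have "AE z in \<mu>. \<exists>g\<in>G. e / 2 \<le> cmod (g z - y (abs_linf g))"
        using G(4)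
      proof eventually_elim
        case (elim z)
        then obtain g where g: "g \<in> G" "e \<le> cmod (g z - x (abs_linf g))" by blast
        have "cmod (y (abs_linf g) - x (abs_linf g)) < e / 2" using y g(1) by (auto simp: U_def)
        moreover have "cmod (g z - x (abs_linf g)) \<le>
            cmod (g z - y (abs_linf g)) + cmod (y (abs_linf g) - x (abs_linf g))"
          using norm_triangle_ineq[of "g z - y (abs_linf g)" "y (abs_linf g) - x (abs_linf g)"] by simp
        ultimately show ?case using g by (intro bexI[of _ g]) auto
      qed
      moreover have "e / 2 > 0" using G(3) by simp
      ultimately have "y \<notin> boundary_characters A"
        using G(1,2) unfolding boundary_characters_def by blast
      then show "y \<in> characters A - boundary_characters A" using y by (simp add: U_def)
    qed
    ultimately show "\<exists>T. openin (gelfand_topology A) T \<and> x \<in> T \<and> T \<subseteq> characters A - boundary_characters A"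
      by blast
  qed
qed

lemma rep_linf: "ess_bounded (rep_linf F)" "abs_linf (rep_linf F) = F"
  using Quotient_rep_reflp[OF Quotient_linf, of F] Quotient_abs_rep[OF Quotient_linf, of F] by auto

text \<open>Limits along an ultrafilter finer than the almost-everywhere filter exist, depend only
  on the class, and respect sums and products.\<close>

lemma boundary_character_of_ultrafilter:
  assumes A: "closed_subalgebra A"
    and F: "F \<noteq> bot" "F \<le> ae_filter \<mu>" "\<forall>P. eventually P F \<or> eventually (\<lambda>x. \<not> P x) F"
  obtains x where "x \<in> boundary_characters A" "\<forall>f\<in>reps A. (f \<longlongrightarrow> x (abs_linf f)) F"
proof -
  have ae: "eventually P F" if "AE z in \<mu>. P z" for P
    using that F(2) by (rule filter_leD[rotated])
  have conv: "\<exists>l. (f \<longlongrightarrow> l) F" if f: "ess_bounded f" for f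
  proof -
    obtain M where "AE z in \<mu>. cmod (f z) \<le> M" using f unfolding ess_bounded_iff by blast
    then show ?thesis by (intro ultrafilter_convergent[OF F(1,3)] ae)
  qed
  \<comment> \<open>One representative per class is fixed for the definition; the restriction to
    \<open>A\<close> makes the functional extensional, as characters are required to be.\<close>
  define x where "x = (\<lambda>G\<in>A. SOME l. (rep_linf G \<longlongrightarrow> l) F)"
  have lim: "(f \<longlongrightarrow> x (abs_linf f)) F" if f: "f \<in> reps A" for f
  proof -
    define G where "G = abs_linf f"
    have "G \<in> A" using f by (simp add: G_def reps_def)
    then have "(rep_linf G \<longlongrightarrow> x G) F"
      using someI_ex[OF conv[OF rep_linf(1)[of G]]] by (simp add: x_def)
    moreover have "AE z in \<mu>. rep_linf G z = f z"
      using rep_linf[of G] f abs_linf_eq_iff by (metis G_def reps_ess_bounded)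
    ultimately show ?thesis unfolding G_def[symmetric] by (rule Lim_transform_eventually[OF _ ae])
  qed
  have eqI: "x (abs_linf f) = l" if "f \<in> reps A" "(f \<longlongrightarrow> l) F" for f l
    using tendsto_unique[OF F(1) lim[OF that(1)] that(2)] .
  have char: "x \<in> characters A"
    unfolding characters_def
  proof (intro CollectI conjI ballI allI)
    show "x \<in> extensional A" by (simp add: x_def)
    fix P Q assume "P \<in> A" "Q \<in> A"
    then obtain f g where fg: "f \<in> reps A" "P = abs_linf f" "g \<in> reps A" "Q = abs_linf g"
      by (metis in_reps_obtain)
    show "x (P + Q) = x P + x Q"
      unfolding fg(2,4) abs_linf_add[OF fg(1,3)[THEN reps_ess_bounded]]
      by (intro eqI reps_add A fg tendsto_add lim)
    show "x (P * Q) = x P * x Q"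
      unfolding fg(2,4) abs_linf_mult[OF fg(1,3)[THEN reps_ess_bounded]]
      by (intro eqI reps_mult A fg tendsto_mult lim)
  next
    fix c P assume "P \<in> A"
    then obtain f where f: "f \<in> reps A" "P = abs_linf f" by (metis in_reps_obtain)
    show "x (c *\<^sub>C P) = c * x P"
      unfolding f(2) abs_linf_scaleC[OF reps_ess_bounded[OF f(1)]]
      by (intro eqI reps_mult reps_const A f tendsto_mult tendsto_const lim)
  next
    have "x (abs_linf (\<lambda>_. 1)) = 1" by (intro eqI reps_const A tendsto_const)
    moreover have "abs_linf (\<lambda>_. 1) \<in> A" using reps_const[OF A, of 1] by (simp add: reps_def)
    ultimately show "\<exists>f\<in>A. x f \<noteq> 0" by (metis zero_neq_one)
  qed
  have "x \<in> boundary_characters A"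
    unfolding boundary_characters_def
  proof (intro CollectI conjI char allI impI notI)
    fix G and e :: real
    assume G: "finite G" "G \<subseteq> reps A" "e > 0" "AE z in \<mu>. \<exists>g\<in>G. e \<le> cmod (g z - x (abs_linf g))"
    \<comment> \<open>A finite family is eventually close to all its limits at once, which
      contradicts a gap that holds almost everywhere.\<close>
    have "eventually (\<lambda>z. \<forall>g\<in>G. dist (g z) (x (abs_linf g)) < e) F"
      using G by (intro eventually_ball_finite ballI tendstoD lim) auto
    with ae[OF G(4)] have "eventually (\<lambda>_. False) F"
      by eventually_elim (force simp: dist_norm)
    then show False using F(1) by (simp add: eventually_False)
  qed
  then show thesis using that lim by blast
qed

text \<open>An ultrafilter along which |f| tends to its essential supremum gives a character
  attaining the norm of \<open>f\<close>, and no character exceeds the norm.\<close>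

lemma boundary_characters_attain_norm:
  assumes A: "closed_subalgebra A" and f: "f \<in> reps A"
  obtains x where "x \<in> boundary_characters A" "\<forall>y\<in>characters A. cmod (y (abs_linf f)) \<le> cmod (x (abs_linf f))"
proof -
  define c where "c = norm (abs_linf f)"
  have fc: "AE z in \<mu>. cmod (f z) \<le> c"
    using norm_abs_linf_le_iff[OF reps_ess_bounded[OF f], of c] by (simp add: c_def)
  define F0 where "F0 = inf (ae_filter \<mu>) (filtercomap (\<lambda>z. cmod (f z)) (nhds c))"
  have "F0 \<noteq> bot"
  proof
    assume "F0 = bot"
    then have "eventually (\<lambda>_. False) F0" by simp
    then obtain P Q where PQ: "AE z in \<mu>. P z" "eventually Q (filtercomap (\<lambda>z. cmod (f z)) (nhds c))"
      "\<And>z. P z \<Longrightarrow> Q z \<Longrightarrow> False" unfolding F0_def eventually_inf by auto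
    obtain S where S: "eventually S (nhds c)" "\<And>z. S (cmod (f z)) \<Longrightarrow> Q z"
      using PQ(2) unfolding eventually_filtercomap by blast
    obtain d where d: "d > 0" "\<And>t. dist t c < d \<Longrightarrow> S t"
      using S(1) unfolding eventually_nhds_metric by blast
    have "AE z in \<mu>. cmod (f z) \<le> c - d"
      using PQ(1) fc
    proof eventually_elim
      case (elim z)
      then have "\<not> dist (cmod (f z)) c < d" using PQ(3) S(2) d(2) by blast
      then show ?case using elim(2) by (simp add: dist_real_def)
    qed
    then have "c \<le> c - d"
      using norm_abs_linf_le_iff[OF reps_ess_bounded[OF f]] by (simp add: c_def)
    then show False using d(1) by simp
  qed
  then obtain F where F: "F \<noteq> bot" "F \<le> F0" "\<forall>P. eventually P F \<or> eventually (\<lambda>x. \<not> P x) F"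
    by (rule ultrafilter_exists)
  have "F \<le> ae_filter \<mu>" using F(2) by (simp add: F0_def)
  then obtain x where x: "x \<in> boundary_characters A" "\<forall>f\<in>reps A. (f \<longlongrightarrow> x (abs_linf f)) F"
    by (rule boundary_character_of_ultrafilter[OF A F(1) _ F(3)])
  have "F \<le> filtercomap (\<lambda>z. cmod (f z)) (nhds c)" using F(2) by (simp add: F0_def)
  then have "((\<lambda>z. cmod (f z)) \<longlongrightarrow> c) F"
    by (rule filterlim_mono[OF filterlim_filtercomap order_refl])
  moreover have "((\<lambda>z. cmod (f z)) \<longlongrightarrow> cmod (x (abs_linf f))) F"
    by (rule tendsto_norm[OF x(2)[rule_format, OF f]])
  ultimately have "cmod (x (abs_linf f)) = c" using tendsto_unique[OF F(1)] by blast
  then show thesis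
    using that[OF x(1)] character_bound[OF A _ f fc] by metis
qed

text \<open>Multiplying by an inner function turns the indicator of a small neighbourhood into an element of \<open>D\<close>.\<close>

lemma boundary_character_separated:
  assumes D: "douglas_algebra D" and x: "x \<in> boundary_characters D"
    and V: "openin (gelfand_topology D) V" "x \<in> V"
  obtains F where "F \<in> D" "x F \<noteq> 0" "\<forall>y\<in>characters D. y \<notin> V \<longrightarrow> y F = 0"
proof -
  note A = closed_unital_douglas[OF D]
  obtain G e where G: "finite G" "G \<subseteq> D" "e > 0"
    and GV: "{y \<in> characters D. \<forall>F\<in>G. cmod (y F - x F) < e} \<subseteq> V"
    by (rule gelfand_open_neighbourhood[OF A V])
  have repD: "rep_linf H \<in> reps D" if "H \<in> G" for H
    using that G(2) rep_linf[of H] by (auto simp: reps_def)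
  have [measurable]: "rep_linf H \<in> borel_measurable \<mu>" for H
    using rep_linf(1) ess_bounded_measurable by blast
  define E where "E = {z \<in> space \<mu>. \<forall>H\<in>G. cmod (rep_linf H z - x H) < e / 2}"
  have E: "E \<in> sets \<mu>" unfolding E_def using G(1) by measurable
  obtain R where R: "unimodular R" "(\<lambda>z. R z * indicator E z) \<in> reps D"
    by (rule inner_times_indicator_in_douglas[OF D E])
  define f where "f z = R z * indicator E z" for z
  have f: "f \<in> reps D" unfolding f_def by (rule R(2))
  have xc: "x \<in> characters D" using x by (simp add: boundary_characters_def)
  show thesis
  proof (rule that[of "abs_linf f"])
    show "abs_linf f \<in> D" using f by (simp add: reps_def)
    show "x (abs_linf f) \<noteq> 0"
    proof
      assume 0: "x (abs_linf f) = 0"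
      define d where "d = min (e / 2) 1"
      have d: "d > 0" "d \<le> e / 2" "d \<le> 1" using G(3) by (auto simp: d_def)
      have "AE z in \<mu>. \<exists>g\<in>insert f (rep_linf ` G). d \<le> cmod (g z - x (abs_linf g))"
        using R(1) AE_space
      proof eventually_elim
        case (elim z)
        show ?case
        proof (cases "z \<in> E")
          case True
          then have "d \<le> cmod (f z - x (abs_linf f))" using elim d 0 by (simp add: f_def)
          then show ?thesis by blast
        next
          case False
          then obtain H where H: "H \<in> G" "e / 2 \<le> cmod (rep_linf H z - x H)"
            using elim by (auto simp: E_def not_less)
          then have "d \<le> cmod (rep_linf H z - x (abs_linf (rep_linf H)))"
            using d by (simp add: rep_linf)
          then show ?thesis using H(1) by blast
        qed
      qed
      moreover have "finite (insert f (rep_linf ` G))" "insert f (rep_linf ` G) \<subseteq> reps D"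
        using G(1) f repD by auto
      ultimately show False using x d(1) unfolding boundary_characters_def by blast
    qed
    show "\<forall>y\<in>characters D. y \<notin> V \<longrightarrow> y (abs_linf f) = 0"
    proof (intro ballI impI, rule ccontr)
      fix y assume y: "y \<in> characters D" "y \<notin> V"
      assume nz: "y (abs_linf f) \<noteq> 0"
      have "cmod (y H - x H) < e" if H: "H \<in> G" for H
      proof -
        have g: "(\<lambda>z. rep_linf H z - x H) \<in> reps D" by (intro reps_minus reps_const A repD H)
        have "cmod (y (abs_linf (\<lambda>z. rep_linf H z - x H))) \<le> e / 2"
        proof (rule character_bound_on_support[OF A y(1) f nz g])
          show "AE z in \<mu>. f z \<noteq> 0 \<longrightarrow> cmod (rep_linf H z - x H) \<le> e / 2"
            using H by (intro AE_I2) (auto simp: f_def E_def indicator_def less_imp_le)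
        qed (use G(3) in simp)
        moreover have "y (abs_linf (\<lambda>z. rep_linf H z - x H)) = y H - x H"
          using character_minus[OF A y(1) repD[OF H] reps_const[OF A]] character_const[OF A y(1)]
          by (simp add: rep_linf)
        ultimately show ?thesis using G(3) by simp
      qed
      then show False using GV y by blast
    qed
  qed
qed

lemma closed_boundary_boundary_characters:
  assumes A: "closed_subalgebra A"
  shows "closed_boundary A (boundary_characters A)"
  unfolding closed_boundary_def
proof (intro conjI ballI)
  fix F assume "F \<in> A"
  then obtain f where f: "f \<in> reps A" "F = abs_linf f" by (rule in_reps_obtain)
  show "\<exists>x\<in>boundary_characters A. \<forall>y\<in>characters A. cmod (y F) \<le> cmod (x F)"
    unfolding f(2) by (rule boundary_characters_attain_norm[OF A f(1)]) blast
qed (rule boundary_characters_closed[OF A])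

lemma shilov_boundary_douglas:
  assumes D: "douglas_algebra D"
  shows "shilov_boundary D = boundary_characters D"
  unfolding shilov_boundary_def
proof (rule Least_equality)
  show "closed_boundary D (boundary_characters D)"
    by (rule closed_boundary_boundary_characters[OF closed_unital_douglas[OF D]])
  fix E assume E: "closed_boundary D E"
  show "boundary_characters D \<subseteq> E"
  proof (rule subsetI, rule ccontr)
    fix x assume x: "x \<in> boundary_characters D" "x \<notin> E"
    have xc: "x \<in> characters D" using x(1) by (simp add: boundary_characters_def)
    have EV: "openin (gelfand_topology D) (characters D - E)" "E \<subseteq> characters D"
      using E unfolding closed_boundary_def closedin_def by auto
    obtain F where F: "F \<in> D" "x F \<noteq> 0" "\<forall>y\<in>characters D. y \<notin> characters D - E \<longrightarrow> y F = 0"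
      by (rule boundary_character_separated[OF D x(1) EV(1)]) (use x(2) xc in auto)
    obtain y where y: "y \<in> E" "cmod (x F) \<le> cmod (y F)"
      using E F(1) xc unfolding closed_boundary_def by blast
    then have "y F = 0" using F(3) EV(2) by blast
    then show False using y(2) F(2) by simp
  qed
qed

theorem corollary3p2:
  fixes D :: "linf set"
  assumes "douglas_algebra D"
  shows "hk_continuity_points D = shilov_boundary D"
proof -
  have sub: "complex_subalgebra D" using assms by (simp add: douglas_algebra_def)
  note A = closed_unital_douglas[OF assms]
  have "hk_continuity_points D = boundary_characters D"
  proof (intro subset_antisym subsetI)
    fix x assume "x \<in> hk_continuity_points D"
    then have x: "x \<in> characters D" and cont: "topcontinuous_at (hk_topology D) (gelfand_topology D) id x"
      by (auto simp: hk_continuity_points_def)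
    show "x \<in> boundary_characters D"
    proof (rule ccontr)
      assume nx: "x \<notin> boundary_characters D"
      have "openin (gelfand_topology D) (characters D - boundary_characters D)"
        using boundary_characters_closed[OF A] by (simp add: closedin_def)
      then obtain U where U: "openin (hk_topology D) U" "x \<in> U" "\<forall>y\<in>U. y \<in> characters D - boundary_characters D"
        using cont x nx unfolding topcontinuous_at_def by (metis DiffI id_apply)
      then have "hk_closed D (characters D - U)" by (simp add: openin_hk_topology[OF sub])
      then obtain F where F: "F \<in> D" "\<forall>y\<in>characters D - U. y F = 0" "x F \<noteq> 0"
        using hk_closedD[of D "characters D - U" x] x U(2) by auto
      obtain y where y: "y \<in> boundary_characters D" "cmod (x F) \<le> cmod (y F)"
        using closed_boundary_boundary_characters[OF A] F(1) x unfolding closed_boundary_def by blast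
      have "y \<in> characters D" "y \<notin> U" using y(1) U(3) by (simp add: boundary_characters_def, blast)
      then have "y F = 0" using F(2) by blast
      then show False using y(2) F(3) by simp
    qed
  next
    fix x assume x: "x \<in> boundary_characters D"
    then have xc: "x \<in> characters D" by (simp add: boundary_characters_def)
    have "topcontinuous_at (hk_topology D) (gelfand_topology D) id x"
      unfolding topcontinuous_at_def topspace_hk_topology[OF sub] topspace_gelfand_topology
    proof (intro conjI allI impI)
      fix V assume V: "openin (gelfand_topology D) V \<and> id x \<in> V"
      obtain F where F: "F \<in> D" "x F \<noteq> 0" "\<forall>y\<in>characters D. y \<notin> V \<longrightarrow> y F = 0"
        by (rule boundary_character_separated[OF assms x]) (use V in auto)
      show "\<exists>U. openin (hk_topology D) U \<and> x \<in> U \<and> (\<forall>y\<in>U. id y \<in> V)"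
      proof (intro exI conjI)
        show "openin (hk_topology D) {y \<in> characters D. y F \<noteq> 0}"
          unfolding openin_hk_topology[OF sub]
          by (auto intro!: hk_closedI bexI[of _ F] F(1))
      qed (use xc F in auto)
    qed (use xc in auto)
    then show "x \<in> hk_continuity_points D" using xc by (simp add: hk_continuity_points_def)
  qed
  then show ?thesis using shilov_boundary_douglas[OF assms] by simp
qed

end
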